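(* Indices are taken modulo 4. Let $\mathcal{A}\subset[0,\pi)^4$ be the set of $(\alpha_1,\dots,\alpha_4)$ for which there exists a hyperbolic (tetragonal) trapezohedron with dihedral angle $\alpha_i$ at $\hat L_i$ and dihedral angle $\pi/2$ at all other edges, and let $\mathcal{A}'=\{(\cos\alpha_1,\dots,\cos\alpha_4) \mid (\alpha_1,\dots,\alpha_4)\in\mathcal{A}\}\subset(-1,1]^4$. For $1\le i\le 4$ define $$\Phi_i(c_1,\dots,c_4)=c_ic_{i+1}(c_ic_{i+1}+1)c_{i+2}c_{i+3}-c_ic_{i+1}(c_i+c_{i+1})(c_{i+2}+c_{i+3})+(c_i+c_{i+1})^2-c_ic_{i+1}-1.$$ Let $\partial\mathcal{A}'$ denote the frontier of $\mathcal{A}'$ in $(-1,1]^4$. Then $$\mathcal{A}'=\{(c_1,\dots,c_4)\in(-1,1]^4 \mid \text{for any } i,\ \Phi_i(c_1,\dots,c_4)<0 \text{ or } c_i+c_{i+1}>0\},$$ and $\partial\mathcal{A}'=\bigcup_{i=1}^4\partial_i\mathcal{A}'$, where $$\partial_i\mathcal{A}'=\{(c_1,\dots,c_4)\in(-1,1]^4\mid \Phi_i(c_1,\dots,c_4)=0,\ c_i+c_{i+1}\le 0,\ c_i\le c_{i+2},\ c_{i+1}\le c_{i+3}\}.$$ As $(c_1,\dots,c_4)\in\mathcal{A}'$ approaches $\partial_i\mathcal{A}'$, the edge between $\hat L_i$ and $\hat L_{i+1}$ of the corresponding trapezohedron degenerates (its two endpoints coincide in the limit). In particular, $\mathcal{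A}'\ne(-1,1]^4$.
   Context: A (hyperbolic tetragonal) trapezohedron is a convex finite-volume polyhedron in $\mathbb{H}^3$ with totally geodesic faces and the following combinatorial type (indices modulo 4): it has two 4-valent vertices $v_+,v_-$ and trivalent vertices $\widetilde P_i,\widetilde Q_i$ ($1\le i\le 4$); its edges are $v_+\widetilde P_i$, $v_-\widetilde Q_i$, $\hat L_i=\widetilde P_i\widetilde Q_i$, and $\widetilde Q_i\widetilde P_{i+1}$ (the last is called the edge between $\hat L_i$ and $\hat L_{i+1}$); its faces are the eight quadrilaterals $v_-\widetilde Q_{i-1}\widetilde P_i\widetilde Q_i$ and $v_+\widetilde P_i\widetilde Q_i\widetilde P_{i+1}$. The vertices $v_\pm$ are ideal. The dihedral angle at $\hat L_i$ is $\alpha_i\in[0,\pi)$ and the dihedral angle at every other edge is $\pi/2$. If $\alpha_i=0$, then $\hat L_i$ degenerates to an ideal vertex $\widetilde P_i=\widetilde Q_i$; the term trapezohedron also covers such degenerated polyhedra. The trapezohedron with given dihedral angles $(\alpha_1,\dots,\alpha_4)\in\mathcal{A}$ is unique up to label-preserving isometry, and "the corresponding trapezohedron" of $(c_1,\dots,c_4)\in\mathcal{A}'$ is the one with $\cos\alpha_i=c_i$. *)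

theory Defs
  imports "HOL-Analysis.Analysis"
begin

text \<open>
  Hyperbolic space is the projective (Klein) model: the open unit ball of \<^typ>\<open>real^3\<close>, with the
  unit sphere as its ideal boundary.  Totally geodesic planes are the nonempty intersections of
  affine planes with the ball, so faces of a hyperbolic polyhedron, ideal vertices included, are
  the faces of its Euclidean closure.  Indices modulo 4 are elements of the type \<^typ>\<open>4\<close>, whose
  arithmetic is modular.
\<close>

definition hyp_space :: "(real^3) set"
  where "hyp_space = ball 0 1"

definition hyp_dist :: "real^3 \<Rightarrow> real^3 \<Rightarrow> real"
  where "hyp_dist x y =
    arcosh ((1 - x \<bullet> y) / (sqrt (1 - (norm x)\<^sup>2) * sqrt (1 - (norm y)\<^sup>2)))"

text \<open>The Riemannian volume of the Klein model in dimension \<open>n\<close> has density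
  \<open>(1 - |x|^2) powr (- (n + 1) / 2)\<close>.\<close>

definition hyp_volume :: "(real^3) set \<Rightarrow> ennreal"
  where "hyp_volume K = (\<integral>\<^sup>+ x \<in> K. ennreal (1 / (1 - (norm x)\<^sup>2)\<^sup>2) \<partial>lborel)"

definition finite_volume_polyhedron :: "(real^3) set \<Rightarrow> bool"
  where "finite_volume_polyhedron K \<longleftrightarrow>
    (\<exists>S. polyhedron S \<and> K = S \<inter> hyp_space) \<and> interior K \<noteq> {} \<and> hyp_volume K < \<infinity>"

text \<open>In homogeneous coordinates a point \<open>x\<close> is \<open>(x, 1)\<close> and the half-space \<open>a \<bullet> x \<le> b\<close> has
  outward normal \<open>(a, b)\<close> with respect to the Lorentzian form.  Two half-spaces with unit outward
  normals \<open>n\<close> and \<open>m\<close> bound a wedge with dihedral angle \<open>\<theta>\<close> where \<open>cos \<theta> = - lorentz n m\<close>.\<close>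

definition lorentz :: "(real^3) \<times> real \<Rightarrow> (real^3) \<times> real \<Rightarrow> real"
  where "lorentz n m = fst n \<bullet> fst m - snd n * snd m"

definition outward_unit_normal :: "(real^3) set \<Rightarrow> (real^3) set \<Rightarrow> (real^3) \<times> real \<Rightarrow> bool"
  where "outward_unit_normal T F n \<longleftrightarrow>
    T \<subseteq> {x. fst n \<bullet> x \<le> snd n} \<and> F = T \<inter> {x. fst n \<bullet> x = snd n} \<and> lorentz n n = 1"

definition has_dihedral_angle :: "(real^3) set \<Rightarrow> (real^3) set \<Rightarrow> real \<Rightarrow> bool"
  where "has_dihedral_angle T e \<theta> \<longleftrightarrow>
    e edge_of T \<and> 0 \<le> \<theta> \<and> \<theta> \<le> pi \<and>
    (\<exists>F G n m. F facet_of T \<and> G facet_of T \<and> F \<noteq> G \<and> e = F \<inter> G \<and>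
       outward_unit_normal T F n \<and> outward_unit_normal T G m \<and> cos \<theta> = - lorentz n m)"

text \<open>\<open>K\<close> is the polyhedron in hyperbolic space and \<open>vp\<close>, \<open>vm\<close>, \<open>P i\<close>, \<open>Q i\<close> are its labelled
  (possibly ideal) vertices.  For \<open>\<alpha> $ i = 0\<close> the edge from \<open>P i\<close> to \<open>Q i\<close> is replaced by the
  ideal vertex \<open>P i = Q i\<close>, and the quadrilaterals containing it lose a vertex.\<close>

definition trapezohedron ::
    "(real^3) set \<Rightarrow> real^3 \<Rightarrow> real^3 \<Rightarrow> (4 \<Rightarrow> real^3) \<Rightarrow> (4 \<Rightarrow> real^3) \<Rightarrow> real^4 \<Rightarrow> bool"
  where "trapezohedron K vp vm P Q \<alpha> \<longleftrightarrow>
    finite_volume_polyhedron K \<and>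
    \<comment> \<open>vertices\<close>
    {x. x extreme_point_of closure K} = {vp, vm} \<union> range P \<union> range Q \<and>
    vp \<noteq> vm \<and> {vp, vm} \<inter> (range P \<union> range Q) = {} \<and> inj P \<and> inj Q \<and>
    (\<forall>i j. P i = Q j \<longleftrightarrow> i = j \<and> \<alpha> $ i = 0) \<and>
    norm vp = 1 \<and> norm vm = 1 \<and> (\<forall>i. \<alpha> $ i = 0 \<longrightarrow> norm (P i) = 1) \<and>
    \<comment> \<open>edges\<close>
    {e. e edge_of closure K} =
      (\<Union>i. {closed_segment vp (P i), closed_segment vm (Q i), closed_segment (Q i) (P (i + 1))}) \<union>
      {closed_segment (P i) (Q i) | i. \<alpha> $ i \<noteq> 0} \<and>
    \<comment> \<open>faces\<close>
    {F. F facet_of closure K} =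
      (\<Union>i. {convex hull {vm, Q (i - 1), P i, Q i}, convex hull {vp, P i, Q i, P (i + 1)}}) \<and>
    \<comment> \<open>dihedral angles\<close>
    (\<forall>i. 0 \<le> \<alpha> $ i \<and> \<alpha> $ i < pi) \<and>
    (\<forall>i. \<alpha> $ i \<noteq> 0 \<longrightarrow> has_dihedral_angle (closure K) (closed_segment (P i) (Q i)) (\<alpha> $ i)) \<and>
    (\<forall>i. has_dihedral_angle (closure K) (closed_segment vp (P i)) (pi / 2) \<and>
         has_dihedral_angle (closure K) (closed_segment vm (Q i)) (pi / 2) \<and>
         has_dihedral_angle (closure K) (closed_segment (Q i) (P (i + 1))) (pi / 2))"

definition angle_set :: "(real^4) set"  (\<open>\<A>\<close>)
  where "\<A> = {\<alpha>. (\<forall>i. 0 \<le> \<alpha> $ i \<and> \<alpha> $ i < pi) \<and> (\<exists>K vp vm P Q. trapezohedron K vp vm P Q \<alpha>)}"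

definition cos_vec :: "real^4 \<Rightarrow> real^4"
  where "cos_vec \<alpha> = (\<chi> i. cos (\<alpha> $ i))"

definition cos_angle_set :: "(real^4) set"  (\<open>\<A>''\<close>)
  where "\<A>' = cos_vec ` \<A>"

definition cos_box :: "(real^4) set"
  where "cos_box = {c. \<forall>i. -1 < c $ i \<and> c $ i \<le> 1}"

definition Phi :: "4 \<Rightarrow> real^4 \<Rightarrow> real"
  where "Phi i c =
    c $ i * c $ (i + 1) * (c $ i * c $ (i + 1) + 1) * c $ (i + 2) * c $ (i + 3)
    - c $ i * c $ (i + 1) * (c $ i + c $ (i + 1)) * (c $ (i + 2) + c $ (i + 3))
    + (c $ i + c $ (i + 1))\<^sup>2 - c $ i * c $ (i + 1) - 1"

definition boundary_piece :: "4 \<Rightarrow> (real^4) set"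
  where "boundary_piece i =
    {c \<in> cos_box. Phi i c = 0 \<and> c $ i + c $ (i + 1) \<le> 0 \<and>
       c $ i \<le> c $ (i + 2) \<and> c $ (i + 1) \<le> c $ (i + 3)}"

text \<open>The trapezohedron of given angles is unique only up to isometry, so the degeneration of the
  edge from \<open>Q i\<close> to \<open>P (i + 1)\<close> as the angle cosines tend to \<open>c0\<close> is expressed by its hyperbolic
  length, uniformly over all realizations.  The requirement that the endpoints not be ideal keeps
  \<^const>\<open>hyp_dist\<close> meaningful.\<close>

definition edge_degenerates_at :: "4 \<Rightarrow> real^4 \<Rightarrow> bool"
  where "edge_degenerates_at i c0 \<longleftrightarrow>
    (\<forall>\<epsilon>>0. \<forall>\<^sub>F c in at c0 within \<A>'. \<forall>\<alpha> K vp vm P Q.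
       trapezohedron K vp vm P Q \<alpha> \<and> cos_vec \<alpha> = c \<longrightarrow>
         Q i \<in> hyp_space \<and> P (i + 1) \<in> hyp_space \<and> hyp_dist (Q i) (P (i + 1)) < \<epsilon>)"

end

theory Submission
  imports Defs
begin

text \<open>
  Let \<open>a i\<close> and \<open>b i\<close> be the outward unit normals of the faces at the two ideal vertices \<open>v\<close> and
  \<open>w\<close>.  Modulo \<open>v\<close> the \<open>a i\<close> form a rectangle and modulo \<open>w\<close> so do the \<open>b i\<close>; let \<open>x\<close> be the cosine
  of the angle by which these two frames are rotated against each other.  The prescribed dihedral
  angles turn into \<open>c $ i + x = k * mu i * nu i\<close> and \<open>sqrt (1 - x\<^sup>2) = k * mu i * nu (i + 1)\<close>, so \<open>x\<close> is
  the unique root of \<open>(\<Prod>i. c $ i + x) = (1 - x\<^sup>2)\<^sup>2\<close> with all \<open>c $ i + x\<close> positive and \<open>x < 1\<close>, and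
  such a configuration of normals exists for every \<open>c\<close> in the box.  It bounds a trapezohedron iff
  \<open>Q i\<close> precedes \<open>P (i + 1)\<close> on their common edge line for every \<open>i\<close>, that is iff
  \<open>c $ i + c $ (i + 1) + x * (1 + c $ i * c $ (i + 1)) > 0\<close>; evaluating the equation for the root at the
  critical value of \<open>x\<close> turns this into the condition on \<^const>\<open>Phi\<close>.
\<close>

subsection \<open>The equation for the angle parameter\<close>

text \<open>The normals of every realization satisfy the same relations, so \<open>x\<close>, the
  side of each face plane on which a vertex lies, and the edge lengths are functions of
  \<open>c\<close> alone; this makes the degeneration uniform over all realizations. The vertex
  signs that do not come for free are those of \<open>Q i\<close> against the face of
  \<open>a (i + 1)\<close> and of \<open>P (i + 1)\<close> against the face of \<open>b i\<close>,
  and both are governed by the sign of \<open>edge_gap\<close>. An angle 0 carries no dihedral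
  condition; there the missing relation between \<open>a i\<close> and \<open>b i\<close> comes from
  tangency at the ideal vertex. For the frontier, the gap of a neighbouring edge exceeds gap
  \<open>i\<close> by \<open>c $ (i + 2) - c $ i\<close> or \<open>c $ (i + 3) - c $ (i + 1)\<close>
  times a positive factor. The two inequalities in \<open>boundary_piece\<close> thus say that the
  vanishing gap \<open>i\<close> is minimal. The gap divided by a positive quantity is the
  hyperbolic sine of the edge length, so its vanishing is the collapse of the edge.\<close>

lemma prod_4_shift: "(\<Prod>j\<in>UNIV. g j) = g i * g (i + 1) * g (i + 2) * g (i + 3)"
  for i :: 4 and g :: "4 \<Rightarrow> real"
proof -
  have "(UNIV :: 4 set) = {i, i + 1, i + 2, i + 3}"
    using exhaust_4[of i] unfolding UNIV_4 by auto
  moreover have "prod g {i, i + 1, i + 2, i + 3} = g i * g (i + 1) * g (i + 2) * g (i + 3)" by simp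
  ultimately show ?thesis by simp
qed

definition angle_root :: "real^4 \<Rightarrow> real \<Rightarrow> bool"
  where "angle_root c x \<longleftrightarrow>
    (\<forall>i. 0 < c $ i + x) \<and> x < 1 \<and> (\<Prod>i\<in>UNIV. c $ i + x) = (1 - x\<^sup>2)\<^sup>2"

lemma angle_rootD:
  assumes "angle_root c x"
  shows "0 < c $ i + x" "x < 1" "(\<Prod>i\<in>UNIV. c $ i + x) = (1 - x\<^sup>2)\<^sup>2"
  using assms by (auto simp: angle_root_def)

lemma cos_boxD: "c \<in> cos_box \<Longrightarrow> -1 < c $ i" "c \<in> cos_box \<Longrightarrow> c $ i \<le> 1"
  by (auto simp: cos_box_def)

lemma angle_root_gt:
  assumes "c \<in> cos_box" "angle_root c x"
  shows "-1 < x"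
  using angle_rootD(1)[OF assms(2), of 1] cos_boxD(2)[OF assms(1), of 1] by linarith

text \<open>The quotient of both sides is the product of the nondecreasing \<open>(c $ i + x) / (1 + x)\<close> and
  of the increasing \<open>((1 + x) / (1 - x))\<^sup>2\<close>.\<close>

lemma prod_sq_increasing:
  fixes c :: "real^4"
  assumes c: "\<And>i. c $ i \<le> 1" and s: "\<And>i. 0 < c $ i + s" and st: "s < t" "t < 1"
    and le: "(1 - s\<^sup>2)\<^sup>2 \<le> (\<Prod>i\<in>UNIV. c $ i + s)"
  shows "(1 - t\<^sup>2)\<^sup>2 < (\<Prod>i\<in>UNIV. c $ i + t)"
proof -
  have s1: "0 < 1 + s" using s[of 1] c[of 1] by linarith
  have t1: "0 < 1 + t" "0 < 1 - t" using s1 st by auto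
  have "(\<Prod>i\<in>UNIV. (c $ i + s) * (1 + t)) \<le> (\<Prod>i\<in>UNIV. (c $ i + t) * (1 + s))"
  proof (rule prod_mono)
    fix i :: 4
    have "(c $ i + t) * (1 + s) - (c $ i + s) * (1 + t) = (t - s) * (1 - c $ i)"
      by (simp add: algebra_simps)
    moreover have "0 \<le> (t - s) * (1 - c $ i)" using st c[of i] by simp
    ultimately show "0 \<le> (c $ i + s) * (1 + t) \<and> (c $ i + s) * (1 + t) \<le> (c $ i + t) * (1 + s)"
      using s[of i] t1 by simp
  qed
  then have 1: "(\<Prod>i\<in>UNIV. c $ i + s) * (1 + t)^4 \<le> (\<Prod>i\<in>UNIV. c $ i + t) * (1 + s)^4"
    by (simp add: prod.distrib)
  have "(1 - t) * (1 + s) < (1 - s) * (1 + t)" using st by (simp add: algebra_simps)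
  then have "((1 - t) * (1 + s))\<^sup>2 < ((1 - s) * (1 + t))\<^sup>2"
    using t1 s1 by (intro power_strict_mono) auto
  then have "((1 - t) * (1 + s))\<^sup>2 * ((1 + s) * (1 + t))\<^sup>2 < ((1 - s) * (1 + t))\<^sup>2 * ((1 + s) * (1 + t))\<^sup>2"
    using t1 s1 by (intro mult_strict_right_mono) auto
  moreover have "1 - r\<^sup>2 = (1 - r) * (1 + r)" for r :: real by (simp add: algebra_simps power2_eq_square)
  ultimately have "(1 - t\<^sup>2)\<^sup>2 * (1 + s)^4 < (1 - s\<^sup>2)\<^sup>2 * (1 + t)^4"
    by (simp only: power2_eq_square power4_eq_xxxx mult_ac)
  also have "\<dots> \<le> (\<Prod>i\<in>UNIV. c $ i + s) * (1 + t)^4"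
    using le t1 by (intro mult_right_mono) auto
  also note 1
  finally show ?thesis using s1 by simp
qed

text \<open>Once the product has reached \<open>(1 - t\<^sup>2)\<^sup>2\<close> it stays strictly
  above it, by \<open>prod_sq_increasing\<close>, so the root separates the two signs. This locates
  \<open>t\<close> relative to the root without solving for the root.\<close>

lemma angle_root_less:
  assumes c: "c \<in> cos_box" and x: "angle_root c x" and t: "\<And>i. 0 < c $ i + t" "t < 1"
  shows "t < x \<longleftrightarrow> (\<Prod>i\<in>UNIV. c $ i + t) < (1 - t\<^sup>2)\<^sup>2"
    and "t = x \<longleftrightarrow> (\<Prod>i\<in>UNIV. c $ i + t) = (1 - t\<^sup>2)\<^sup>2"
proof -
  note xD = angle_rootD[OF x]
  consider "t < x" | "t = x" | "x < t" by linarith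
  then have "(t < x \<longleftrightarrow> (\<Prod>i\<in>UNIV. c $ i + t) < (1 - t\<^sup>2)\<^sup>2) \<and>
        (t = x \<longleftrightarrow> (\<Prod>i\<in>UNIV. c $ i + t) = (1 - t\<^sup>2)\<^sup>2)"
  proof cases
    case 1
    then have "\<not> (1 - t\<^sup>2)\<^sup>2 \<le> (\<Prod>i\<in>UNIV. c $ i + t)"
      using prod_sq_increasing[of c t x] t xD cos_boxD[OF c] by fastforce
    then show ?thesis using 1 by auto
  next
    case 2 then show ?thesis using xD by auto
  next
    case 3
    then have "(1 - t\<^sup>2)\<^sup>2 < (\<Prod>i\<in>UNIV. c $ i + t)"
      using prod_sq_increasing[of c x t] t xD cos_boxD[OF c] by fastforce
    then show ?thesis using 3 by auto
  qed
  then show "t < x \<longleftrightarrow> (\<Prod>i\<in>UNIV. c $ i + t) < (1 - t\<^sup>2)\<^sup>2"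
    "t = x \<longleftrightarrow> (\<Prod>i\<in>UNIV. c $ i + t) = (1 - t\<^sup>2)\<^sup>2" by auto
qed

lemma angle_root_unique:
  assumes "c \<in> cos_box" "angle_root c x" "angle_root c x'"
  shows "x = x'"
  using angle_root_less(2)[OF assms(1,2), of x'] angle_rootD[OF assms(3)] by auto

text \<open>Intermediate value theorem to the right of \<open>m\<close>, the largest zero of a
  factor \<open>c $ i + x\<close>: there all factors are positive, near \<open>m\<close> the product
  is too small, and at 1 the other side vanishes.\<close>

lemma angle_root_exists:
  assumes c: "c \<in> cos_box"
  obtains x where "angle_root c x"
proof -
  define m where "m = Max (range (\<lambda>i. - c $ i))"
  have m_ge: "- c $ i \<le> m" for i unfolding m_def by (intro Max_ge) auto
  have "m \<in> range (\<lambda>i. - c $ i)" unfolding m_def by (intro Max_in) auto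
  then obtain k where k: "m = - c $ k" by auto
  have m: "-1 \<le> m" "m < 1" using k cos_boxD[OF c, of k] by auto
  let ?f = "\<lambda>x. (\<Prod>i\<in>UNIV. c $ i + x) - (1 - x\<^sup>2)\<^sup>2"
  have cont: "continuous_on A ?f" for A by (intro continuous_intros)
  have "0 < c $ i + 1" for i using cos_boxD(1)[OF c, of i] by linarith
  then have f1: "?f 1 > 0" using prod_pos[of UNIV "\<lambda>i. c $ i + 1"] by simp
  have "\<exists>s. m < s \<and> s < 1 \<and> ?f s < 0"
  proof (cases "m = -1")
    \<comment> \<open>All \<open>c $ i\<close> are 1 and both sides vanish at -1, so the sign has to
      be sampled further right: at -1/2 the sides are 1/16 and 9/16.\<close>
    case True
    have "c $ i = 1" for i using m_ge[of i] cos_boxD[OF c, of i] True by linarith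
    then have "?f (-1/2) < 0" by (simp add: power2_eq_square power4_eq_xxxx)
    then show ?thesis using True by (intro exI[of _ "-1/2"]) auto
  next
    case False
    then have "m\<^sup>2 < 1" using m by (simp add: abs_square_less_1 abs_less_iff)
    then have "0 < (1 - m\<^sup>2)\<^sup>2" by simp
    then have fm: "?f m < 0" unfolding prod_4_shift[of "\<lambda>i. c $ i + m" k] using k by simp
    have "(?f \<longlongrightarrow> ?f m) (at_right m)" by (intro tendsto_intros)
    then have "\<forall>\<^sub>F s in at_right m. ?f s < 0" using fm by (rule order_tendstoD)
    moreover have "\<forall>\<^sub>F s in at_right m. s \<in> {m<..<1}" using m by (intro eventually_at_right_real) auto
    ultimately have "\<forall>\<^sub>F s in at_right m. ?f s < 0 \<and> s \<in> {m<..<1}" by eventually_elim auto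
    then have "\<exists>s. ?f s < 0 \<and> s \<in> {m<..<1}" by (rule eventually_happens'[OF trivial_limit_at_right_real])
    then show ?thesis by auto
  qed
  then obtain s where s: "m < s" "s < 1" "?f s < 0" by blast
  have "?f s \<le> 0" "0 \<le> ?f 1" "s \<le> 1" using s f1 by (simp_all only: less_imp_le)
  then obtain x where x: "s \<le> x" "x \<le> 1" "?f x = 0" using IVT'[of ?f s 0 1] cont by blast
  have "x \<noteq> 1" using x(3) f1 by (metis less_irrefl)
  moreover have "0 < c $ i + x" for i using m_ge[of i] s x by linarith
  ultimately have "angle_root c x" using x by (auto simp: angle_root_def)
  then show thesis by (rule that)
qed

text \<open>Up to a positive factor this is the sum of \<open>c $ i\<close>, \<open>c $ (i + 1)\<close> and \<open>x\<close> with respect to the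
  addition law of the hyperbolic tangent; its inverse hyperbolic tangent will be the signed length of
  the edge from \<open>Q i\<close> to \<open>P (i + 1)\<close>.\<close>

definition edge_gap :: "real^4 \<Rightarrow> real \<Rightarrow> 4 \<Rightarrow> real"
  where "edge_gap c x i = c $ i + c $ (i + 1) + x * (1 + c $ i * c $ (i + 1))"

text \<open>If only one factor is negative, the product is nonpositive. Otherwise two nonpositive
  factors have modulus below \<open>1 - y\<close> and the other two at most \<open>1 + y\<close>.
  This covers the values of \<open>y\<close> to which \<open>angle_root_less\<close> does not
  apply.\<close>

lemma prod_shift_less:
  fixes c1 c2 c3 c4 y :: real
  assumes "-1 < c1" "c1 \<le> 1" "-1 < c2" "c2 \<le> 1" "-1 < c3" "c3 \<le> 1" "-1 < c4" "c4 \<le> 1"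
    and y: "0 \<le> y" "y < 1" and neg: "c1 + y \<le> 0"
  shows "(c1 + y) * (c2 + y) * (c3 + y) * (c4 + y) < (1 - y\<^sup>2)\<^sup>2"
proof -
  have y2: "0 < (1 - y\<^sup>2)\<^sup>2" using y by (simp add: power2_eq_1_iff)
  have two: "a * b * (p * q) < (1 - y\<^sup>2)\<^sup>2"
    if "\<bar>a\<bar> < 1 - y" "\<bar>b\<bar> < 1 - y" "\<bar>p\<bar> \<le> 1 + y" "\<bar>q\<bar> \<le> 1 + y" for a b p q
  proof -
    have "a * b * (p * q) \<le> (\<bar>a\<bar> * \<bar>b\<bar>) * (\<bar>p\<bar> * \<bar>q\<bar>)"
      using abs_ge_self[of "a * b * (p * q)"] by (simp add: abs_mult)
    also have "\<dots> \<le> (\<bar>a\<bar> * \<bar>b\<bar>) * ((1 + y) * (1 + y))"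
      using that y by (intro mult_left_mono mult_mono) auto
    also have "\<dots> < ((1 - y) * (1 - y)) * ((1 + y) * (1 + y))"
      using that y by (intro mult_strict_right_mono mult_strict_mono') auto
    also have "\<dots> = (1 - y\<^sup>2)\<^sup>2" by (simp add: algebra_simps power2_eq_square)
    finally show ?thesis .
  qed
  have abs1: "\<bar>d + y\<bar> \<le> 1 + y" if "-1 < d" "d \<le> 1" for d using that y by auto
  have abs2: "\<bar>d + y\<bar> < 1 - y" if "-1 < d" "d + y \<le> 0" for d using that by auto
  consider "c2 + y \<le> 0" | "c3 + y \<le> 0" | "c4 + y \<le> 0" | "0 \<le> c2 + y" "0 \<le> c3 + y" "0 \<le> c4 + y"
    by linarith
  then show ?thesis
  proof cases
    case 1 show ?thesis
      using two[of "c1 + y" "c2 + y" "c3 + y" "c4 + y"] abs1 abs2 1 assms by (simp add: mult_ac)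
  next
    case 2 show ?thesis
      using two[of "c1 + y" "c3 + y" "c2 + y" "c4 + y"] abs1 abs2 2 assms by (simp add: mult_ac)
  next
    case 3 show ?thesis
      using two[of "c1 + y" "c4 + y" "c3 + y" "c2 + y"] abs1 abs2 3 assms by (simp add: mult_ac)
  next
    case 4
    then have "(c1 + y) * ((c2 + y) * (c3 + y) * (c4 + y)) \<le> 0"
      using neg by (intro mult_nonpos_nonneg) auto
    also note y2
    finally show ?thesis by (simp add: mult_ac)
  qed
qed

lemma one_plus_mult_pos:
  fixes c d :: real
  assumes "-1 < c" "c \<le> 1" "-1 < d" "d \<le> 1"
  shows "0 < 1 + c * d"
proof -
  consider "d \<le> 0" | "0 < d" by linarith
  then show ?thesis
  proof cases
    case 1
    then have "1 * d \<le> c * d" using assms by (intro mult_right_mono_neg) auto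
    then show ?thesis using assms by linarith
  next
    case 2
    then have "-1 * d < c * d" using assms by (intro mult_strict_right_mono) auto
    then show ?thesis using assms by linarith
  qed
qed

text \<open>One of the two cosines, say \<open>b\<close>, is positive, and with \<open>a\<close> for
  the other one the gap is \<open>(a + x) + b * (1 + a * x)\<close>, a sum of two positive
  terms.\<close>

lemma edge_gap_pos_of_sum_pos:
  assumes c: "c \<in> cos_box" and x: "angle_root c x" and "0 < c $ i + c $ (i + 1)"
  shows "0 < edge_gap c x i"
proof -
  have x1: "\<bar>x\<bar> < 1" using angle_root_gt[OF c x] angle_rootD(2)[OF x] by auto
  have *: "0 < a + b + x * (1 + a * b)" if "0 < a + x" "0 < b" "-1 < a" "a \<le> 1" for a b
  proof -
    have "0 < 1 + a * x" using that x1 by (intro one_plus_mult_pos) auto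
    then have "0 < (a + x) + b * (1 + a * x)" using that by (simp add: add_pos_pos)
    then show ?thesis by (simp add: algebra_simps)
  qed
  note facts = cos_boxD[OF c] angle_rootD(1)[OF x]
  show ?thesis
  proof (cases "0 < c $ i")
    case True
    then show ?thesis using *[of "c $ (i + 1)" "c $ i"] facts by (simp add: edge_gap_def add.commute mult.commute)
  next
    case False
    then show ?thesis using *[of "c $ i" "c $ (i + 1)"] facts assms(3) by (simp add: edge_gap_def)
  qed
qed

text \<open>\<^const>\<open>Phi\<close> is, up to a positive factor, the difference of the two sides of the equation for
  the root at \<open>y = - (c $ i + c $ (i + 1)) / (1 + c $ i * c $ (i + 1))\<close>.\<close>

lemma Phi_eq:
  fixes c :: "real^4"
  assumes "1 + c $ i * c $ (i + 1) \<noteq> 0"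
  defines "y \<equiv> - (c $ i + c $ (i + 1)) / (1 + c $ i * c $ (i + 1))"
  shows "((\<Prod>j\<in>UNIV. c $ j + y) - (1 - y\<^sup>2)\<^sup>2) * (1 + c $ i * c $ (i + 1))^3
    = (1 - (c $ i)\<^sup>2) * (1 - (c $ (i + 1))\<^sup>2) * Phi i c"
proof -
  define a b d e where "a = c $ i" and "b = c $ (i + 1)" and "d = c $ (i + 2)" and "e = c $ (i + 3)"
  define q where "q = 1 + a * b"
  have q: "q \<noteq> 0" using assms by (simp add: q_def a_def b_def)
  have yq: "y * q = - (a + b)" using q by (simp add: y_def q_def a_def b_def)
  have aq: "(a + y) * q = - b * (1 - a\<^sup>2)"
    using yq by (simp add: algebra_simps q_def power2_eq_square)
  have bq: "(b + y) * q = - a * (1 - b\<^sup>2)"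
    using yq by (simp add: algebra_simps q_def power2_eq_square)
  have yy: "(1 - y\<^sup>2) * q\<^sup>2 = (1 - a\<^sup>2) * (1 - b\<^sup>2)"
  proof -
    have "(1 - y\<^sup>2) * q\<^sup>2 = q\<^sup>2 - (y * q)\<^sup>2" by (simp add: algebra_simps)
    then show ?thesis unfolding yq by (simp add: q_def algebra_simps power2_eq_square)
  qed
  have ring1: "q^4 * (A * B * D * E - Z\<^sup>2) = (A * q) * (B * q) * ((D * q) * (E * q)) - (Z * q\<^sup>2)\<^sup>2"
    for A B D E Z :: real
    by (simp add: power2_eq_square power4_eq_xxxx algebra_simps)
  have ring2: "(- b * r) * (- a * s) * M - (r * s)\<^sup>2 = r * s * (a * b * M - r * s)" for r s M :: real
    by (simp add: power2_eq_square algebra_simps)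
  have shift: "(r + y) * q = r * q - (a + b)" for r using yq by (simp add: distrib_right)
  have "q^4 * ((a + y) * (b + y) * (d + y) * (e + y) - (1 - y\<^sup>2)\<^sup>2) = (1 - a\<^sup>2) * (1 - b\<^sup>2) *
      (a * b * ((d * q - (a + b)) * (e * q - (a + b))) - (1 - a\<^sup>2) * (1 - b\<^sup>2))"
    unfolding ring1 aq bq yy ring2 shift[of d] shift[of e] ..
  \<comment> \<open>The bracket contains one more factor \<open>q\<close>, which lowers the power of
    the denominator from 4 to 3; its cofactor is the definition of \<open>Phi\<close>.\<close>
  also have "a * b * ((d * q - (a + b)) * (e * q - (a + b))) - (1 - a\<^sup>2) * (1 - b\<^sup>2) = q * Phi i c"
    unfolding Phi_def a_def[symmetric] b_def[symmetric] d_def[symmetric] e_def[symmetric] q_def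
    by (simp add: algebra_simps power2_eq_square)
  also have "q^4 = q * q^3" by (simp add: power4_eq_xxxx power3_eq_cube)
  finally have eq: "q * q^3 * ((a + y) * (b + y) * (d + y) * (e + y) - (1 - y\<^sup>2)\<^sup>2)
      = (1 - a\<^sup>2) * (1 - b\<^sup>2) * (q * Phi i c)" .
  have cancel: "u * r = s * v" if "q * r * u = s * (q * v)" for u v r s :: real
  proof -
    have "q * (u * r) = q * (s * v)" using that by (simp add: mult_ac)
    then show ?thesis using q by simp
  qed
  show ?thesis
    using cancel[OF eq] unfolding prod_4_shift[of _ i] a_def b_def d_def e_def q_def .
qed

text \<open>The gap is \<open>q * (x - y)\<close> with \<open>q > 0\<close>, so its sign is read off
  from the root equation at \<open>y\<close>. The bound on the sum gives \<open>0 \<le> y\<close>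
  and keeps both cosines below 1, so that the factor between \<open>f\<close> and \<open>Phi\<close>
  is positive.\<close>

lemma edge_gap_iff_Phi:
  assumes c: "c \<in> cos_box" and x: "angle_root c x" and sum: "c $ i + c $ (i + 1) \<le> 0"
  shows "0 < edge_gap c x i \<longleftrightarrow> Phi i c < 0" and "edge_gap c x i = 0 \<longleftrightarrow> Phi i c = 0"
proof -
  note ci = cos_boxD[OF c]
  define q where "q = 1 + c $ i * c $ (i + 1)"
  define y where "y = - (c $ i + c $ (i + 1)) / q"
  define f where "f = (\<Prod>j\<in>UNIV. c $ j + y) - (1 - y\<^sup>2)\<^sup>2"
  have q: "0 < q" unfolding q_def using ci by (intro one_plus_mult_pos) auto
  have lt: "c $ i < 1" "c $ (i + 1) < 1" using ci[of i] ci[of "i + 1"] sum by linarith+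
  have "(c $ i)\<^sup>2 < 1" "(c $ (i + 1))\<^sup>2 < 1"
    using ci lt by (simp_all add: abs_square_less_1 abs_less_iff minus_less_iff)
  then have r: "0 < (1 - (c $ i)\<^sup>2) * (1 - (c $ (i + 1))\<^sup>2)" by simp
  have "f * q^3 = (1 - (c $ i)\<^sup>2) * (1 - (c $ (i + 1))\<^sup>2) * Phi i c"
    using Phi_eq[of c i] q unfolding f_def y_def q_def by simp
  then have "sgn (f * q^3) = sgn ((1 - (c $ i)\<^sup>2) * (1 - (c $ (i + 1))\<^sup>2) * Phi i c)" by simp
  then have "sgn f = sgn (Phi i c)"
    unfolding sgn_mult[of f] sgn_mult[of _ "Phi i c"] using q sgn_pos[OF r] by simp
  then have f_Phi: "f < 0 \<longleftrightarrow> Phi i c < 0" "f = 0 \<longleftrightarrow> Phi i c = 0"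
    by (auto simp: sgn_if split: if_splits)
  have y0: "0 \<le> y" using sum q by (simp add: y_def)
  have "0 < (1 + c $ i) * (1 + c $ (i + 1))" using ci[of i] ci[of "i + 1"] by simp
  then have "- (c $ i + c $ (i + 1)) < q" by (simp add: q_def algebra_simps)
  then have y1: "y < 1" using q by (simp add: y_def)
  have gap: "edge_gap c x i = q * (x - y)"
    using q by (simp add: edge_gap_def y_def q_def field_simps)
  have "(y < x \<longleftrightarrow> f < 0) \<and> (y = x \<longleftrightarrow> f = 0)"
  proof (cases "\<forall>j. 0 < c $ j + y")
    case True
    then show ?thesis using angle_root_less[OF c x, of y] y1 by (simp add: f_def)
  next
    \<comment> \<open>Some factor is nonpositive at \<open>y\<close>, so \<open>y\<close> lies below
      the root because the root makes all factors positive; the sign of \<open>f\<close> needs the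
      direct estimate.\<close>
    case False
    then obtain j where j: "c $ j + y \<le> 0" by (auto simp: not_less)
    then have "y < x" using angle_rootD(1)[OF x, of j] by linarith
    moreover have "f < 0"
      using prod_shift_less[of "c $ j" "c $ (j + 1)" "c $ (j + 2)" "c $ (j + 3)" y] ci y0 y1 j
      unfolding f_def prod_4_shift[of _ j] by simp
    ultimately show ?thesis by auto
  qed
  then show "0 < edge_gap c x i \<longleftrightarrow> Phi i c < 0" "edge_gap c x i = 0 \<longleftrightarrow> Phi i c = 0"
    using q f_Phi by (auto simp: gap zero_less_mult_iff)
qed

lemma edge_gap_pos_iff:
  assumes "c \<in> cos_box" "angle_root c x"
  shows "0 < edge_gap c x i \<longleftrightarrow> Phi i c < 0 \<or> 0 < c $ i + c $ (i + 1)"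
  using edge_gap_iff_Phi[OF assms] edge_gap_pos_of_sum_pos[OF assms] by (meson not_less)

subsection \<open>Configurations of normals\<close>

definition hom :: "real^3 \<Rightarrow> (real^3) \<times> real" where "hom x = (x, 1)"

lemma hom_inject [simp]: "hom x = hom y \<longleftrightarrow> x = y"
  by (simp add: hom_def)

lemma hom_nonzero [simp]: "hom x \<noteq> 0"
  by (simp add: hom_def prod_eq_iff)

lemma lorentz_hom: "lorentz n (hom x) = fst n \<bullet> x - snd n"
  by (simp add: lorentz_def hom_def)

lemma lorentz_commute: "lorentz n m = lorentz m n"
  by (simp add: lorentz_def inner_commute)

lemma lorentz_bilinear [simp]:
  "lorentz (n + m) l = lorentz n l + lorentz m l"
  "lorentz l (n + m) = lorentz l n + lorentz l m"
  "lorentz (n - m) l = lorentz n l - lorentz m l"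
  "lorentz l (n - m) = lorentz l n - lorentz l m"
  "lorentz (- n) l = - lorentz n l"
  "lorentz l (- n) = - lorentz l n"
  "lorentz (r *\<^sub>R n) l = r * lorentz n l"
  "lorentz l (r *\<^sub>R n) = r * lorentz l n"
  "lorentz 0 l = 0"
  "lorentz l 0 = 0"
  by (simp_all add: lorentz_def algebra_simps)

lemma lorentz_null [simp]: "norm v = 1 \<Longrightarrow> lorentz (hom v) (hom v) = 0"
  by (simp add: lorentz_def hom_def norm_eq_1)

lemma orthonormal_basis_3:
  fixes x :: "real^3"
  assumes "norm u = 1" "norm v = 1" "norm w = 1" "u \<bullet> v = 0" "u \<bullet> w = 0" "v \<bullet> w = 0"
    and x: "x \<bullet> u = 0" "x \<bullet> v = 0" "x \<bullet> w = 0"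
  shows "x = 0"
proof -
  have flip: "v \<bullet> u = 0" "w \<bullet> u = 0" "w \<bullet> v = 0" using assms by (simp_all add: inner_commute)
  have ne: "u \<noteq> v" "u \<noteq> w" "v \<noteq> w" using assms(1-6) by auto
  have "independent {u, v, w}"
  proof (rule pairwise_orthogonal_independent)
    show "pairwise orthogonal {u, v, w}"
      using assms(4-6) flip by (auto simp: pairwise_insert orthogonal_def)
    have "u \<noteq> 0" "v \<noteq> 0" "w \<noteq> 0" using assms(1-3) by auto
    then show "0 \<notin> {u, v, w}" by simp
  qed
  moreover have "card {u, v, w} = 3" using ne by simp
  ultimately have "UNIV \<subseteq> span {u, v, w}" by (intro card_ge_dim_independent) auto
  then have "x \<in> span {u, v, w}" by blast
  moreover have "orthogonal x z" if "z \<in> {u, v, w}" for z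
    using that x by (auto simp: orthogonal_def)
  ultimately have "orthogonal x x" by (rule orthogonal_to_span)
  then show ?thesis by (simp add: orthogonal_def)
qed

text \<open>The quotient of the orthogonal complement of a null vector by that vector is a Euclidean
  plane.\<close>

lemma null_orthogonal_multiple:
  assumes v: "norm v = 1"
    and perp: "lorentz n (hom v) = 0" "lorentz m (hom v) = 0" "lorentz d (hom v) = 0"
    and nm: "lorentz n n = 1" "lorentz m m = 1" "lorentz n m = 0"
    and d: "lorentz d n = 0" "lorentz d m = 0"
  shows "\<exists>r. d = r *\<^sub>R hom v"
proof -
  define pr where "pr l = fst l - (fst l \<bullet> v) *\<^sub>R v" for l :: "(real^3) \<times> real"
  have snd_eq: "snd n = fst n \<bullet> v" "snd m = fst m \<bullet> v" "snd d = fst d \<bullet> v"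
    using perp by (simp_all add: lorentz_hom)
  have vv: "v \<bullet> v = 1" using v by (simp add: norm_eq_1)
  have pr_v: "pr l \<bullet> v = 0" for l by (simp add: pr_def inner_diff_left vv)
  have pr_pr: "pr l \<bullet> pr l' = fst l \<bullet> fst l' - (fst l \<bullet> v) * (fst l' \<bullet> v)" for l l'
    by (simp add: pr_def inner_diff_left inner_diff_right vv inner_commute)
  have "pr d = 0"
  proof (rule orthonormal_basis_3[of v "pr n" "pr m"])
    show "norm (pr n) = 1" "norm (pr m) = 1" "pr n \<bullet> pr m = 0" "pr d \<bullet> pr n = 0" "pr d \<bullet> pr m = 0"
      using nm d by (simp_all add: norm_eq_1 pr_pr lorentz_def snd_eq)
  qed (use v pr_v in \<open>simp_all add: inner_commute\<close>)
  then have "d = (fst d \<bullet> v) *\<^sub>R hom v" by (simp add: prod_eq_iff pr_def snd_eq hom_def)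
  then show ?thesis by blast
qed

text \<open>In the Euclidean plane obtained by factoring out the null vector, \<open>n\<close> and
  \<open>l\<close> are unit vectors orthogonal to the same unit vector \<open>m\<close>, hence equal
  up to sign.\<close>

lemma null_orthogonal_opposite:
  assumes v: "norm v = 1"
    and perp: "lorentz n (hom v) = 0" "lorentz m (hom v) = 0" "lorentz l (hom v) = 0"
    and unit: "lorentz n n = 1" "lorentz m m = 1" "lorentz l l = 1"
    and orth: "lorentz n m = 0" "lorentz l m = 0"
  obtains r where "l = n + r *\<^sub>R hom v" | r where "l = - n + r *\<^sub>R hom v"
proof -
  define t where "t = lorentz l n"
  have "\<exists>r. l - t *\<^sub>R n = r *\<^sub>R hom v"
    by (rule null_orthogonal_multiple[of v n m]) (use assms in \<open>simp_all add: t_def\<close>)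
  then obtain r where r: "l - t *\<^sub>R n = r *\<^sub>R hom v" by blast
  then have l: "l = t *\<^sub>R n + r *\<^sub>R hom v" by (simp add: algebra_simps)
  have "lorentz l l = t * t"
    using unit v perp by (subst (1 2) l) (simp add: lorentz_commute[of "hom v" n])
  then have "t = 1 \<or> t = -1" using unit by (simp add: square_eq_1_iff)
  then show thesis using l that by auto
qed

lemma lorentz_light_neg:
  assumes "norm v \<le> 1" "norm x \<le> 1" "v \<noteq> x"
  shows "lorentz (hom v) (hom x) < 0"
proof -
  have "0 < (norm (v - x))\<^sup>2" using assms by simp
  also have "\<dots> = (norm v)\<^sup>2 + (norm x)\<^sup>2 - 2 * (v \<bullet> x)"
    by (simp add: power2_norm_eq_inner algebra_simps inner_commute)
  also have "\<dots> \<le> 1 + 1 - 2 * (v \<bullet> x)"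
    using assms by (intro diff_right_mono add_mono) (auto simp: power_le_one)
  finally show ?thesis by (simp add: lorentz_def hom_def)
qed

text \<open>\<open>exhaust_4\<close> enumerates the index type as 1, 2, 3, 4, whereas the cyclic
  arguments start at 0.\<close>

lemma four_eq_0: "(4 :: 4) = 0"
  by simp

lemma all_index: "P 0 \<Longrightarrow> (\<And>i::4. P i \<Longrightarrow> P (i + 1)) \<Longrightarrow> P i"
proof -
  assume "P 0" and step: "\<And>i::4. P i \<Longrightarrow> P (i + 1)"
  then have "P 1" "P 2" "P 3" using step[of 0] step[of 1] step[of 2] by simp_all
  moreover have "(4::4) = 0" by simp
  ultimately show ?thesis using exhaust_4[of i] \<open>P 0\<close> by metis
qed

text \<open>\<open>a i\<close> belongs to the face with vertices \<open>v\<close>, \<open>P i\<close>, \<open>Q i\<close>, \<open>P (i + 1)\<close> and \<open>b i\<close> to the one with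
  vertices \<open>w\<close>, \<open>Q (i - 1)\<close>, \<open>P i\<close>, \<open>Q i\<close>.\<close>

locale trapezohedral_normals =
  fixes a b :: "4 \<Rightarrow> (real^3) \<times> real" and v w :: "real^3" and c :: "real^4"
  assumes c_box: "c \<in> cos_box"
    and norm_v: "norm v = 1" and norm_w: "norm w = 1"
    and a_unit: "lorentz (a i) (a i) = 1" and b_unit: "lorentz (b i) (b i) = 1"
    and a_next: "lorentz (a i) (a (i + 1)) = 0" and b_next: "lorentz (b i) (b (i + 1)) = 0"
    and a_b: "lorentz (a i) (b i) = - c $ i" and a_b_next: "lorentz (a i) (b (i + 1)) = 0"
    and a_v: "lorentz (a i) (hom v) = 0" and b_w: "lorentz (b i) (hom w) = 0"
    and a_w: "lorentz (a i) (hom w) < 0" and b_v: "lorentz (b i) (hom v) < 0"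
    and a_opp: "\<exists>r. a i + a (i + 2) = r *\<^sub>R hom v"
    and b_opp: "\<exists>r. b i + b (i + 2) = r *\<^sub>R hom w"
begin

text \<open>Exchanging the two ideal vertices reverses the cyclic order; with negated indices the
  relation \<open>a_b_next\<close> keeps its form. Statements about the vertices \<open>q\<close>
  are obtained in this way from those about \<open>p\<close>.\<close>

lemma dual: "trapezohedral_normals (\<lambda>i. b (- i)) (\<lambda>i. a (- i)) w v (\<chi> i. c $ (- i))"
proof
  fix i
  have shift: "- (i + 1) + 1 = - i" "- (i + 2) + 2 = - i" for i :: 4 by simp_all
  show "\<exists>r. b (- i) + b (- (i + 2)) = r *\<^sub>R hom w" "\<exists>r. a (- i) + a (- (i + 2)) = r *\<^sub>R hom v"
    using b_opp[of "- (i + 2)"] a_opp[of "- (i + 2)"] unfolding shift by (simp_all add: add.commute)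
  show "lorentz (b (- i)) (b (- (i + 1))) = 0" "lorentz (a (- i)) (a (- (i + 1))) = 0"
    "lorentz (b (- i)) (a (- (i + 1))) = 0"
    using b_next[of "- (i + 1)"] a_next[of "- (i + 1)"] a_b_next[of "- (i + 1)"] unfolding shift
    by (simp_all add: lorentz_commute)
  show "lorentz (b (- i)) (a (- i)) = - (\<chi> i. c $ (- i)) $ i" using a_b[of "- i"] by (simp add: lorentz_commute)
qed (use c_box norm_v norm_w a_unit b_unit a_v b_w a_w b_v in \<open>auto simp: cos_box_def\<close>)

text \<open>Coordinates adapted to the null vectors \<open>hom v\<close> and \<open>hom w\<close>,
  whose product is \<open>- k\<close>: \<open>a i\<close> is \<open>u i\<close> plus
  \<open>mu i\<close> times \<open>hom v\<close>, and \<open>b i\<close> is \<open>e i\<close> plus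
  \<open>nu i\<close> times \<open>hom w\<close>. The parts \<open>u i\<close> and
  \<open>e i\<close> lie in the Euclidean plane orthogonal to both null vectors; \<open>x\<close>
  and \<open>y\<close> are the cosine and sine of the angle between the two frames.\<close>

definition k :: real where "k = - lorentz (hom v) (hom w)"
definition mu :: "4 \<Rightarrow> real" where "mu i = - lorentz (a i) (hom w) / k"
definition nu :: "4 \<Rightarrow> real" where "nu i = - lorentz (b i) (hom v) / k"
definition u :: "4 \<Rightarrow> (real^3) \<times> real" where "u i = a i - mu i *\<^sub>R hom v"
definition e :: "4 \<Rightarrow> (real^3) \<times> real" where "e i = b i - nu i *\<^sub>R hom w"
definition x :: real where "x = lorentz (u 0) (e 0)"
definition y :: real where "y = lorentz (u 0) (e 1)"

lemma v_neq_w: "v \<noteq> w" using a_v[of 0] a_w[of 0] by auto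

lemma k_pos: "0 < k" using lorentz_light_neg[of v w] v_neq_w norm_v norm_w by (simp add: k_def)

lemma mu_pos: "0 < mu i" and nu_pos: "0 < nu i"
  using a_w[of i] b_v[of i] k_pos by (simp_all add: mu_def nu_def divide_neg_pos)

lemma vw [simp]:
  "lorentz (hom v) (hom v) = 0" "lorentz (hom w) (hom w) = 0"
  "lorentz (hom v) (hom w) = - k" "lorentz (hom w) (hom v) = - k"
  using norm_v norm_w by (simp_all add: k_def lorentz_commute)

lemma a_vw [simp]:
  "lorentz (a i) (hom v) = 0" "lorentz (hom v) (a i) = 0"
  "lorentz (a i) (hom w) = - k * mu i" "lorentz (hom w) (a i) = - k * mu i"
  using a_v[of i] k_pos by (simp_all add: lorentz_commute mu_def)

lemma b_vw [simp]:
  "lorentz (b i) (hom w) = 0" "lorentz (hom w) (b i) = 0"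
  "lorentz (b i) (hom v) = - k * nu i" "lorentz (hom v) (b i) = - k * nu i"
  using b_w[of i] k_pos by (simp_all add: lorentz_commute nu_def)

lemma ue_vw [simp]:
  "lorentz (u i) (hom v) = 0" "lorentz (hom v) (u i) = 0"
  "lorentz (u i) (hom w) = 0" "lorentz (hom w) (u i) = 0"
  "lorentz (e i) (hom v) = 0" "lorentz (hom v) (e i) = 0"
  "lorentz (e i) (hom w) = 0" "lorentz (hom w) (e i) = 0"
  by (simp_all add: u_def e_def mult.commute)

lemma ue_unit [simp]:
  "lorentz (u i) (u i) = 1" "lorentz (u i) (u (i + 1)) = 0" "lorentz (u (i + 1)) (u i) = 0"
  "lorentz (e i) (e i) = 1" "lorentz (e i) (e (i + 1)) = 0" "lorentz (e (i + 1)) (e i) = 0"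
  using a_unit[of i] a_next[of i] b_unit[of i] b_next[of i]
  by (simp_all add: u_def e_def lorentz_commute)

lemma a_eq: "a i = u i + mu i *\<^sub>R hom v" and b_eq: "b i = e i + nu i *\<^sub>R hom w"
  by (simp_all add: u_def e_def)

lemma ue_mu_nu:
  "lorentz (u i) (e i) = k * mu i * nu i - c $ i"
  "lorentz (u i) (e (i + 1)) = k * mu i * nu (i + 1)"
  using a_b[of i] a_b_next[of i] by (simp_all add: a_eq b_eq mult_ac)

lemma y_pos: "0 < y"
  using ue_mu_nu(2)[of 0] k_pos mu_pos nu_pos by (simp add: y_def)

lemma e_opp: "e (i + 2) = - e i"
proof -
  obtain r where r: "b i + b (i + 2) = r *\<^sub>R hom w" using b_opp by blast
  then have eq: "e i + e (i + 2) = (r - nu i - nu (i + 2)) *\<^sub>R hom w" by (simp add: e_def algebra_simps)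
  have "lorentz (e i + e (i + 2)) (hom v) = 0" by simp
  then have "(r - nu i - nu (i + 2)) * - k = 0" unfolding eq by simp
  then show ?thesis using k_pos eq by (simp add: add_eq_0_iff)
qed

lemma span_e:
  "u i = lorentz (u i) (e i) *\<^sub>R e i + lorentz (u i) (e (i + 1)) *\<^sub>R e (i + 1)"
proof -
  have "\<exists>r. u i - lorentz (u i) (e i) *\<^sub>R e i - lorentz (u i) (e (i + 1)) *\<^sub>R e (i + 1) = r *\<^sub>R hom v"
    by (rule null_orthogonal_multiple[of v "e i" "e (i + 1)"]) (simp_all add: norm_v)
  then obtain r
    where r: "u i - lorentz (u i) (e i) *\<^sub>R e i - lorentz (u i) (e (i + 1)) *\<^sub>R e (i + 1) = r *\<^sub>R hom v"
    by blast
  have "lorentz (u i - lorentz (u i) (e i) *\<^sub>R e i - lorentz (u i) (e (i + 1)) *\<^sub>R e (i + 1)) (hom w) = 0"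
    by simp
  then have "r = 0" unfolding r using k_pos by simp
  then show ?thesis using r by (simp add: algebra_simps)
qed

text \<open>Orthogonality alone would allow \<open>u (i + 1)\<close> to be either quarter turn of
  \<open>u i\<close>. Both \<open>y0\<close> and \<open>y1\<close> are positive, being of the form
  \<open>k * mu * nu\<close>, and this forces the sense in which the frame \<open>e\<close>
  turns.\<close>

lemma ue_next:
  "lorentz (u (i + 1)) (e (i + 1)) = lorentz (u i) (e i)"
  "lorentz (u (i + 1)) (e (i + 2)) = lorentz (u i) (e (i + 1))"
  "(lorentz (u i) (e i))\<^sup>2 + (lorentz (u i) (e (i + 1)))\<^sup>2 = 1"
proof -
  define x0 y0 x1 y1 where "x0 = lorentz (u i) (e i)" and "y0 = lorentz (u i) (e (i + 1))"
    and "x1 = lorentz (u (i + 1)) (e (i + 1))" and "y1 = lorentz (u (i + 1)) (e (i + 2))"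
  have u0: "u i = x0 *\<^sub>R e i + y0 *\<^sub>R e (i + 1)"
    using span_e[of i] by (simp add: x0_def y0_def)
  have u1: "u (i + 1) = x1 *\<^sub>R e (i + 1) - y1 *\<^sub>R e i"
    using span_e[of "i + 1"] e_opp[of i] by (simp add: x1_def y1_def add.assoc)
  have n0: "x0\<^sup>2 + y0\<^sup>2 = 1" using ue_unit(1)[of i] unfolding u0 by (simp add: power2_eq_square)
  have n1: "x1\<^sup>2 + y1\<^sup>2 = 1" using ue_unit(1)[of "i + 1"] unfolding u1 by (simp add: power2_eq_square)
  have orth: "x0 * y1 = x1 * y0"
    using ue_unit(2)[of i] unfolding u0 u1 by (simp add: mult.commute)
  have pos: "0 < y0" "0 < y1"
    using ue_mu_nu(2)[of i] ue_mu_nu(2)[of "i + 1"] k_pos mu_pos nu_pos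
    by (simp_all add: y0_def y1_def add.assoc)
  have "y1\<^sup>2 = y1\<^sup>2 * (x0\<^sup>2 + y0\<^sup>2)" using n0 by simp
  also have "\<dots> = (x0 * y1)\<^sup>2 + y1\<^sup>2 * y0\<^sup>2" by (simp add: algebra_simps)
  also have "\<dots> = y0\<^sup>2 * (x1\<^sup>2 + y1\<^sup>2)" unfolding orth by (simp add: algebra_simps)
  finally have "y1 = y0" using n1 pos by (simp add: power2_eq_iff_nonneg)
  moreover from this have "x1 = x0" using orth pos by simp
  ultimately show "lorentz (u (i + 1)) (e (i + 1)) = lorentz (u i) (e i)"
    "lorentz (u (i + 1)) (e (i + 2)) = lorentz (u i) (e (i + 1))"
    "(lorentz (u i) (e i))\<^sup>2 + (lorentz (u i) (e (i + 1)))\<^sup>2 = 1"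
    using n0 by (simp_all add: x0_def y0_def x1_def y1_def)
qed

lemma ue [simp]: "lorentz (u i) (e i) = x" "lorentz (u i) (e (i + 1)) = y"
proof -
  have "lorentz (u i) (e i) = x \<and> lorentz (u i) (e (i + 1)) = y"
    by (induction i rule: all_index) (use ue_next in \<open>auto simp: x_def y_def add.assoc\<close>)
  then show "lorentz (u i) (e i) = x" "lorentz (u i) (e (i + 1)) = y" by auto
qed

lemma xy: "x\<^sup>2 + y\<^sup>2 = 1"
  using ue_next(3)[of 0] unfolding ue .

lemma k_mu_nu: "k * mu i * nu i = c $ i + x" "k * mu i * nu (i + 1) = y"
  using ue_mu_nu[of i] by simp_all

text \<open>The product of \<open>k * mu i * nu i\<close> over the cycle does not change when
  \<open>nu i\<close> is replaced by \<open>nu (i + 1)\<close>, which turns every factor into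
  \<open>y\<close>.\<close>

lemma angle_root_x: "angle_root c x"
proof -
  have pos: "0 < c $ i + x" for i
    using k_mu_nu(1)[of i] k_pos mu_pos[of i] nu_pos[of i] by (metis mult_pos_pos)
  have "x\<^sup>2 < 1" using xy y_pos by (smt (verit) zero_less_power)
  then have "x < 1" by (simp add: abs_square_less_1)
  have "(\<Prod>i\<in>UNIV. c $ i + x) = (\<Prod>i\<in>UNIV. k * mu i * nu (i + 1))"
  proof -
    have "(\<Prod>i\<in>UNIV. nu (i + 1)) = (\<Prod>i\<in>UNIV. nu i)"
      unfolding prod_4_shift[of _ 0] by (simp, subst four_eq_0, simp)
    then show ?thesis by (simp add: k_mu_nu(1)[symmetric] prod.distrib)
  qed
  also have "\<dots> = y^4" by (simp add: k_mu_nu)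
  also have "\<dots> = (y\<^sup>2)\<^sup>2" by simp
  also have "y\<^sup>2 = 1 - x\<^sup>2" using xy by simp
  finally show ?thesis using pos \<open>x < 1\<close> by (simp add: angle_root_def)
qed

end

section \<open>Vertices of a configuration in homogeneous coordinates\<close>

definition dehom :: "(real^3) \<times> real \<Rightarrow> real^3" where "dehom z = fst z /\<^sub>R snd z"

lemma hom_dehom: "snd z \<noteq> 0 \<Longrightarrow> hom (dehom z) = (1 / snd z) *\<^sub>R z"
  by (simp add: hom_def dehom_def prod_eq_iff divide_inverse_commute)

text \<open>A causal vector with nonpositive last coordinate lies in the past cone, where
  Cauchy-Schwarz makes its product with \<open>hom v\<close> nonnegative.\<close>

lemma causal_snd_pos:
  assumes "norm v = 1" "lorentz z z \<le> 0" "lorentz z (hom v) < 0"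
  shows "0 < snd z"
proof (rule ccontr)
  assume neg: "\<not> 0 < snd z"
  have "(norm (fst z))\<^sup>2 \<le> (snd z)\<^sup>2"
    using assms(2) by (simp add: lorentz_def power2_norm_eq_inner power2_eq_square[of "snd z"])
  then have "norm (fst z) \<le> - snd z" using neg by (simp add: abs_le_square_iff[symmetric])
  moreover have "- (fst z \<bullet> v) \<le> norm (fst z)"
    using norm_cauchy_schwarz[of "- fst z" v] assms(1) by simp
  ultimately show False using assms(3) by (simp add: lorentz_hom)
qed

lemma norm_dehom:
  assumes "0 < snd z"
  shows "norm (dehom z) \<le> 1 \<longleftrightarrow> lorentz z z \<le> 0"
    "norm (dehom z) = 1 \<longleftrightarrow> lorentz z z = 0"
proof -
  have eq: "lorentz z z = (norm (fst z))\<^sup>2 - (snd z)\<^sup>2"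
    by (simp add: lorentz_def power2_norm_eq_inner power2_eq_square[of "snd z"])
  have *: "norm (dehom z) = norm (fst z) / snd z" using assms by (simp add: dehom_def divide_inverse_commute)
  show "norm (dehom z) \<le> 1 \<longleftrightarrow> lorentz z z \<le> 0"
    "norm (dehom z) = 1 \<longleftrightarrow> lorentz z z = 0"
    unfolding eq * using assms abs_le_square_iff[of "snd z" "norm (fst z)"] abs_le_square_iff[of "norm (fst z)" "snd z"]
    by (auto simp: power2_eq_iff_nonneg intro: power_strict_mono dest: power2_less_imp_less)
qed

lemma prev_plus_2: "i - 1 + 2 = i + 1" for i :: 4
  by simp

context trapezohedral_normals begin

lemma ue_more [simp]:
  "lorentz (e i) (u i) = x" "lorentz (e (i + 1)) (u i) = y"
  "lorentz (u (i + 1)) (e i) = - y" "lorentz (e i) (u (i + 1)) = - y"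
proof -
  show "lorentz (e i) (u i) = x" "lorentz (e (i + 1)) (u i) = y" by (simp_all add: lorentz_commute[of "e _"])
  have "lorentz (u (i + 1)) (e i) = - lorentz (u (i + 1)) (e (i + 1 + 1))" using e_opp[of i] by (simp add: add.assoc)
  then show "lorentz (u (i + 1)) (e i) = - y" by (simp only: ue)
  then show "lorentz (e i) (u (i + 1)) = - y" by (simp add: lorentz_commute[of "e _"])
qed

text \<open>\<open>p i\<close> spans the line common to the planes of \<open>a (i - 1)\<close>,
  \<open>a i\<close> and \<open>b i\<close>, and \<open>q i\<close> the one common to
  \<open>a i\<close>, \<open>b i\<close> and \<open>b (i + 1)\<close>. The formulas solve these
  linear equations up to scale in terms of the two null vectors, \<open>u i\<close> and
  \<open>e i\<close>, without denominators.\<close>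

definition p :: "4 \<Rightarrow> (real^3) \<times> real" where
  "p i = (1 + c $ i * x) *\<^sub>R hom v + (k * (nu i)\<^sup>2) *\<^sub>R hom w + (k * nu i) *\<^sub>R (c $ i *\<^sub>R u i + e i)"
definition q :: "4 \<Rightarrow> (real^3) \<times> real" where
  "q i = (1 + c $ i * x) *\<^sub>R hom w + (k * (mu i)\<^sup>2) *\<^sub>R hom v + (k * mu i) *\<^sub>R (c $ i *\<^sub>R e i + u i)"

lemma nu_y: "nu i * y = nu (i + 1) * (c $ i + x)"
  unfolding k_mu_nu[symmetric, of i] by (simp add: mult_ac)

lemma p_v: "lorentz (p i) (hom v) = - (k * nu i)\<^sup>2"
  by (simp add: p_def power2_eq_square)

lemma p_w: "lorentz (p i) (hom w) = - k * (1 + c $ i * x)"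
  by (simp add: p_def)

lemma p_a: "lorentz (p i) (a i) = 0"
proof -
  have "lorentz (p i) (a i) = k * nu i * (c $ i + x - k * mu i * nu i)"
    by (simp add: a_eq p_def algebra_simps power2_eq_square)
  then show ?thesis by (simp add: k_mu_nu)
qed

lemma p_a_prev: "lorentz (p (i + 1)) (a i) = 0"
proof -
  have "lorentz (p (i + 1)) (a i) = k * nu (i + 1) * (y - k * mu i * nu (i + 1))"
    by (simp add: a_eq p_def right_diff_distrib power2_eq_square)
  then show ?thesis by (simp add: k_mu_nu)
qed

lemma p_b: "lorentz (p i) (b i) = 0"
  by (simp add: b_eq p_def algebra_simps)

lemma p_b_next: "lorentz (p i) (b (i + 1)) = k * nu (i + 1) * ((c $ i)\<^sup>2 - 1)"
proof -
  have "lorentz (p i) (b (i + 1)) = k * (c $ i * (nu i * y) - nu (i + 1) * (1 + c $ i * x))"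
    by (simp add: b_eq p_def left_diff_distrib right_diff_distrib)
  also have "\<dots> = k * nu (i + 1) * ((c $ i)\<^sup>2 - 1)" unfolding nu_y by (simp add: algebra_simps power2_eq_square)
  finally show ?thesis .
qed

text \<open>This is the geometric meaning of the gap: its sign tells on which side of the plane of
  \<open>b i\<close> the vertex \<open>p (i + 1)\<close> lies. The factor \<open>y\<close> avoids a
  division; \<open>nu_y\<close> and \<open>xy\<close> eliminate \<open>nu i\<close> and
  \<open>y\<close>.\<close>

lemma p_b_prev: "y * lorentz (p (i + 1)) (b i) = - k * nu (i + 1) * edge_gap c x i"
proof -
  have "y * lorentz (p (i + 1)) (b i)
      = - k * (nu (i + 1) * c $ (i + 1) * y\<^sup>2 + (nu i * y) * (1 + c $ (i + 1) * x))"
    by (simp add: b_eq p_def) (simp add: algebra_simps power2_eq_square)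
  also have "y\<^sup>2 = 1 - x\<^sup>2" using xy by simp
  finally show ?thesis unfolding nu_y by (simp add: edge_gap_def algebra_simps power2_eq_square)
qed

lemma p_p: "lorentz (p i) (p i) = (k * nu i)\<^sup>2 * ((c $ i)\<^sup>2 - 1)"
  by (simp add: p_def algebra_simps power2_eq_square)

text \<open>Up to normalization this is the negated hyperbolic cosine of the length of the edge from
  \<open>Q i\<close> to \<open>P (i + 1)\<close>.\<close>

lemma q_p: "lorentz (q i) (p (i + 1)) = - k * (1 + c $ i * c $ (i + 1) + x * (c $ i + c $ (i + 1)))"
proof -
  have "lorentz (q i) (p (i + 1)) = - k * ((1 + c $ i * x) * (1 + c $ (i + 1) * x) + (k * mu i * nu (i + 1))\<^sup>2
     + k * mu i * nu (i + 1) * (c $ i * c $ (i + 1) * y - y))"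
    by (simp add: p_def q_def) (simp add: algebra_simps power2_eq_square)
  also have "\<dots> = - k * ((1 + c $ i * x) * (1 + c $ (i + 1) * x) + c $ i * c $ (i + 1) * y\<^sup>2)"
    unfolding k_mu_nu by (simp add: algebra_simps power2_eq_square)
  also have "y\<^sup>2 = 1 - x\<^sup>2" using xy by simp
  finally show ?thesis by (simp add: algebra_simps power2_eq_square)
qed

text \<open>Opposite faces at \<open>v\<close> are tangent there. Pairing with \<open>hom w\<close>
  shows that the multiple is positive, so signs against \<open>a (i + 2)\<close> follow from those
  against \<open>a i\<close> and \<open>hom v\<close>.\<close>

lemma a_opp_pos:
  obtains r where "0 < r" "\<And>z. lorentz z (a (i + 2)) = r * lorentz z (hom v) - lorentz z (a i)"
proof -
  obtain r where r: "a i + a (i + 2) = r *\<^sub>R hom v" using a_opp by blast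
  then have a2: "a (i + 2) = r *\<^sub>R hom v - a i" by (simp add: algebra_simps)
  have "lorentz (hom w) (a i + a (i + 2)) < 0"
    using mult_pos_pos[OF k_pos mu_pos[of i]] mult_pos_pos[OF k_pos mu_pos[of "i + 2"]] by simp
  then have "0 < r" unfolding r using k_pos by (simp add: zero_less_mult_iff)
  then show thesis using that[of r] by (simp add: a2)
qed

text \<open>The first three conditions leave only multiples of \<open>hom v\<close>, and
  \<open>b j\<close> is not orthogonal to \<open>hom v\<close>. Vector identities can therefore be
  verified by four products.\<close>

lemma eq_0_of_orthogonal:
  assumes z: "lorentz z (a i) = 0" "lorentz z (a (i + 1)) = 0" "lorentz z (hom v) = 0" "lorentz z (b j) = 0"
  shows "z = 0"
proof -
  have "\<exists>r. z = r *\<^sub>R hom v"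
    by (rule null_orthogonal_multiple[of v "a i" "a (i + 1)"])
      (use z norm_v a_unit a_next in simp_all)
  then obtain r where r: "z = r *\<^sub>R hom v" by blast
  have "r = 0" using z(4) k_pos nu_pos[of j] unfolding r by simp
  then show ?thesis using r by simp
qed

lemma p_unique:
  assumes z: "lorentz z (a i) = 0" "lorentz z (a (i + 1)) = 0" "lorentz z (b (i + 1)) = 0"
  shows "z = (lorentz z (hom v) / lorentz (p (i + 1)) (hom v)) *\<^sub>R p (i + 1)"
proof -
  have "lorentz (p (i + 1)) (hom v) \<noteq> 0" using k_pos nu_pos[of "i + 1"] by (simp add: p_v)
  then have "z - (lorentz z (hom v) / lorentz (p (i + 1)) (hom v)) *\<^sub>R p (i + 1) = 0"
    by (intro eq_0_of_orthogonal[of _ i "i + 1"]) (simp_all add: z p_a p_a_prev p_b)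
  then show ?thesis by simp
qed

lemma p_snd_pos: "0 < snd (p i)"
proof (rule causal_snd_pos[OF norm_v])
  have "(c $ i)\<^sup>2 \<le> 1" using cos_boxD[OF c_box, of i] by (simp add: abs_square_le_1 abs_le_iff)
  then show "lorentz (p i) (p i) \<le> 0" by (simp add: p_p mult_nonneg_nonpos)
  show "lorentz (p i) (hom v) < 0" using k_pos nu_pos[of i] by (simp add: p_v)
qed

end

context trapezohedral_normals begin

interpretation dual: trapezohedral_normals "\<lambda>i. b (- i)" "\<lambda>i. a (- i)" w v "\<chi> i. c $ (- i)"
  by (rule dual)

text \<open>The dictionary through which facts about the exchanged configuration become facts about
  the original one.\<close>

lemma dual_simps:
  "dual.k = k" "dual.mu i = nu (- i)" "dual.nu i = mu (- i)" "dual.u i = e (- i)" "dual.e i = u (- i)"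
  "dual.x = x" "dual.y = y" "dual.p i = q (- i)" "dual.q i = p (- i)"
proof -
  show k: "dual.k = k" by (simp only: dual.k_def k_def lorentz_commute[of "hom w"])
  show mu: "dual.mu i = nu (- i)" and nu: "dual.nu i = mu (- i)" for i
    by (simp_all only: dual.mu_def dual.nu_def mu_def nu_def k)
  show u: "dual.u i = e (- i)" and e: "dual.e i = u (- i)" for i
    by (simp_all only: dual.u_def dual.e_def u_def e_def mu nu)
  show x: "dual.x = x" using dual.ue(1)[of 0] unfolding u e by simp
  show "dual.y = y" using dual.ue(2)[of "-1"] ue_more(2)[of 0] unfolding u e by simp
  show "dual.p i = q (- i)" "dual.q i = p (- i)"
    by (simp_all only: dual.p_def dual.q_def p_def q_def k mu nu u e x vec_lambda_beta)
qed

lemma q_b: "lorentz (q i) (b i) = 0" and q_a: "lorentz (q i) (a i) = 0"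
  and q_b_next: "lorentz (q i) (b (i + 1)) = 0"
  using dual.p_a[of "- i"] dual.p_b[of "- i"] dual.p_a_prev[of "- i - 1"] unfolding dual_simps
  by (simp_all add: add.commute[of 1])

lemma q_w: "lorentz (q i) (hom w) = - (k * mu i)\<^sup>2"
  and q_v: "lorentz (q i) (hom v) = - k * (1 + c $ i * x)"
  using dual.p_v[of "- i"] dual.p_w[of "- i"] unfolding dual_simps by simp_all

lemma q_a_prev: "lorentz (q i) (a (i - 1)) = k * mu (i - 1) * ((c $ i)\<^sup>2 - 1)"
  using dual.p_b_next[of "- i"] unfolding dual_simps by simp

lemma edge_gap_dual: "edge_gap (\<chi> i. c $ (- i)) x' (- i - 1) = edge_gap c x' i"
  by (simp add: edge_gap_def add.commute mult.commute)

lemma q_a_next: "y * lorentz (q i) (a (i + 1)) = - k * mu i * edge_gap c x i"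
  using dual.p_b_prev[of "- i - 1"] unfolding dual_simps edge_gap_dual by (simp add: add.commute[of 1])

lemma q_q: "lorentz (q i) (q i) = (k * mu i)\<^sup>2 * ((c $ i)\<^sup>2 - 1)"
  using dual.p_p[of "- i"] unfolding dual_simps by simp

lemma q_snd_pos: "0 < snd (q i)"
  using dual.p_snd_pos[of "- i"] unfolding dual_simps by simp

lemma q_unique:
  assumes "lorentz z (a i) = 0" "lorentz z (b i) = 0" "lorentz z (b (i + 1)) = 0"
  shows "z = (lorentz z (hom w) / lorentz (q i) (hom w)) *\<^sub>R q i"
  using dual.p_unique[of z "- i - 1"] assms unfolding dual_simps by (simp add: add.commute[of 1])

text \<open>For \<open>c $ i = 1\<close> the product in \<open>q_a_prev\<close> vanishes, so
  \<open>q i\<close> satisfies all three equations that determine \<open>p i\<close>: the edge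
  shrinks to one vertex.\<close>

lemma q_eq_p: "c $ i = 1 \<Longrightarrow> \<exists>r. q i = r *\<^sub>R p i"
  using p_unique[of "q i" "i - 1"] q_a_prev[of i] q_a[of i] q_b[of i] by fastforce

lemma edge_gap_q_a_neg:
  assumes "0 < edge_gap c x i"
  shows "lorentz (q i) (a (i + 1)) < 0"
proof -
  have "y * lorentz (q i) (a (i + 1)) < 0"
    unfolding q_a_next using assms k_pos mu_pos[of i] by simp
  then show ?thesis using y_pos by (simp add: mult_less_0_iff)
qed

text \<open>The quadrilateral face is cut along the diagonal from \<open>v\<close> to \<open>q i\<close>, on which \<open>\<psi>\<close> vanishes.\<close>

lemma a_face_cone:
  assumes gap: "0 < edge_gap c x i"
    and z: "\<And>j. lorentz z (a j) \<le> 0" "\<And>j. lorentz z (b j) \<le> 0" "lorentz z (a i) = 0"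
  obtains r1 r2 r3 r4 where "0 \<le> r1" "0 \<le> r2" "0 \<le> r3" "0 \<le> r4"
    "z = r1 *\<^sub>R hom v + r2 *\<^sub>R p i + r3 *\<^sub>R q i + r4 *\<^sub>R p (i + 1)"
proof -
  define L M where "L z = lorentz z (a (i - 1))" and "M z = lorentz z (a (i + 1))" for z
  define \<psi> where "\<psi> z = M z * L (q i) - L z * M (q i)" for z
  have Lv: "L (hom v) = 0" and Mv: "M (hom v) = 0" by (simp_all add: L_def M_def)
  have Lp: "L (p i) = 0" using p_a_prev[of "i - 1"] by (simp add: L_def)
  have Mp': "M (p (i + 1)) = 0" using p_a by (simp add: M_def)
  \<comment> \<open>\<open>L\<close> and \<open>M\<close> add up to a positive multiple of the
    product with \<open>hom v\<close>. Hence they are negative at \<open>p (i + 1)\<close> and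
    \<open>p i\<close> respectively, and vectors killed by both are orthogonal to
    \<open>hom v\<close>.\<close>
  obtain r where r: "0 < r" "\<And>z. M z = r * lorentz z (hom v) - L z"
    using a_opp_pos[of "i - 1", unfolded prev_plus_2] unfolding L_def M_def by blast
  have Mp: "M (p i) < 0" using r p_v[of i] k_pos nu_pos[of i] by (simp add: Lp)
  have "L (p (i + 1)) = r * lorentz (p (i + 1)) (hom v)" using r(2)[of "p (i + 1)"] Mp' by simp
  then have Lp': "L (p (i + 1)) < 0" using r p_v[of "i + 1"] k_pos nu_pos[of "i + 1"] by simp
  have Mq: "M (q i) < 0" using edge_gap_q_a_neg[OF gap] by (simp add: M_def)
  have "(c $ i)\<^sup>2 \<le> 1" using cos_boxD[OF c_box, of i] by (simp add: abs_square_le_1 abs_le_iff)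
  then have Lq: "L (q i) \<le> 0"
    using k_pos mu_pos[of "i - 1"] by (simp add: L_def q_a_prev mult_nonneg_nonpos)
  have zero: "d = 0" if "lorentz d (a i) = 0" "L d = 0" "M d = 0" "lorentz d (b j) = 0" for d j
  proof (rule eq_0_of_orthogonal[of d "i - 1" j])
    show "lorentz d (hom v) = 0" using r that by simp
  qed (use that in \<open>simp_all add: L_def\<close>)
  have bv: "lorentz (hom v) (b j) < 0" for j using k_pos nu_pos by simp
  have lin: "L (d + d') = L d + L d'" "M (d + d') = M d + M d'" "L (t *\<^sub>R d) = t * L d" "M (t *\<^sub>R d) = t * M d"
    "L (d - d') = L d - L d'" "M (d - d') = M d - M d'" for d d' t
    by (simp_all add: L_def M_def)
  have Lz: "L z \<le> 0" and Mz: "M z \<le> 0" using z by (simp_all add: L_def M_def)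
  show thesis
  proof (cases "0 < \<psi> z")
    case True
    \<comment> \<open>In the degenerate case \<open>c $ i = 1\<close> the triangle \<open>v\<close>,
      \<open>p i\<close>, \<open>q i\<close> is flat and \<open>L\<close> vanishes at
      \<open>q i\<close>; then \<open>\<psi> z\<close> cannot be positive, so only the other
      triangle occurs.\<close>
    have Lq': "L (q i) < 0"
    proof (rule ccontr)
      assume "\<not> L (q i) < 0"
      then have "\<psi> z = - (L z * M (q i))" using Lq by (simp add: \<psi>_def)
      then show False using True mult_nonpos_nonpos[OF Lz less_imp_le[OF Mq]] by simp
    qed
    have \<psi>p: "\<psi> (p i) = M (p i) * L (q i)" by (simp add: \<psi>_def Lp)
    have \<psi>p_pos: "0 < \<psi> (p i)" unfolding \<psi>p using Mp Lq' by (rule mult_neg_neg)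
    \<comment> \<open>Each coefficient uses a functional that vanishes on the other two generators:
      \<open>b i\<close> on \<open>p i\<close> and \<open>q i\<close>, \<open>\<psi>\<close> on
      \<open>hom v\<close> and \<open>q i\<close>, \<open>L\<close> on \<open>hom v\<close> and
      \<open>p i\<close>.\<close>
    define r1 r2 r3 where "r1 = lorentz z (b i) / lorentz (hom v) (b i)"
      and "r2 = \<psi> z / \<psi> (p i)" and "r3 = L z / L (q i)"
    define d where "d = z - (r1 *\<^sub>R hom v + r2 *\<^sub>R p i + r3 *\<^sub>R q i)"
    have Ld: "L d = 0" unfolding d_def lin using Lq' by (simp add: Lv Lp r3_def)
    have "M d * L (q i) = (M z - r2 * M (p i) - r3 * M (q i)) * L (q i)"
      unfolding d_def lin by (simp add: Mv)
    also have "\<dots> = M z * L (q i) - r2 * \<psi> (p i) - (r3 * L (q i)) * M (q i)"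
      unfolding \<psi>p by (simp add: algebra_simps)
    also have "\<dots> = 0" using \<psi>p_pos Lq' by (simp add: r2_def r3_def \<psi>_def)
    finally have Md: "M d = 0" using Lq' by simp
    have "d = 0"
    proof (rule zero[OF _ Ld Md])
      show "lorentz d (a i) = 0" by (simp add: d_def z p_a q_a)
      show "lorentz d (b i) = 0" using k_pos nu_pos[of i] by (simp add: d_def p_b q_b r1_def)
    qed
    then have "z = r1 *\<^sub>R hom v + r2 *\<^sub>R p i + r3 *\<^sub>R q i + 0 *\<^sub>R p (i + 1)"
      by (simp add: d_def)
    moreover have "0 \<le> r1" "0 \<le> r2" "0 \<le> r3"
      unfolding r1_def r2_def r3_def using True \<psi>p_pos Lz Lq'
      by (simp_all add: divide_nonpos_neg divide_nonpos_neg[OF z(2) bv] del: b_vw)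
    ultimately show thesis using that[of r1 r2 r3 0] by simp
  next
    case False
    have \<psi>p': "\<psi> (p (i + 1)) = - (L (p (i + 1)) * M (q i))" by (simp add: \<psi>_def Mp')
    have \<psi>p'_neg: "\<psi> (p (i + 1)) < 0" unfolding \<psi>p' using mult_neg_neg[OF Lp' Mq] by simp
    define r1 r3 r4 where "r1 = lorentz z (b (i + 1)) / lorentz (hom v) (b (i + 1))"
      and "r3 = M z / M (q i)" and "r4 = \<psi> z / \<psi> (p (i + 1))"
    define d where "d = z - (r1 *\<^sub>R hom v + r3 *\<^sub>R q i + r4 *\<^sub>R p (i + 1))"
    have Md: "M d = 0" unfolding d_def lin using Mq by (simp add: Mv Mp' r3_def)
    have "L d * M (q i) = (L z - r3 * L (q i) - r4 * L (p (i + 1))) * M (q i)"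
      unfolding d_def lin by (simp add: Lv)
    also have "\<dots> = L z * M (q i) - (r3 * M (q i)) * L (q i) + r4 * \<psi> (p (i + 1))"
      unfolding \<psi>p' by (simp add: algebra_simps)
    also have "\<dots> = 0" using \<psi>p'_neg Mq by (simp add: r3_def r4_def \<psi>_def)
    finally have Ld: "L d = 0" using Mq by simp
    have "d = 0"
    proof (rule zero[OF _ Ld Md])
      show "lorentz d (a i) = 0" by (simp add: d_def z p_a_prev q_a)
      show "lorentz d (b (i + 1)) = 0" using k_pos nu_pos[of "i + 1"] by (simp add: d_def p_b q_b_next r1_def)
    qed
    then have "z = r1 *\<^sub>R hom v + 0 *\<^sub>R p i + r3 *\<^sub>R q i + r4 *\<^sub>R p (i + 1)"
      by (simp add: d_def)
    moreover have "0 \<le> r1" "0 \<le> r3" "0 \<le> r4"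
      unfolding r1_def r3_def r4_def using False \<psi>p'_neg Mz Mq
      by (simp_all add: divide_nonpos_neg divide_nonpos_neg[OF z(2) bv] del: b_vw)
    ultimately show thesis using that[of r1 0 r3 r4] by simp
  qed
qed

end

context trapezohedral_normals begin

interpretation dual: trapezohedral_normals "\<lambda>i. b (- i)" "\<lambda>i. a (- i)" w v "\<chi> i. c $ (- i)"
  by (rule dual)

lemma b_face_cone:
  assumes gap: "0 < edge_gap c x (i - 1)"
    and z: "\<And>j. lorentz z (a j) \<le> 0" "\<And>j. lorentz z (b j) \<le> 0" "lorentz z (b i) = 0"
  obtains r1 r2 r3 r4 where "0 \<le> r1" "0 \<le> r2" "0 \<le> r3" "0 \<le> r4"
    "z = r1 *\<^sub>R hom w + r2 *\<^sub>R q i + r3 *\<^sub>R p i + r4 *\<^sub>R q (i - 1)"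
  using dual.a_face_cone[of "- i" z] assms edge_gap_dual[of x "i - 1"] unfolding dual_simps by simp blast

end

subsection \<open>The polytope of a configuration\<close>

text \<open>A supporting hyperplane cuts out a face, and a face of a hull is the hull of some of the
  generators, which must then lie on the hyperplane.\<close>

lemma convex_hull_Int_supporting_hyperplane:
  fixes V :: "'a::euclidean_space set"
  assumes "finite V" "\<And>x. x \<in> V \<Longrightarrow> n \<bullet> x \<le> r"
  shows "convex hull V \<inter> {x. n \<bullet> x = r} = convex hull {x \<in> V. n \<bullet> x = r}"
proof
  have "convex hull V \<subseteq> {x. n \<bullet> x \<le> r}"
    using assms by (intro hull_minimal) (auto simp: convex_halfspace_le)
  then have "convex hull V \<inter> {x. n \<bullet> x = r} face_of convex hull V"
    by (intro face_of_Int_supporting_hyperplane_le) auto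
  then obtain V' where V': "V' \<subseteq> V" "convex hull V \<inter> {x. n \<bullet> x = r} = convex hull V'"
    using face_of_convex_hull_subset[of V] finite_imp_compact[OF assms(1)] by blast
  then have "V' \<subseteq> {x. n \<bullet> x = r}" using hull_subset[of V' convex] by blast
  then have "V' \<subseteq> {x \<in> V. n \<bullet> x = r}" using V' by blast
  then show "convex hull V \<inter> {x. n \<bullet> x = r} \<subseteq> convex hull {x \<in> V. n \<bullet> x = r}"
    unfolding V' by (rule hull_mono)
  show "convex hull {x \<in> V. n \<bullet> x = r} \<subseteq> convex hull V \<inter> {x. n \<bullet> x = r}"
    by (intro Int_greatest hull_mono hull_minimal) (auto simp: convex_hyperplane)
qed

text \<open>The cone over \<open>C\<close> at height 1. For convex \<open>C\<close> it is closed
  under addition, so nonnegative combinations of unnormalized vertex vectors can be used in place of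
  convex combinations.\<close>

definition hom_cone :: "(real^3) set \<Rightarrow> ((real^3) \<times> real) set"
  where "hom_cone C = {t *\<^sub>R hom X | t X. 0 \<le> t \<and> X \<in> C}"

lemma hom_cone_scale: "X \<in> C \<Longrightarrow> 0 \<le> t \<Longrightarrow> t *\<^sub>R hom X \<in> hom_cone C"
  by (auto simp: hom_cone_def)

lemma hom_cone_add:
  assumes "convex C" "z \<in> hom_cone C" "z' \<in> hom_cone C"
  shows "z + z' \<in> hom_cone C"
proof -
  obtain t X t' X' where z: "z = t *\<^sub>R hom X" "0 \<le> t" "X \<in> C" "z' = t' *\<^sub>R hom X'" "0 \<le> t'" "X' \<in> C"
    using assms by (auto simp: hom_cone_def)
  show ?thesis
  proof (cases "t + t' = 0")
    case True
    then have "t = 0" "t' = 0" using z by auto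
    then show ?thesis using hom_cone_scale[OF z(3), of 0] by (simp add: z)
  next
    case False
    then have pos: "0 < t + t'" using z by auto
    define Y where "Y = (t / (t + t')) *\<^sub>R X + (t' / (t + t')) *\<^sub>R X'"
    have "Y \<in> C" unfolding Y_def using assms(1) z pos
      by (intro convexD) (auto simp: add_divide_distrib[symmetric])
    moreover have "z + z' = (t + t') *\<^sub>R hom Y"
      using pos by (simp add: z Y_def hom_def prod_eq_iff scaleR_add_right)
    ultimately show ?thesis using pos hom_cone_scale[of Y C "t + t'"] by simp
  qed
qed

lemma hom_cone_hom: "hom X \<in> hom_cone C \<Longrightarrow> X \<in> C"
  by (auto simp: hom_cone_def hom_def)

lemma index_cases:
  fixes i j :: 4
  obtains "j = i" | "j = i + 1" | "j = i + 2" | "j = i - 1"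
proof -
  have "j - i = 0 \<or> j - i = 1 \<or> j - i = 2 \<or> j - i = 3"
    using exhaust_4[of "j - i"] four_eq_0 by metis
  moreover have "j = i + (j - i)" by simp
  ultimately have "j = i + 0 \<or> j = i + 1 \<or> j = i + 2 \<or> j = i + 3" by metis
  moreover have "i + 3 = i - 1" by (simp add: eq_diff_eq add.assoc)
  ultimately have "j = i \<or> j = i + 1 \<or> j = i + 2 \<or> j = i - 1" by auto
  then show thesis using that by blast
qed

lemma index_neq [simp]:
  "i + 1 \<noteq> i" "i \<noteq> i + 1" "i + 2 \<noteq> i" "i \<noteq> i + 2" "i - 1 \<noteq> i" "i \<noteq> i - 1"
  "i - 1 - 1 \<noteq> i" "i \<noteq> i - 1 - 1" "i + 1 + 1 \<noteq> i" "i \<noteq> i + 1 + 1" "i + 1 \<noteq> i - 1" "i - 1 \<noteq> i + 1" "i + 2 \<noteq> i - 1" "i - 1 \<noteq> i + 2" "i + 1 \<noteq> i + 2" "i + 2 \<noteq> i + 1" for i :: 4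
  by (simp_all add: algebra_simps)

locale trapezohedral_polytope = trapezohedral_normals +
  assumes gap: "0 < edge_gap c x i"
begin

lemma c_sq: "(c $ i)\<^sup>2 - 1 \<le> 0" "(c $ i)\<^sup>2 - 1 = 0 \<longleftrightarrow> c $ i = 1"
  using cos_boxD[OF c_box, of i] by (simp_all add: abs_square_le_1 abs_le_iff power2_eq_1_iff)

lemma one_plus_cx: "0 < 1 + c $ i * x"
  using cos_boxD[OF c_box, of i] angle_root_gt[OF c_box angle_root_x] angle_rootD(2)[OF angle_root_x]
  by (intro one_plus_mult_pos) auto

lemma p_v_neg: "lorentz (p i) (hom v) < 0" and p_w_neg: "lorentz (p i) (hom w) < 0"
  and q_v_neg: "lorentz (q i) (hom v) < 0" and q_w_neg: "lorentz (q i) (hom w) < 0"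
  using k_pos nu_pos[of i] mu_pos[of i] one_plus_cx[of i] by (simp_all add: p_v p_w q_v q_w)

lemma p_a_sign: "lorentz (p i) (a j) \<le> 0 \<and> (lorentz (p i) (a j) = 0 \<longleftrightarrow> j = i \<or> j = i - 1)"
proof (cases rule: index_cases[of j i])
  case 1 then show ?thesis by (simp add: p_a)
next
  case 2
  obtain r where r: "0 < r" "\<And>z. lorentz z (a (i + 1)) = r * lorentz z (hom v) - lorentz z (a (i - 1))"
    using a_opp_pos[of "i - 1", unfolded prev_plus_2] by blast
  have "lorentz (p i) (a (i + 1)) < 0"
    using r(1) p_v_neg[of i] p_a_prev[of "i - 1"] by (simp add: r(2) mult_pos_neg)
  then show ?thesis using 2 by simp
next
  case 3
  obtain r where r: "0 < r" "\<And>z. lorentz z (a (i + 2)) = r * lorentz z (hom v) - lorentz z (a i)"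
    using a_opp_pos[of i] by blast
  have "lorentz (p i) (a (i + 2)) < 0"
    using r(1) p_v_neg[of i] p_a[of i] by (simp add: r(2) mult_pos_neg)
  then show ?thesis using 3 by simp
next
  case 4 then show ?thesis using p_a_prev[of "i - 1"] by simp
qed

text \<open>Among the four cases the gap decides the sign only for \<open>j = i + 1\<close>. The
  case \<open>j = i - 1\<close> becomes an equality exactly when the edge at \<open>i\<close> has
  shrunk to an ideal vertex.\<close>

lemma q_a_sign: "lorentz (q i) (a j) \<le> 0 \<and> (lorentz (q i) (a j) = 0 \<longleftrightarrow> j = i \<or> j = i - 1 \<and> c $ i = 1)"
proof (cases rule: index_cases[of j i])
  case 1 then show ?thesis by (simp add: q_a)
next
  case 2 then show ?thesis using edge_gap_q_a_neg[OF gap[of i]] by simp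
next
  case 3
  obtain r where r: "0 < r" "\<And>z. lorentz z (a (i + 2)) = r * lorentz z (hom v) - lorentz z (a i)"
    using a_opp_pos[of i] by blast
  have "lorentz (q i) (a (i + 2)) < 0"
    using r(1) q_v_neg[of i] q_a[of i] by (simp add: r(2) mult_pos_neg)
  then show ?thesis using 3 by simp
next
  case 4
  show ?thesis
    using k_pos mu_pos[of "i - 1"] c_sq[of i] unfolding 4
    by (simp add: q_a_prev mult_nonneg_nonpos)
qed

lemma dual_polytope:
  "trapezohedral_polytope (\<lambda>i. b (- i)) (\<lambda>i. a (- i)) w v (\<chi> i. c $ (- i))"
proof -
  interpret dual: trapezohedral_normals "\<lambda>i. b (- i)" "\<lambda>i. a (- i)" w v "\<chi> i. c $ (- i)"
    by (rule dual)
  show ?thesis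
  proof
    fix i
    show "0 < edge_gap (\<chi> i. c $ (- i)) dual.x i"
      using gap[of "- i - 1"] edge_gap_dual[of x "- i - 1"] unfolding dual_simps by simp
  qed
qed

lemma q_b_sign: "lorentz (q i) (b j) \<le> 0 \<and> (lorentz (q i) (b j) = 0 \<longleftrightarrow> j = i \<or> j = i + 1)"
  and p_b_sign: "lorentz (p i) (b j) \<le> 0 \<and> (lorentz (p i) (b j) = 0 \<longleftrightarrow> j = i \<or> j = i + 1 \<and> c $ i = 1)"
proof -
  interpret dual: trapezohedral_polytope "\<lambda>i. b (- i)" "\<lambda>i. a (- i)" w v "\<chi> i. c $ (- i)"
    by (rule dual_polytope)
  have "- i - 1 = - (i + 1)" by simp
  then have "- j = - i - 1 \<longleftrightarrow> j = i + 1" by (simp only: neg_equal_iff_equal)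
  then show "lorentz (q i) (b j) \<le> 0 \<and> (lorentz (q i) (b j) = 0 \<longleftrightarrow> j = i \<or> j = i + 1)"
    "lorentz (p i) (b j) \<le> 0 \<and> (lorentz (p i) (b j) = 0 \<longleftrightarrow> j = i \<or> j = i + 1 \<and> c $ i = 1)"
    using dual.p_a_sign[of "- i" "- j"] dual.q_a_sign[of "- i" "- j"] unfolding dual_simps by simp_all
qed

definition P :: "4 \<Rightarrow> real^3" where "P i = dehom (p i)"
definition Q :: "4 \<Rightarrow> real^3" where "Q i = dehom (q i)"

lemma p_hom: "p i = snd (p i) *\<^sub>R hom (P i)" and q_hom: "q i = snd (q i) *\<^sub>R hom (Q i)"
  using p_snd_pos[of i] q_snd_pos[of i] by (simp_all add: hom_dehom P_def Q_def)

lemma P_sign: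
  "lorentz (a j) (hom (P i)) \<le> 0" "lorentz (a j) (hom (P i)) = 0 \<longleftrightarrow> j = i \<or> j = i - 1"
  "lorentz (b j) (hom (P i)) \<le> 0" "lorentz (b j) (hom (P i)) = 0 \<longleftrightarrow> j = i \<or> j = i + 1 \<and> c $ i = 1"
proof -
  have *: "lorentz n (hom (P i)) = lorentz (p i) n / snd (p i)" for n
    using p_snd_pos[of i] by (subst p_hom) (simp add: lorentz_commute)
  show "lorentz (a j) (hom (P i)) \<le> 0" "lorentz (a j) (hom (P i)) = 0 \<longleftrightarrow> j = i \<or> j = i - 1"
    "lorentz (b j) (hom (P i)) \<le> 0" "lorentz (b j) (hom (P i)) = 0 \<longleftrightarrow> j = i \<or> j = i + 1 \<and> c $ i = 1"
    unfolding * using p_a_sign[of i j] p_b_sign[of i j] p_snd_pos[of i] by (simp_all add: divide_nonpos_pos)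
qed

lemma Q_sign:
  "lorentz (a j) (hom (Q i)) \<le> 0" "lorentz (a j) (hom (Q i)) = 0 \<longleftrightarrow> j = i \<or> j = i - 1 \<and> c $ i = 1"
  "lorentz (b j) (hom (Q i)) \<le> 0" "lorentz (b j) (hom (Q i)) = 0 \<longleftrightarrow> j = i \<or> j = i + 1"
proof -
  have *: "lorentz n (hom (Q i)) = lorentz (q i) n / snd (q i)" for n
    using q_snd_pos[of i] by (subst q_hom) (simp add: lorentz_commute)
  show "lorentz (a j) (hom (Q i)) \<le> 0" "lorentz (a j) (hom (Q i)) = 0 \<longleftrightarrow> j = i \<or> j = i - 1 \<and> c $ i = 1"
    "lorentz (b j) (hom (Q i)) \<le> 0" "lorentz (b j) (hom (Q i)) = 0 \<longleftrightarrow> j = i \<or> j = i + 1"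
    unfolding * using q_a_sign[of i j] q_b_sign[of i j] q_snd_pos[of i] by (simp_all add: divide_nonpos_pos)
qed

text \<open>Vertices are told apart by the planes that contain them: equal points have equal
  incidences, and the sign lemmas translate incidences into indices.\<close>

lemma P_eq_Q: "P i = Q j \<longleftrightarrow> i = j \<and> c $ i = 1"
proof
  assume eq: "P i = Q j"
  have "lorentz (a j) (hom (Q j)) = 0" "lorentz (a i) (hom (P i)) = 0" "lorentz (a (i - 1)) (hom (P i)) = 0"
    by (simp_all add: P_sign Q_sign)
  then have "j = i \<or> j = i - 1" "i = j \<or> i = j - 1 \<and> c $ j = 1" "i - 1 = j \<or> i - 1 = j - 1 \<and> c $ j = 1"
    unfolding P_sign Q_sign eq unfolding eq[symmetric] P_sign by auto
  then show "i = j \<and> c $ i = 1" by auto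
next
  assume "i = j \<and> c $ i = 1"
  then obtain r where r: "q i = r *\<^sub>R p i" "i = j" using q_eq_p by blast
  then have "snd (q i) = r * snd (p i)" by simp
  then have "r \<noteq> 0" using q_snd_pos[of i] by auto
  then show "P i = Q j" using r by (simp add: P_def Q_def dehom_def)
qed

lemma inj_P: "inj P"
proof
  fix i j assume eq: "P i = P j"
  have "lorentz (a i) (hom (P j)) = 0" "lorentz (a (i - 1)) (hom (P j)) = 0"
    unfolding eq[symmetric] by (simp_all add: P_sign)
  then have "i = j \<or> i = j - 1" "i - 1 = j \<or> i - 1 = j - 1" unfolding P_sign by auto
  then show "i = j" by auto
qed

lemma inj_Q: "inj Q"
proof
  fix i j assume eq: "Q i = Q j"
  have "lorentz (b i) (hom (Q j)) = 0" "lorentz (b (i + 1)) (hom (Q j)) = 0"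
    unfolding eq[symmetric] by (simp_all add: Q_sign)
  then have "i = j \<or> i = j + 1" "i + 1 = j \<or> i + 1 = j + 1" unfolding Q_sign by auto
  then show "i = j" by auto
qed

lemma v_sign: "lorentz (a j) (hom v) = 0" "lorentz (b j) (hom v) < 0"
  and w_sign: "lorentz (b j) (hom w) = 0" "lorentz (a j) (hom w) < 0"
  using a_v b_v b_w a_w by blast+

lemma vw_PQ: "v \<noteq> P i" "v \<noteq> Q i" "w \<noteq> P i" "w \<noteq> Q i" "P i \<noteq> v" "Q i \<noteq> v" "P i \<noteq> w" "Q i \<noteq> w"
  using P_sign(4)[of i i] Q_sign(4)[of i i] P_sign(2)[of i i] Q_sign(2)[of i i]
    v_sign(2)[of i] w_sign(2)[of i] by auto

definition vertices :: "(real^3) set" where "vertices = {v, w} \<union> range P \<union> range Q"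

definition body :: "(real^3) set"
  where "body = {X. \<forall>i. lorentz (a i) (hom X) \<le> 0 \<and> lorentz (b i) (hom X) \<le> 0}"

lemma finite_vertices: "finite vertices"
  by (simp add: vertices_def)

lemma convex_body: "convex body"
proof -
  have "body = (\<Inter>i. {X. fst (a i) \<bullet> X \<le> snd (a i)} \<inter> {X. fst (b i) \<bullet> X \<le> snd (b i)})"
    by (auto simp: body_def lorentz_hom)
  then show ?thesis by (simp add: convex_INT convex_Int convex_halfspace_le)
qed

lemma vertices_sign: "X \<in> vertices \<Longrightarrow> lorentz (a i) (hom X) \<le> 0"
  "X \<in> vertices \<Longrightarrow> lorentz (b i) (hom X) \<le> 0"
  using v_sign[of i] w_sign[of i] P_sign[of i] Q_sign[of i] by (auto simp: vertices_def)

text \<open>Projection from \<open>v\<close>: subtract from \<open>hom X\<close> the largest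
  multiple \<open>t\<close> of \<open>hom v\<close> that keeps all products with the
  \<open>b j\<close> nonpositive; \<open>f j\<close> is the multiple at which \<open>b j\<close>
  becomes tight. The products with the \<open>a j\<close> do not change, so the remainder lies over
  a face at \<open>w\<close>, and \<open>b_face_cone\<close> expresses it by the vertices of that
  face.\<close>

lemma body_eq_hull: "body = convex hull vertices"
proof
  show "convex hull vertices \<subseteq> body"
    by (intro hull_minimal convex_body) (auto simp: body_def vertices_sign)
  show "body \<subseteq> convex hull vertices"
  proof
    fix X assume "X \<in> body"
    then have z: "lorentz (hom X) (a j) \<le> 0" "lorentz (hom X) (b j) \<le> 0" for j
      by (auto simp: body_def lorentz_commute)
    define f where "f j = lorentz (hom X) (b j) / lorentz (hom v) (b j)" for j
    define t where "t = Min (range f)"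
    have "t \<in> range f" unfolding t_def by (intro Min_in) auto
    then obtain j where j: "t = f j" by blast
    have t_le: "t \<le> f i" for i unfolding t_def by (intro Min_le) auto
    have bv: "lorentz (hom v) (b i) < 0" for i using b_v[of i] by (simp add: lorentz_commute del: b_vw)
    have t0: "0 \<le> t" unfolding j f_def using z(2) bv by (intro divide_nonpos_neg) auto
    define z' where "z' = hom X - t *\<^sub>R hom v"
    have za: "lorentz z' (a i) \<le> 0" for i using z by (simp add: z'_def)
    have zb: "lorentz z' (b i) \<le> 0" for i
    proof -
      have "f i * lorentz (hom v) (b i) \<le> t * lorentz (hom v) (b i)"
        using t_le bv[of i] by (intro mult_right_mono_neg) auto
      then show ?thesis using bv[of i] by (simp add: z'_def f_def del: b_vw)
    qed
    have zj: "lorentz z' (b j) = 0" using bv[of j] by (simp add: z'_def j f_def del: b_vw)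
    obtain r1 r2 r3 r4 where r: "0 \<le> r1" "0 \<le> r2" "0 \<le> r3" "0 \<le> r4"
      "z' = r1 *\<^sub>R hom w + r2 *\<^sub>R q j + r3 *\<^sub>R p j + r4 *\<^sub>R q (j - 1)"
      by (rule b_face_cone[OF gap za zb zj])
    have in_V: "r *\<^sub>R hom Y \<in> hom_cone (convex hull vertices)" if "Y \<in> vertices" "0 \<le> r" for r Y
      using that by (intro hom_cone_scale hull_inc)
    have in_pq: "r *\<^sub>R p i \<in> hom_cone (convex hull vertices)" "r *\<^sub>R q i \<in> hom_cone (convex hull vertices)"
      if "0 \<le> r" for r i
      using in_V[of "P i" "r * snd (p i)"] in_V[of "Q i" "r * snd (q i)"] p_hom[of i] q_hom[of i]
        p_snd_pos[of i] q_snd_pos[of i] that by (auto simp: vertices_def) (metis scaleR_scaleR)+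
    have "hom X = z' + t *\<^sub>R hom v" by (simp add: z'_def)
    also have "\<dots> \<in> hom_cone (convex hull vertices)"
      unfolding r(5) by (intro hom_cone_add convex_convex_hull in_pq in_V r t0) (auto simp: vertices_def)
    finally show "X \<in> convex hull vertices" by (rule hom_cone_hom)
  qed
qed

end

section \<open>Face lattice and dihedral angles of the polytope\<close>

lemma index_eq_prev: "i = j - 1 \<longleftrightarrow> j = i + 1" "j - 1 = i \<longleftrightarrow> j = i + 1" for i j :: 4
  by auto

lemma aff_dim_triple_ge:
  fixes X Y Z :: "'a::euclidean_space"
  assumes "X \<noteq> Y" "n \<bullet> X = r" "n \<bullet> Y = r" "n \<bullet> Z \<noteq> r"
  shows "aff_dim {X, Y, Z} = 2"
proof -
  have "affine hull {X, Y} \<subseteq> {x. n \<bullet> x = r}"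
    using assms by (intro hull_minimal) (auto simp: affine_hyperplane)
  then have "Z \<notin> affine hull {X, Y}" using assms by auto
  then have "aff_dim (insert Z {X, Y}) = 2" using assms by (simp add: aff_dim_insert aff_dim_2)
  moreover have "{X, Y, Z} = insert Z {X, Y}" by auto
  ultimately show ?thesis by simp
qed

context trapezohedral_polytope begin

lemma vertices_le: "X \<in> vertices \<Longrightarrow> fst (a i) \<bullet> X \<le> snd (a i)"
  "X \<in> vertices \<Longrightarrow> fst (b i) \<bullet> X \<le> snd (b i)"
  using vertices_sign[of X i] by (simp_all add: lorentz_hom)

lemma body_le: "X \<in> body \<Longrightarrow> fst (a i) \<bullet> X \<le> snd (a i)" "X \<in> body \<Longrightarrow> fst (b i) \<bullet> X \<le> snd (b i)"
  by (auto simp: body_def lorentz_hom)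

definition face_a :: "4 \<Rightarrow> (real^3) set" where "face_a i = convex hull {v, P i, Q i, P (i + 1)}"
definition face_b :: "4 \<Rightarrow> (real^3) set" where "face_b i = convex hull {w, Q (i - 1), P i, Q i}"

lemma tight_a: "{X \<in> vertices. fst (a i) \<bullet> X = snd (a i)} = {v, P i, Q i, P (i + 1)}"
proof -
  have "{X \<in> vertices. lorentz (a i) (hom X) = 0} = {v, P i, Q i, P (i + 1)}"
    using v_sign(1)[of i] w_sign(2)[of i] P_eq_Q[of "i + 1" "i + 1"]
    by (auto simp: vertices_def P_sign Q_sign index_eq_prev)
  then show ?thesis by (simp add: lorentz_hom)
qed

lemma tight_b: "{X \<in> vertices. fst (b i) \<bullet> X = snd (b i)} = {w, Q (i - 1), P i, Q i}"
proof -
  have eq: "i = j + 1 \<longleftrightarrow> j = i - 1" for j by auto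
  have "{X \<in> vertices. lorentz (b i) (hom X) = 0} = {w, Q (i - 1), P i, Q i}"
    using v_sign(2)[of i] w_sign(1)[of i] P_eq_Q[of "i - 1" "i - 1"]
    by (auto simp: vertices_def P_sign Q_sign eq)
  then show ?thesis by (simp add: lorentz_hom)
qed

lemma face_a_eq: "face_a i = body \<inter> {X. fst (a i) \<bullet> X = snd (a i)}"
  unfolding face_a_def body_eq_hull
  by (subst convex_hull_Int_supporting_hyperplane[OF finite_vertices vertices_le(1)]) (simp_all add: tight_a)

lemma face_b_eq: "face_b i = body \<inter> {X. fst (b i) \<bullet> X = snd (b i)}"
  unfolding face_b_def body_eq_hull
  by (subst convex_hull_Int_supporting_hyperplane[OF finite_vertices vertices_le(2)]) (simp_all add: tight_b)

lemma face_a_face: "face_a i face_of body" and face_b_face: "face_b i face_of body"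
  unfolding face_a_eq face_b_eq
  by (intro face_of_Int_supporting_hyperplane_le convex_body body_le; assumption)+

lemma face_Int_hull:
  assumes F: "F = convex hull V" "V \<subseteq> vertices"
  shows "F \<inter> face_a i = convex hull (V \<inter> {v, P i, Q i, P (i + 1)})"
    and "F \<inter> face_b i = convex hull (V \<inter> {w, Q (i - 1), P i, Q i})"
proof -
  have fin: "finite V" using F finite_subset[OF _ finite_vertices] by blast
  have "F \<subseteq> body" unfolding F body_eq_hull using F(2) by (rule hull_mono)
  then have "F \<inter> face_a i = convex hull V \<inter> {X. fst (a i) \<bullet> X = snd (a i)}"
    "F \<inter> face_b i = convex hull V \<inter> {X. fst (b i) \<bullet> X = snd (b i)}"
    using F by (auto simp: face_a_eq face_b_eq)
  moreover have "convex hull V \<inter> {X. fst (a i) \<bullet> X = snd (a i)} = convex hull {X \<in> V. fst (a i) \<bullet> X = snd (a i)}"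
    "convex hull V \<inter> {X. fst (b i) \<bullet> X = snd (b i)} = convex hull {X \<in> V. fst (b i) \<bullet> X = snd (b i)}"
    using F(2) vertices_le by (intro convex_hull_Int_supporting_hyperplane fin; blast)+
  moreover have "{X \<in> V. fst (a i) \<bullet> X = snd (a i)} = V \<inter> {v, P i, Q i, P (i + 1)}"
    "{X \<in> V. fst (b i) \<bullet> X = snd (b i)} = V \<inter> {w, Q (i - 1), P i, Q i}"
    using F(2) unfolding tight_a[symmetric] tight_b[symmetric] by auto
  ultimately show "F \<inter> face_a i = convex hull (V \<inter> {v, P i, Q i, P (i + 1)})"
    "F \<inter> face_b i = convex hull (V \<inter> {w, Q (i - 1), P i, Q i})" by simp_all
qed

lemma vertices_mem [simp]: "v \<in> vertices" "w \<in> vertices" "P i \<in> vertices" "Q i \<in> vertices"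
  by (auto simp: vertices_def)

lemma P_inject [simp]: "P i = P j \<longleftrightarrow> i = j" and Q_inject [simp]: "Q i = Q j \<longleftrightarrow> i = j"
  using inj_P inj_Q by (auto dest: injD)

lemma Q_eq_P: "Q j = P i \<longleftrightarrow> i = j \<and> c $ i = 1"
  using P_eq_Q[of i j] by auto

lemmas vertex_eq = P_eq_Q Q_eq_P vw_PQ v_neq_w v_neq_w[symmetric]

text \<open>Intersections of faces are computed on vertex sets. The fifth item is only an inclusion
  because these two faces meet just when \<open>c $ (i + 1) = 1\<close>, in the ideal vertex
  \<open>P (i + 1) = Q (i + 1)\<close>.\<close>

lemma face_a_Int:
  "face_a i \<inter> face_a (i + 1) = convex hull {v, P (i + 1)}"
  "face_a i \<inter> face_a (i + 2) = convex hull {v}"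
  "face_a i \<inter> face_b i = convex hull {P i, Q i}"
  "face_a i \<inter> face_b (i + 1) = convex hull {Q i, P (i + 1)}"
  "face_a i \<inter> face_b (i + 2) \<subseteq> convex hull {P (i + 1)}"
  "face_a i \<inter> face_b (i - 1) = {}"
proof -
  have sub: "{v, P i, Q i, P (i + 1)} \<subseteq> vertices" by simp
  note I = face_Int_hull[OF face_a_def sub]
  have "{v, P i, Q i, P (i + 1)} \<inter> {v, P (i + 1), Q (i + 1), P (i + 1 + 1)} = {v, P (i + 1)}"
    by (auto simp: vertex_eq)
  then show "face_a i \<inter> face_a (i + 1) = convex hull {v, P (i + 1)}" unfolding I by (simp only:)
  have "i + 2 + 1 = i - 1" by (simp add: eq_diff_eq add.assoc)
  then have "{v, P i, Q i, P (i + 1)} \<inter> {v, P (i + 2), Q (i + 2), P (i + 2 + 1)} = {v}"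
    by (auto simp: vertex_eq)
  then show "face_a i \<inter> face_a (i + 2) = convex hull {v}" unfolding I by (simp only:)
  have "{v, P i, Q i, P (i + 1)} \<inter> {w, Q (i - 1), P i, Q i} = {P i, Q i}"
    by (auto simp: vertex_eq)
  then show "face_a i \<inter> face_b i = convex hull {P i, Q i}" unfolding I by (simp only:)
  have "{v, P i, Q i, P (i + 1)} \<inter> {w, Q (i + 1 - 1), P (i + 1), Q (i + 1)} = {Q i, P (i + 1)}"
    by (auto simp: vertex_eq)
  then show "face_a i \<inter> face_b (i + 1) = convex hull {Q i, P (i + 1)}" unfolding I by (simp only:)
  have "i + 2 - 1 = i + 1" by simp
  then have "{v, P i, Q i, P (i + 1)} \<inter> {w, Q (i + 2 - 1), P (i + 2), Q (i + 2)} \<subseteq> {P (i + 1)}"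
    by (auto simp: vertex_eq)
  then show "face_a i \<inter> face_b (i + 2) \<subseteq> convex hull {P (i + 1)}" unfolding I by (rule hull_mono)
  have "i - 1 - 1 = i + 2" by (simp add: algebra_simps)
  then have "{v, P i, Q i, P (i + 1)} \<inter> {w, Q (i - 1 - 1), P (i - 1), Q (i - 1)} = {}"
    by (auto simp: vertex_eq)
  then show "face_a i \<inter> face_b (i - 1) = {}" unfolding I by (simp only: convex_hull_empty)
qed

lemma face_b_Int:
  "face_b i \<inter> face_b (i + 1) = convex hull {w, Q i}"
  "face_b i \<inter> face_b (i + 2) = convex hull {w}"
proof -
  have sub: "{w, Q (i - 1), P i, Q i} \<subseteq> vertices" by simp
  note I = face_Int_hull[OF face_b_def sub]
  have "{w, Q (i - 1), P i, Q i} \<inter> {w, Q (i + 1 - 1), P (i + 1), Q (i + 1)} = {w, Q i}"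
    by (auto simp: vertex_eq)
  then show "face_b i \<inter> face_b (i + 1) = convex hull {w, Q i}" unfolding I by (simp only:)
  have "i + 2 - 1 = i + 1" by simp
  then have "{w, Q (i - 1), P i, Q i} \<inter> {w, Q (i + 2 - 1), P (i + 2), Q (i + 2)} = {w}"
    by (auto simp: vertex_eq)
  then show "face_b i \<inter> face_b (i + 2) = convex hull {w}" unfolding I by (simp only:)
qed

lemma vertices_ball: "X \<in> vertices \<Longrightarrow> norm X \<le> 1"
proof -
  have "norm (P i) \<le> 1" "norm (Q i) \<le> 1" for i
    unfolding P_def Q_def norm_dehom(1)[OF p_snd_pos] norm_dehom(1)[OF q_snd_pos] p_p q_q
    using c_sq(1)[of i] by (simp_all add: mult_nonneg_nonpos)
  then show "X \<in> vertices \<Longrightarrow> norm X \<le> 1" using norm_v norm_w by (auto simp: vertices_def)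
qed

lemma norm_P: "norm (P i) = 1 \<longleftrightarrow> c $ i = 1"
  using c_sq(2)[of i] k_pos nu_pos[of i] unfolding P_def norm_dehom(2)[OF p_snd_pos] p_p by simp

lemma body_ball: "body \<subseteq> cball 0 1"
  unfolding body_eq_hull by (intro hull_minimal) (auto simp: vertices_ball)

lemma polyhedron_body: "polyhedron body" and compact_body: "compact body"
  unfolding body_eq_hull
  by (intro polytope_imp_polyhedron polytope_convex_hull finite_vertices)
    (intro compact_convex_hull finite_imp_compact finite_vertices)

definition open_body :: "(real^3) set"
  where "open_body = {X. \<forall>i. lorentz (a i) (hom X) < 0 \<and> lorentz (b i) (hom X) < 0}"

lemma open_body_subset: "open_body \<subseteq> interior body"
proof (rule interior_maximal)
  show "open_body \<subseteq> body" by (auto simp: open_body_def body_def less_imp_le)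
  have "open_body = (\<Inter>i. {X. fst (a i) \<bullet> X < snd (a i)} \<inter> {X. fst (b i) \<bullet> X < snd (b i)})"
    by (auto simp: open_body_def lorentz_hom)
  then show "open open_body" by (auto intro!: open_INT open_Int open_halfspace_lt)
qed

text \<open>The midpoint of the chord from \<open>v\<close> to \<open>w\<close> works: the planes of
  the \<open>a i\<close> pass through \<open>v\<close> with \<open>w\<close> strictly inside, and
  those of the \<open>b i\<close> the other way round.\<close>

lemma interior_body: "interior body \<noteq> {}"
proof -
  have "hom ((1/2) *\<^sub>R (v + w)) = (1/2) *\<^sub>R (hom v + hom w)" by (simp add: hom_def)
  then have "(1/2) *\<^sub>R (v + w) \<in> open_body"
    using v_sign w_sign by (simp add: open_body_def add_neg_neg del: a_vw b_vw)
  then show ?thesis using open_body_subset by blast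
qed

lemma aff_dim_body: "aff_dim body = 3"
  using aff_dim_nonempty_interior[OF interior_body] by simp

lemma aff_dim_face: "aff_dim (face_a i) = 2" "aff_dim (face_b i) = 2"
proof -
  have lt: "aff_dim F \<le> 2" if "F face_of body" "F \<noteq> body" for F
    using face_of_aff_dim_lt[OF convex_body that] aff_dim_body by simp
  have "w \<notin> face_a i" "v \<notin> face_b i" "w \<in> body" "v \<in> body"
    using v_sign(2)[of i] w_sign(2)[of i]
    by (auto simp: face_a_eq face_b_eq lorentz_hom body_eq_hull hull_inc)
  then have le: "aff_dim (face_a i) \<le> 2" "aff_dim (face_b i) \<le> 2"
    using lt[OF face_a_face] lt[OF face_b_face] by auto
  have "aff_dim {v, P (i + 1), Q i} = 2"
  proof (rule aff_dim_triple_ge[of _ _ "fst (a (i + 1))" "snd (a (i + 1))"])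
    show "fst (a (i + 1)) \<bullet> v = snd (a (i + 1))" "fst (a (i + 1)) \<bullet> P (i + 1) = snd (a (i + 1))"
      "fst (a (i + 1)) \<bullet> Q i \<noteq> snd (a (i + 1))"
      using v_sign(1)[of "i + 1"] P_sign(2)[of "i + 1" "i + 1"] Q_sign(2)[of "i + 1" i]
      by (simp_all add: lorentz_hom)
  qed (rule vw_PQ)
  moreover have "aff_dim {v, P (i + 1), Q i} \<le> aff_dim (face_a i)"
    unfolding face_a_def by (intro aff_dim_subset) (auto intro: hull_inc)
  moreover have "aff_dim {w, Q (i - 1), P i} = 2"
  proof (rule aff_dim_triple_ge[of _ _ "fst (b (i - 1))" "snd (b (i - 1))"])
    show "fst (b (i - 1)) \<bullet> w = snd (b (i - 1))" "fst (b (i - 1)) \<bullet> Q (i - 1) = snd (b (i - 1))"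
      "fst (b (i - 1)) \<bullet> P i \<noteq> snd (b (i - 1))"
      using w_sign(1)[of "i - 1"] Q_sign(4)[of "i - 1" "i - 1"] P_sign(4)[of "i - 1" i]
      by (simp_all add: lorentz_hom)
  qed (rule vw_PQ)
  moreover have "aff_dim {w, Q (i - 1), P i} \<le> aff_dim (face_b i)"
    unfolding face_b_def by (intro aff_dim_subset) (auto intro: hull_inc)
  ultimately show "aff_dim (face_a i) = 2" "aff_dim (face_b i) = 2" using le by auto
qed

lemma facet_a: "face_a i facet_of body" and facet_b: "face_b i facet_of body"
  using face_a_face face_b_face aff_dim_face[of i] aff_dim_body
  by (auto simp: facet_of_def)

text \<open>A relative interior point of a facet is not interior to the body, hence lies on one of
  the eight planes. The face cut out there contains the whole facet and has the same
  dimension.\<close>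

lemma facets: "{F. F facet_of body} = (\<Union>i. {face_b i, face_a i})"
proof -
  have "\<exists>i. F = face_b i \<or> F = face_a i" if F: "F facet_of body" for F
  proof -
    have F': "F face_of body" "F \<noteq> {}" "aff_dim F = 2"
      using F aff_dim_body by (auto simp: facet_of_def)
    then have conv: "convex F" "F \<subseteq> body" "F \<noteq> body"
      using aff_dim_body by (auto simp: face_of_imp_convex face_of_imp_subset)
    obtain X where X: "X \<in> rel_interior F" using F' conv by (meson all_not_in_conv rel_interior_eq_empty)
    have "X \<notin> interior body" using face_of_disjoint_interior[OF F'(1) conv(3)] X rel_interior_subset by blast
    then have "X \<notin> open_body" using open_body_subset by blast
    moreover have "X \<in> body" using X rel_interior_subset conv by blast
    ultimately obtain i where "lorentz (a i) (hom X) = 0 \<or> lorentz (b i) (hom X) = 0"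
      unfolding open_body_def body_def by (auto simp: less_le)
    then obtain G where G: "G = face_a i \<or> G = face_b i" "X \<in> G"
      using \<open>X \<in> body\<close> by (auto simp: face_a_eq face_b_eq lorentz_hom)
    have G': "G face_of body" "aff_dim G = 2" using G face_a_face face_b_face aff_dim_face by auto
    have "F \<subseteq> G" using subset_of_face_of[OF G'(1) conv(2)] X G(2) by blast
    then have "F face_of G" using F'(1) G'(1) by (meson face_of_imp_subset face_of_subset)
    then have "F = G"
      using face_of_aff_dim_lt[of G F] G' F' by (metis face_of_imp_convex convex_body less_irrefl)
    then show ?thesis using G by auto
  qed
  then show ?thesis using facet_a facet_b by auto
qed

lemma extreme_points: "{X. X extreme_point_of body} = vertices"
proof
  show "{X. X extreme_point_of body} \<subseteq> vertices"
    unfolding body_eq_hull using extreme_point_of_convex_hull by blast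
  have v: "{v} face_of body" and w: "{w} face_of body"
    using face_of_Int[OF face_a_face[of 0] face_a_face[of "0 + 2"]]
      face_of_Int[OF face_b_face[of 0] face_b_face[of "0 + 2"]]
    unfolding face_a_Int face_b_Int by simp_all
  have P: "{P i} face_of body" for i
  proof -
    have "face_a (i - 1) \<inter> face_a i = convex hull {v, P i}" using face_a_Int(1)[of "i - 1"] by simp
    moreover have "{v, P i} \<inter> {w, Q (i - 1), P i, Q i} = {P i}" by (auto simp: vertex_eq)
    ultimately have "face_a (i - 1) \<inter> face_a i \<inter> face_b i = {P i}"
      using face_Int_hull(2)[of _ "{v, P i}" i] by simp
    then show ?thesis using face_of_Int[OF face_of_Int[OF face_a_face face_a_face] face_b_face] by metis
  qed
  have Q: "{Q i} face_of body" for i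
  proof -
    have "{w, Q i} \<inter> {v, P i, Q i, P (i + 1)} = {Q i}" by (auto simp: vertex_eq)
    then have "face_b i \<inter> face_b (i + 1) \<inter> face_a i = {Q i}"
      using face_Int_hull(1)[of _ "{w, Q i}" i] face_b_Int(1)[of i] by simp
    then show ?thesis using face_of_Int[OF face_of_Int[OF face_b_face face_b_face] face_a_face] by metis
  qed
  show "vertices \<subseteq> {X. X extreme_point_of body}"
    using v w P Q by (auto simp: vertices_def face_of_singleton)
qed

definition edges :: "(real^3) set set" where
  "edges = (\<Union>i. {closed_segment v (P i), closed_segment w (Q i), closed_segment (Q i) (P (i + 1))}) \<union>
    {closed_segment (P i) (Q i) | i. c $ i \<noteq> 1}"

lemma segment_edge:
  assumes "F face_of body" "G face_of body" "F \<inter> G = convex hull {X, Y}" "X \<noteq> Y"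
  shows "closed_segment X Y edge_of body"
  using face_of_Int[OF assms(1,2)] assms(3,4) by (simp add: edge_of_def segment_convex_hull aff_dim_convex_hull aff_dim_2)

lemma face_a_prev_Int: "face_a (i - 1) \<inter> face_a i = convex hull {v, P i}"
  using face_a_Int(1)[of "i - 1"] by simp

lemma edges_edge: "s \<in> edges \<Longrightarrow> s edge_of body"
proof -
  have "closed_segment v (P i) edge_of body" "closed_segment w (Q i) edge_of body"
    "closed_segment (Q i) (P (i + 1)) edge_of body" "c $ i \<noteq> 1 \<Longrightarrow> closed_segment (P i) (Q i) edge_of body" for i
    by (rule segment_edge[OF face_a_face face_a_face face_a_prev_Int] segment_edge[OF face_b_face face_b_face face_b_Int(1)]
        segment_edge[OF face_a_face face_b_face face_a_Int(4)] segment_edge[OF face_a_face face_b_face face_a_Int(3)],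
        simp add: vertex_eq)+
  then show "s \<in> edges \<Longrightarrow> s edge_of body" by (auto simp: edges_def)
qed

lemma facet_Int_cases:
  assumes "F facet_of body" "G facet_of body" "F \<noteq> G"
  shows "F \<inter> G \<in> edges \<or> (\<exists>X. F \<inter> G \<subseteq> {X})"
proof -
  have aa: "face_a i \<inter> face_a j \<in> edges \<or> (\<exists>X. face_a i \<inter> face_a j \<subseteq> {X})" if "face_a i \<noteq> face_a j" for i j
  proof (cases rule: index_cases[of j i])
    case 1 then show ?thesis using that by simp
  next
    case 2 then show ?thesis by (auto simp: face_a_Int edges_def segment_convex_hull)
  next
    case 3 then show ?thesis by (auto simp: face_a_Int)
  next
    case 4
    then have "face_a i \<inter> face_a j = convex hull {v, P i}" using face_a_prev_Int[of i] by (simp add: Int_commute)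
    then show ?thesis by (auto simp: edges_def segment_convex_hull)
  qed
  have bb: "face_b i \<inter> face_b j \<in> edges \<or> (\<exists>X. face_b i \<inter> face_b j \<subseteq> {X})" if "face_b i \<noteq> face_b j" for i j
  proof (cases rule: index_cases[of j i])
    case 1 then show ?thesis using that by simp
  next
    case 2 then show ?thesis by (auto simp: face_b_Int edges_def segment_convex_hull)
  next
    case 3 then show ?thesis by (auto simp: face_b_Int)
  next
    case 4
    then have "face_b i \<inter> face_b j = convex hull {w, Q j}" using face_b_Int(1)[of "i - 1"] by (simp add: Int_commute)
    then show ?thesis by (auto simp: edges_def segment_convex_hull)
  qed
  have ab: "face_a i \<inter> face_b j \<in> edges \<or> (\<exists>X. face_a i \<inter> face_b j \<subseteq> {X})" for i j
  proof (cases rule: index_cases[of j i])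
    case 1
    show ?thesis
    proof (cases "c $ i = 1")
      case True
      then have "face_a i \<inter> face_b j = {P i}" using 1 P_eq_Q[of i i] by (simp add: face_a_Int)
      then show ?thesis by auto
    next
      case False
      then show ?thesis using 1 by (auto simp: face_a_Int edges_def segment_convex_hull)
    qed
  next
    case 2 then show ?thesis by (auto simp: face_a_Int edges_def segment_convex_hull)
  next
    case 3 then show ?thesis using face_a_Int(5)[of i] by auto
  next
    case 4 then show ?thesis by (simp add: face_a_Int)
  qed
  have "F \<in> {F. F facet_of body}" "G \<in> {F. F facet_of body}" using assms by auto
  then obtain i j where "F = face_a i \<or> F = face_b i" "G = face_a j \<or> G = face_b j"
    unfolding facets by auto
  then show ?thesis using aa[of i j] bb[of i j] ab[of i j] ab[of j i] assms(3) by (auto simp: Int_commute)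
qed

text \<open>A proper face of a polyhedron is the intersection of the facets containing it, so an
  edge lies in two distinct facets. Their intersection is not contained in a point, hence is a
  listed edge, and equality follows by dimension.\<close>

lemma edge_edges: assumes e: "s edge_of body" shows "s \<in> edges"
proof -
  have e': "s face_of body" "aff_dim s = 1" using e by (auto simp: edge_of_def)
  then have ne: "s \<noteq> {}" "s \<noteq> body" using aff_dim_body by auto
  define FF where "FF = {F. F facet_of body \<and> s \<subseteq> F}"
  have eq: "s = \<Inter> FF"
    unfolding FF_def using face_of_polyhedron[OF polyhedron_body e'(1) ne] .
  obtain F where F: "F \<in> FF"
    using face_of_polyhedron_subset_facet[OF polyhedron_body e'(1) ne] by (auto simp: FF_def)
  have dimF: "aff_dim F = 2" using F aff_dim_body by (auto simp: FF_def facet_of_def)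
  have "FF \<noteq> {F}" using eq e'(2) dimF by auto
  then obtain G where G: "G \<in> FF" "F \<noteq> G" using F by blast
  have sub: "s \<subseteq> F \<inter> G" using F G by (auto simp: FF_def)
  have "\<not> F \<inter> G \<subseteq> {X}" for X
  proof
    assume "F \<inter> G \<subseteq> {X}"
    then have "aff_dim s \<le> aff_dim {X}" using sub by (intro aff_dim_subset) auto
    then show False using e' by simp
  qed
  then have FG: "F \<inter> G \<in> edges" using facet_Int_cases[of F G] F G by (auto simp: FF_def)
  then have E: "F \<inter> G face_of body" "aff_dim (F \<inter> G) = 1" using edges_edge by (auto simp: edge_of_def)
  have "s face_of F \<inter> G" using e'(1) sub E(1) by (meson face_of_imp_subset face_of_subset)
  then have "s = F \<inter> G"
    using face_of_aff_dim_lt[of "F \<inter> G" s] E e' by (metis face_of_imp_convex convex_body less_irrefl)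
  then show ?thesis using FG by simp
qed

lemma edges_eq: "{e. e edge_of body} = edges"
  using edge_edges edges_edge by blast

lemma normal_a: "outward_unit_normal body (face_a i) (a i)"
  and normal_b: "outward_unit_normal body (face_b i) (b i)"
  using body_le a_unit b_unit by (auto simp: outward_unit_normal_def face_a_eq face_b_eq)

lemma dihedralI:
  assumes "F facet_of body" "G facet_of body" "outward_unit_normal body F n" "outward_unit_normal body G m"
    "F \<inter> G = convex hull {X, Y}" "X \<noteq> Y" "cos \<theta> = - lorentz n m" "0 \<le> \<theta>" "\<theta> \<le> pi"
  shows "has_dihedral_angle body (closed_segment X Y) \<theta>"
proof -
  have faces: "F face_of body" "G face_of body" "aff_dim F = 2"
    using assms aff_dim_body by (auto simp: facet_of_def)
  have edge: "closed_segment X Y edge_of body" by (rule segment_edge[OF faces(1,2) assms(5,6)])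
  then have "aff_dim (F \<inter> G) = 1" using assms(5) by (simp add: edge_of_def segment_convex_hull)
  then have "F \<noteq> G" using faces by auto
  moreover have "closed_segment X Y = F \<inter> G" using assms(5) by (simp add: segment_convex_hull)
  ultimately show ?thesis unfolding has_dihedral_angle_def using edge assms by blast
qed

text \<open>Restricting to the open ball removes the ideal vertices; the closure restores them
  because the interior of the body lies in the open ball and is dense in the body.\<close>

lemma closure_body: "closure (body \<inter> hyp_space) = body" "interior (body \<inter> hyp_space) \<noteq> {}"
proof -
  have sub: "interior body \<subseteq> body \<inter> hyp_space"
    using interior_mono[OF body_ball] interior_subset[of body] by (auto simp: hyp_space_def)
  have "closure (interior body) = body"
    using convex_closure_interior[OF convex_body interior_body] compact_imp_closed[OF compact_body] by simp
  then show "closure (body \<inter> hyp_space) = body"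
    using closure_mono[OF sub] closure_mono[of "body \<inter> hyp_space" body] compact_imp_closed[OF compact_body] by auto
  show "interior (body \<inter> hyp_space) \<noteq> {}"
    using interior_body interior_maximal[OF sub open_interior] by auto
qed

lemma trapezohedron_body:
  assumes \<alpha>: "\<And>i. 0 \<le> \<alpha> $ i \<and> \<alpha> $ i < pi" "cos_vec \<alpha> = c"
    and volume: "hyp_volume (body \<inter> hyp_space) < \<infinity>"
  shows "trapezohedron (body \<inter> hyp_space) v w P Q \<alpha>"
proof -
  have cos: "cos (\<alpha> $ i) = c $ i" for i using \<alpha>(2) by (auto simp: cos_vec_def vec_eq_iff)
  have zero: "\<alpha> $ i = 0 \<longleftrightarrow> c $ i = 1" for i
    using \<alpha>(1)[of i] cos[of i] by (metis cos_zero cos_inj_pi less_imp_le order_refl pi_ge_zero)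
  have dih: "has_dihedral_angle body (closed_segment (P i) (Q i)) (\<alpha> $ i)" if "\<alpha> $ i \<noteq> 0" for i
    by (rule dihedralI[OF facet_a facet_b normal_a normal_b face_a_Int(3)])
      (use that \<alpha>(1)[of i] in \<open>simp_all add: vertex_eq zero cos a_b less_imp_le\<close>)
  have dih2: "has_dihedral_angle body (closed_segment v (P i)) (pi / 2)"
    "has_dihedral_angle body (closed_segment w (Q i)) (pi / 2)"
    "has_dihedral_angle body (closed_segment (Q i) (P (i + 1))) (pi / 2)" for i
  proof -
    show "has_dihedral_angle body (closed_segment v (P i)) (pi / 2)"
      by (rule dihedralI[OF facet_a facet_a normal_a normal_a face_a_prev_Int])
        (use a_next[of "i - 1"] in \<open>simp_all add: vertex_eq\<close>)
    show "has_dihedral_angle body (closed_segment w (Q i)) (pi / 2)"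
      by (rule dihedralI[OF facet_b facet_b normal_b normal_b face_b_Int(1)])
        (use b_next[of i] in \<open>simp_all add: vertex_eq\<close>)
    show "has_dihedral_angle body (closed_segment (Q i) (P (i + 1))) (pi / 2)"
      by (rule dihedralI[OF facet_a facet_b normal_a normal_b face_a_Int(4)])
        (use a_b_next[of i] in \<open>simp_all add: vertex_eq\<close>)
  qed
  have "finite_volume_polyhedron (body \<inter> hyp_space)"
    using polyhedron_body closure_body(2) volume by (auto simp: finite_volume_polyhedron_def)
  then show ?thesis
    unfolding trapezohedron_def closure_body(1) extreme_points edges_eq facets edges_def vertices_def
    using \<alpha>(1) dih dih2 v_neq_w vw_PQ inj_P inj_Q norm_v norm_w norm_P
    by (auto simp: face_a_def face_b_def vertex_eq zero)
qed

end

subsection \<open>Finite volume\<close>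

lemma inner_le_1: "norm u \<le> 1 \<Longrightarrow> norm v \<le> 1 \<Longrightarrow> u \<bullet> v \<le> 1" for u v :: "'a::real_inner"
  using norm_cauchy_schwarz[of u v] mult_le_one[of "norm u" "norm v"] by simp

text \<open>At an ideal vertex the hull meets the unit sphere like a cone, not tangentially.\<close>

lemma hull_depth_ge_distance:
  fixes V :: "'a::real_inner set"
  assumes V: "finite V" "V \<subseteq> cball 0 1"
  obtains C where "0 < C" "\<And>X. X \<in> convex hull V \<Longrightarrow> \<exists>v\<in>V. norm (X - v) \<le> C * (1 - X \<bullet> X)"
proof -
  have "\<exists>\<delta>>0. \<forall>v\<in>V. \<forall>w\<in>V. v \<noteq> w \<longrightarrow> \<delta> \<le> 1 - v \<bullet> w"
  proof -
    \<comment> \<open>The inserted 1 keeps the set nonempty when \<open>V\<close> has at most one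
      point.\<close>
    define D where "D = insert 1 ((\<lambda>(v, w). 1 - v \<bullet> w) ` {(v, w) \<in> V \<times> V. v \<noteq> w})"
    have fin: "finite D" unfolding D_def using V by (auto intro: finite_subset[of _ "V \<times> V"])
    have "0 < d" if "d \<in> D" for d
    proof -
      have "0 < 1 - v \<bullet> w" if vw: "v \<in> V" "w \<in> V" "v \<noteq> w" for v w
      proof -
        have "0 < (v - w) \<bullet> (v - w)" using vw by simp
        also have "(v - w) \<bullet> (v - w) = v \<bullet> v + w \<bullet> w - 2 * (v \<bullet> w)" by (simp add: algebra_simps inner_commute)
        also have "\<dots> \<le> 1 + 1 - 2 * (v \<bullet> w)"
          using V(2) vw by (intro diff_right_mono add_mono inner_le_1) auto
        finally show ?thesis by simp
      qed
      then show ?thesis using that by (auto simp: D_def)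
    qed
    then have "0 < Min D" using fin by (subst Min_gr_iff) (auto simp: D_def)
    moreover have "Min D \<le> 1 - v \<bullet> w" if "v \<in> V" "w \<in> V" "v \<noteq> w" for v w
      using that fin by (intro Min_le) (auto simp: D_def)
    ultimately show ?thesis by blast
  qed
  then obtain \<delta> where \<delta>: "0 < \<delta>" "\<And>v w. v \<in> V \<Longrightarrow> w \<in> V \<Longrightarrow> v \<noteq> w \<Longrightarrow> \<delta> \<le> 1 - v \<bullet> w" by blast
  \<comment> \<open>Since \<open>m\<close> exceeds the number of points, weights that are all at
    most \<open>1 / m\<close> have sum below 1; so some point carries weight at least
    \<open>1 / m\<close>.\<close>
  define m where "m = real (card V) + 1"
  have m: "0 < m" by (simp add: m_def)
  define C where "C = 2 * m / \<delta>"
  have "\<exists>v\<in>V. norm (X - v) \<le> C * (1 - X \<bullet> X)" if "X \<in> convex hull V" for X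
  proof -
    have "\<exists>l. (\<forall>v\<in>V. 0 \<le> l v) \<and> sum l V = 1 \<and> (\<Sum>v\<in>V. l v *\<^sub>R v) = X"
      using that unfolding convex_hull_finite[OF V(1)] by simp
    then obtain l where l: "\<And>v. v \<in> V \<Longrightarrow> 0 \<le> l v" "sum l V = 1" "X = (\<Sum>v\<in>V. l v *\<^sub>R v)"
      by metis
    have "\<exists>v\<in>V. 1 / m \<le> l v"
    proof (rule ccontr)
      assume "\<not> (\<exists>v\<in>V. 1 / m \<le> l v)"
      then have "sum l V \<le> (\<Sum>v\<in>V. 1 / m)" by (intro sum_mono) force
      also have "\<dots> < 1" using m by (simp add: m_def)
      finally show False using l by simp
    qed
    then obtain v where v: "v \<in> V" "1 / m \<le> l v" by blast
    \<comment> \<open>Distance and depth are both compared with the weight \<open>1 - l v\<close>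
      not carried by \<open>v\<close>. The distance to \<open>v\<close> is at most twice that
      weight. For \<open>w\<close> other than \<open>v\<close>, the weight at \<open>v\<close> gives
      \<open>1 - X \<bullet> w\<close> at least \<open>\<delta> / m\<close>, and averaging over
      \<open>w\<close> bounds the depth from below by \<open>\<delta> / m\<close> times that
      weight.\<close>
    have one: "1 - X \<bullet> w = (\<Sum>u\<in>V. l u * (1 - u \<bullet> w))" for w
      using l(2) by (simp add: l(3) inner_sum_left right_diff_distrib sum_subtractf)
    have rest: "sum l (V - {v}) = 1 - l v" using l(2) V(1) v by (simp add: sum_diff1)
    have nn: "0 \<le> 1 - u \<bullet> w" if "u \<in> V" "w \<in> V" for u w
      using inner_le_1[of u w] that V(2) by (auto simp: subset_eq)
    have depth: "\<delta> / m \<le> 1 - X \<bullet> w" if w: "w \<in> V - {v}" for w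
    proof -
      have "\<delta> / m = 1 / m * \<delta>" by simp
      also have "\<dots> \<le> l v * (1 - v \<bullet> w)" using v w \<delta> m l(1)[OF v(1)] by (intro mult_mono) auto
      also have "\<dots> \<le> (\<Sum>u\<in>V. l u * (1 - u \<bullet> w))"
        using V(1) v(1) w l(1) nn by (intro member_le_sum) auto
      finally show ?thesis by (simp add: one)
    qed
    have nnX: "0 \<le> 1 - X \<bullet> w" if "w \<in> V" for w
      unfolding one using l(1) nn that by (intro sum_nonneg) auto
    have "1 - X \<bullet> X = (\<Sum>w\<in>V. l w * (1 - X \<bullet> w))"
      using one[of X] by (simp add: inner_commute)
    also have "\<dots> \<ge> (\<Sum>w\<in>V - {v}. l w * (1 - X \<bullet> w))"
      using V(1) l(1) nnX by (intro sum_mono2) auto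
    also have "(\<Sum>w\<in>V - {v}. l w * (1 - X \<bullet> w)) \<ge> (\<Sum>w\<in>V - {v}. l w * (\<delta> / m))"
      using l(1) depth by (intro sum_mono mult_left_mono) auto
    also have "(\<Sum>w\<in>V - {v}. l w * (\<delta> / m)) = (1 - l v) * (\<delta> / m)"
      by (simp only: rest flip: sum_distrib_right)
    finally have "(1 - l v) * (\<delta> / m) \<le> 1 - X \<bullet> X" .
    then have "C * ((1 - l v) * (\<delta> / m)) \<le> C * (1 - X \<bullet> X)" using m \<delta> by (intro mult_left_mono) (auto simp: C_def)
    then have 1: "2 * (1 - l v) \<le> C * (1 - X \<bullet> X)" using m \<delta> by (simp add: C_def mult_ac)
    have "X - v = (\<Sum>w\<in>V. l w *\<^sub>R w) - sum l V *\<^sub>R v" using l by simp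
    also have "\<dots> = (\<Sum>w\<in>V. l w *\<^sub>R (w - v))" by (simp add: scaleR_diff_right sum_subtractf scaleR_left.sum)
    also have "\<dots> = (\<Sum>w\<in>V - {v}. l w *\<^sub>R (w - v))" using V(1) v(1) by (simp add: sum.remove)
    finally have "norm (X - v) \<le> (\<Sum>w\<in>V - {v}. norm (l w *\<^sub>R (w - v)))" by (simp only: norm_sum)
    also have "\<dots> \<le> (\<Sum>w\<in>V - {v}. l w * 2)"
    proof (rule sum_mono)
      fix w assume w: "w \<in> V - {v}"
      have "norm (w - v) \<le> norm w + norm v" by (rule norm_triangle_ineq4)
      also have "\<dots> \<le> 1 + 1" using w v(1) V(2) by (intro add_mono) auto
      finally show "norm (l w *\<^sub>R (w - v)) \<le> l w * 2" using l(1)[of w] w by (simp add: mult_left_mono)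
    qed
    also have "\<dots> = 2 * (1 - l v)" by (simp add: rest flip: sum_distrib_right)
    finally show ?thesis using 1 v(1) by force
  qed
  moreover have "0 < C" using m \<delta> by (simp add: C_def)
  ultimately show thesis using that by blast
qed

lemma dyadic_shell:
  fixes t :: real
  assumes "0 < t" "t \<le> 1"
  obtains n where "(1/2)^(n + 1) < t" "t \<le> (1/2)^n"
proof -
  define N where "N = (LEAST n. (1/2)^n < t)"
  obtain n0 where "(1/2)^n0 < t" using real_arch_pow_inv[of t "1/2"] assms by auto
  then have N: "(1/2)^N < t" unfolding N_def by (rule LeastI)
  have "N \<noteq> 0"
  proof
    assume "N = 0"
    then show False using N assms by simp
  qed
  then obtain n where n: "N = n + 1" by (metis Suc_eq_plus1 not0_implies_Suc)
  have "\<not> (1/2)^n < t"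
    using not_less_Least[of n "\<lambda>n. (1/2)^n < t"] n by (simp add: N_def)
  then show thesis using that[of n] N n by simp
qed

text \<open>In dyadic shells the density grows by a factor of 4 while the volume shrinks by a factor
  of 8.\<close>

lemma hyp_volume_hull_finite:
  assumes V: "finite V" "V \<subseteq> cball 0 1"
  shows "hyp_volume (convex hull V \<inter> hyp_space) < \<infinity>"
proof -
  obtain C where C: "0 < C" "\<And>X. X \<in> convex hull V \<Longrightarrow> \<exists>v\<in>V. norm (X - v) \<le> C * (1 - X \<bullet> X)"
    using hull_depth_ge_distance[OF V] by blast
  \<comment> \<open>Shell \<open>n\<close> consists of the \<open>X\<close> whose
    \<open>1 - (norm X)\<^sup>2\<close> lies between \<open>(1/2)^(n + 1)\<close> and
    \<open>(1/2)^n\<close>. There the density is below \<open>4^(n + 1)\<close>, and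
    \<open>hull_depth_ge_distance\<close> puts \<open>X\<close> into \<open>U n\<close>.\<close>
  define U where "U n = (\<Union>v\<in>V. cball v (C * (1/2)^n))" for n :: nat
  have U_sets: "U n \<in> sets lborel" for n unfolding U_def using V by auto
  define \<beta> where "\<beta> = real (card V) * unit_ball_vol 3 * C^3"
  have \<beta>: "0 \<le> \<beta>" using C by (simp add: \<beta>_def)
  have vol: "emeasure lborel (U n) \<le> ennreal (\<beta> * (1/8)^n)" for n
  proof -
    have "emeasure lborel (U n) \<le> (\<Sum>v\<in>V. emeasure lborel (cball v (C * (1/2)^n)))"
      unfolding U_def using V by (intro emeasure_subadditive_finite) auto
    also have "\<dots> = (\<Sum>v\<in>V. ennreal (unit_ball_vol 3 * (C * (1/2)^n)^3))"
      using C by (intro sum.cong refl) (simp add: emeasure_cball)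
    also have "\<dots> = ennreal (real (card V) * (unit_ball_vol 3 * (C * (1/2)^n)^3))"
      using C by (simp add: ennreal_mult' ennreal_of_nat_eq_real_of_nat)
    also have "((1/2)^n)^3 = (1/8::real)^n" by (simp add: power3_eq_cube flip: power_mult_distrib)
    then have "real (card V) * (unit_ball_vol 3 * (C * (1/2)^n)^3) = \<beta> * (1/8)^n"
      by (simp add: \<beta>_def power_mult_distrib)
    finally show ?thesis .
  qed
  have "hyp_volume (convex hull V \<inter> hyp_space) \<le> (\<integral>\<^sup>+ X. (\<Sum>n. ennreal (4^(n + 1)) * indicator (U n) X) \<partial>lborel)"
    unfolding hyp_volume_def
  proof (rule nn_integral_mono)
    fix X :: "real^3"
    show "ennreal (1 / (1 - (norm X)\<^sup>2)\<^sup>2) * indicator (convex hull V \<inter> hyp_space) X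
      \<le> (\<Sum>n. ennreal (4^(n + 1)) * indicator (U n) X)"
    proof (cases "X \<in> convex hull V \<inter> hyp_space")
      case True
      define t where "t = 1 - (norm X)\<^sup>2"
      have "(norm X)\<^sup>2 < 1" using True by (simp add: hyp_space_def abs_square_less_1)
      then have "0 < t" "t \<le> 1" by (simp_all add: t_def)
      then obtain n where n: "(1/2)^(n + 1) < t" "t \<le> (1/2)^n" by (rule dyadic_shell)
      obtain v where v: "v \<in> V" "norm (X - v) \<le> C * t"
        using C(2)[of X] True by (auto simp: t_def power2_norm_eq_inner)
      have "C * t \<le> C * (1/2)^n" using n C by (intro mult_left_mono) auto
      then have "dist v X \<le> C * (1/2)^n" using v(2) by (simp add: dist_norm norm_minus_commute)
      then have XU: "X \<in> U n" using v(1) by (auto simp: U_def)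
      have "((1/2)^(n + 1))\<^sup>2 \<le> t\<^sup>2" using n by (intro power_mono) auto
      then have "1 / t\<^sup>2 \<le> 1 / ((1/2)^(n + 1))\<^sup>2" using \<open>0 < t\<close> by (intro divide_left_mono) auto
      also have "((1/2)^(n + 1))\<^sup>2 = (1/4::real)^(n + 1)" by (simp add: power2_eq_square flip: power_mult_distrib)
      also have "1 / (1/4::real)^(n + 1) = 4^(n + 1)" by (simp add: power_one_over)
      finally have "ennreal (1 / t\<^sup>2) \<le> ennreal (4^(n + 1)) * indicator (U n) X" using XU by (simp add: ennreal_leI)
      also have "\<dots> = (\<Sum>k\<in>{n}. ennreal (4^(k + 1)) * indicator (U k) X)"
        by (simp only: sum.insert sum.empty finite.emptyI empty_iff not_False_eq_True add_0_right)
      also have "\<dots> \<le> (\<Sum>k. ennreal (4^(k + 1)) * indicator (U k) X)" by (intro sum_le_suminf) auto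
      finally show ?thesis using True by (simp add: t_def)
    qed simp
  qed
  also have "\<dots> = (\<Sum>n. \<integral>\<^sup>+ X. ennreal (4^(n + 1)) * indicator (U n) X \<partial>lborel)"
    using U_sets by (intro nn_integral_suminf) auto
  also have "\<dots> = (\<Sum>n. ennreal (4^(n + 1)) * emeasure lborel (U n))"
    using U_sets by (simp add: nn_integral_cmult_indicator)
  also have "\<dots> \<le> (\<Sum>n. ennreal (4 * \<beta> * (1/2)^n))"
  proof (intro suminf_le summableI)
    fix n
    have "ennreal (4^(n + 1)) * emeasure lborel (U n) \<le> ennreal (4^(n + 1)) * ennreal (\<beta> * (1/8)^n)"
      using vol by (intro mult_left_mono) auto
    also have "\<dots> = ennreal (4^(n + 1) * (\<beta> * (1/8)^n))" using \<beta> by (simp add: ennreal_mult')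
    also have "4^(n + 1) * (\<beta> * (1/8)^n) = 4 * \<beta> * (1/2)^n"
    proof -
      have "4^n * (1/8)^n = (1/2::real)^n" by (simp flip: power_mult_distrib)
      then show ?thesis by (simp add: mult_ac)
    qed
    finally show "ennreal (4^(n + 1)) * emeasure lborel (U n) \<le> ennreal (4 * \<beta> * (1/2)^n)" .
  qed
  also have "\<dots> < \<infinity>"
  proof -
    have "summable (\<lambda>n. 4 * \<beta> * (1/2)^n)" by (intro summable_mult summable_geometric) simp
    then have "(\<Sum>n. ennreal (4 * \<beta> * (1/2)^n)) \<noteq> top"
      by (rule ennreal_suminf_neq_top) (simp add: \<beta>)
    then show ?thesis by (simp add: less_top)
  qed
  finally show ?thesis .
qed

subsection \<open>The configuration of a trapezohedron\<close>

text \<open>Scale one normal so that both agree at a point of \<open>T\<close> off the facet. The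
  difference then vanishes on an affinely spanning set, so the normals are positive multiples of
  each other, and both have unit length.\<close>

lemma outward_unit_normal_unique:
  assumes T: "aff_dim T = 3" and F: "F facet_of T"
    and n: "outward_unit_normal T F n" and m: "outward_unit_normal T F m"
  shows "n = m"
proof -
  have dimF: "aff_dim F = 2" and "F \<noteq> {}" using F T by (auto simp: facet_of_def)
  have Fn: "F = T \<inter> {x. fst n \<bullet> x = snd n}" and Fm: "F = T \<inter> {x. fst m \<bullet> x = snd m}"
    using n m by (auto simp: outward_unit_normal_def)
  have "F \<noteq> T" using dimF T by auto
  then obtain z where z: "z \<in> T" "z \<notin> F" using Fn by blast
  have neg: "lorentz n (hom z) < 0" "lorentz m (hom z) < 0"
    using z n m Fn Fm by (auto simp: outward_unit_normal_def lorentz_hom less_le)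
  define r where "r = lorentz m (hom z) / lorentz n (hom z)"
  have r: "0 < r" "r * lorentz n (hom z) = lorentz m (hom z)" using neg by (simp_all add: r_def divide_neg_neg)
  define d where "d = r *\<^sub>R n - m"
  have "F \<subseteq> {x. fst n \<bullet> x = snd n}" using Fn by auto
  then have "affine hull F \<subseteq> {x. fst n \<bullet> x = snd n}" by (intro hull_minimal affine_hyperplane)
  then have "z \<notin> affine hull F" using neg by (auto simp: lorentz_hom)
  then have "aff_dim (insert z F) = 3" using dimF by (simp add: aff_dim_insert)
  then have "affine hull (insert z F) = UNIV" using aff_dim_eq_full[of "insert z F"] by simp
  moreover have "affine hull (insert z F) \<subseteq> {x. fst d \<bullet> x = snd d}"
  proof (intro hull_minimal affine_hyperplane)
    have "lorentz d (hom X) = 0" if "X \<in> insert z F" for X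
    proof (cases "X = z")
      case True then show ?thesis using r by (simp add: d_def)
    next
      case False
      then have "lorentz n (hom X) = 0" "lorentz m (hom X) = 0"
        using that Fn Fm by (auto simp: lorentz_hom)
      then show ?thesis by (simp add: d_def)
    qed
    then show "insert z F \<subseteq> {x. fst d \<bullet> x = snd d}" by (auto simp: lorentz_hom)
  qed
  ultimately have all: "fst d \<bullet> x = snd d" for x by auto
  have "snd d = 0" using all[of 0] by simp
  then have "fst d \<bullet> fst d = 0" using all[of "fst d"] by simp
  then have "d = 0" using \<open>snd d = 0\<close> by (simp add: prod_eq_iff)
  then have m_eq: "m = r *\<^sub>R n" by (simp add: d_def)
  have "lorentz n n = 1" "lorentz m m = 1" using n m by (auto simp: outward_unit_normal_def)
  then have "r * r = 1" unfolding m_eq by simp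
  then have "r = 1" using r(1) by (simp add: square_eq_1_iff)
  then show ?thesis using m_eq by simp
qed

text \<open>An arbitrary trapezohedron. The sublocale declaration below turns its facet normals into
  an instance of \<open>trapezohedral_normals\<close>, so that \<open>x\<close> and the gaps become
  available for it.\<close>

locale realization =
  fixes K vp vm P Q \<alpha>
  assumes trap: "trapezohedron K vp vm P Q \<alpha>"
begin

lemma trapD: "finite_volume_polyhedron K" "vp \<noteq> vm" "{vp, vm} \<inter> (range P \<union> range Q) = {}" "inj P" "inj Q"
  "\<forall>i j. P i = Q j \<longleftrightarrow> i = j \<and> \<alpha> $ i = 0" "norm vp = 1" "norm vm = 1"
  "\<forall>i. \<alpha> $ i = 0 \<longrightarrow> norm (P i) = 1" "\<forall>i. 0 \<le> \<alpha> $ i \<and> \<alpha> $ i < pi"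
  using trap unfolding trapezohedron_def by - (elim conjE, assumption)+

abbreviation "T \<equiv> closure K"

definition A :: "4 \<Rightarrow> (real^3) set" where "A i = convex hull {vp, P i, Q i, P (i + 1)}"
definition B :: "4 \<Rightarrow> (real^3) set" where "B i = convex hull {vm, Q (i - 1), P i, Q i}"
definition verts :: "(real^3) set" where "verts = {vp, vm} \<union> range P \<union> range Q"

lemma extreme: "{X. X extreme_point_of T} = verts"
  using trap by (simp add: trapezohedron_def verts_def)

lemma labels: "vp \<noteq> vm" "vm \<noteq> vp" "vp \<noteq> P i" "vp \<noteq> Q i" "vm \<noteq> P i" "vm \<noteq> Q i"
  "P i \<noteq> vp" "Q i \<noteq> vp" "P i \<noteq> vm" "Q i \<noteq> vm"
  "P i = P j \<longleftrightarrow> i = j" "Q i = Q j \<longleftrightarrow> i = j"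
  using trapD(2,3) inj_eq[OF trapD(4)] inj_eq[OF trapD(5)] by auto

lemma P_Q: "P i = Q j \<longleftrightarrow> i = j \<and> \<alpha> $ i = 0" "Q j = P i \<longleftrightarrow> i = j \<and> \<alpha> $ i = 0"
  using trapD(6) by metis+

lemma norms: "norm vp = 1" "norm vm = 1" "\<alpha> $ i = 0 \<Longrightarrow> norm (P i) = 1"
  and angles: "0 \<le> \<alpha> $ i" "\<alpha> $ i < pi"
  using trapD(7-10) by auto

lemma facets: "{F. F facet_of T} = (\<Union>i. {B i, A i})"
  using trap by (simp add: trapezohedron_def A_def B_def)

lemma T: "convex T" "T \<subseteq> cball 0 1" "compact T" "aff_dim T = 3"
proof -
  have "\<exists>S. polyhedron S \<and> K = S \<inter> hyp_space" and int: "interior K \<noteq> {}"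
    using trapD(1) unfolding finite_volume_polyhedron_def by blast+
  then obtain S where S: "polyhedron S" "K = S \<inter> hyp_space" by blast
  have "convex K" unfolding S by (intro convex_Int[OF polyhedron_imp_convex[OF S(1)]]) (simp add: hyp_space_def)
  then show "convex T" by (rule convex_closure)
  have "K \<subseteq> cball 0 1" unfolding S by (auto simp: hyp_space_def)
  then show "T \<subseteq> cball 0 1" by (simp add: closure_minimal)
  then show "compact T" using bounded_subset[OF bounded_cball] by (auto simp: compact_eq_bounded_closed)
  have "interior T \<noteq> {}" using int interior_mono[OF closure_subset[of K]] by auto
  then show "aff_dim T = 3" using aff_dim_nonempty_interior by fastforce
qed

lemma hull_subset_T: "S \<subseteq> verts \<Longrightarrow> convex hull S \<subseteq> T"
  using extreme T(1) by (intro hull_minimal) (auto simp: extreme_point_of_def)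

text \<open>An extreme point of \<open>T\<close> stays extreme in any smaller convex set containing
  it, and extreme points of a hull are generators. Incidence of vertices and faces thus becomes a
  question about labels.\<close>

lemma in_hull: "X \<in> verts \<Longrightarrow> S \<subseteq> verts \<Longrightarrow> X \<in> convex hull S \<longleftrightarrow> X \<in> S"
proof
  assume X: "X \<in> verts" and S: "S \<subseteq> verts" and hull: "X \<in> convex hull S"
  have "X extreme_point_of T" using X extreme by blast
  then have "X extreme_point_of (convex hull S)"
    using hull hull_subset_T[OF S] by (auto simp: extreme_point_of_def)
  then show "X \<in> S" by (rule extreme_point_of_convex_hull)
qed (rule hull_inc)

lemma verts_mem [simp]: "vp \<in> verts" "vm \<in> verts" "P i \<in> verts" "Q i \<in> verts"
  by (auto simp: verts_def)

lemma in_A: "X \<in> verts \<Longrightarrow> X \<in> A j \<longleftrightarrow> X = vp \<or> X = P j \<or> X = Q j \<or> X = P (j + 1)"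
  and in_B: "X \<in> verts \<Longrightarrow> X \<in> B j \<longleftrightarrow> X = vm \<or> X = Q (j - 1) \<or> X = P j \<or> X = Q j"
  by (simp_all add: A_def B_def in_hull)

lemma verts_T: "X \<in> verts \<Longrightarrow> X \<in> T"
  using extreme by (auto simp: extreme_point_of_def)

lemma verts_norm: "X \<in> verts \<Longrightarrow> norm X \<le> 1"
  using verts_T T(2) by (auto simp: subset_eq)

text \<open>\<open>has_dihedral_angle\<close> only asserts that some pair of facets has the angle.
  As \<open>F\<close> and \<open>G\<close> are the only candidates containing both endpoints, the
  pair is these two, up to order.\<close>

lemma edge_normals:
  assumes dih: "has_dihedral_angle T (closed_segment X Y) \<theta>"
    and A: "\<And>j. X \<in> A j \<Longrightarrow> Y \<in> A j \<Longrightarrow> A j = F \<or> A j = G"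
    and B: "\<And>j. X \<in> B j \<Longrightarrow> Y \<in> B j \<Longrightarrow> B j = F \<or> B j = G"
  obtains n m where "outward_unit_normal T F n" "outward_unit_normal T G m" "cos \<theta> = - lorentz n m"
proof -
  obtain F' G' n m where FG: "F' facet_of T" "G' facet_of T" "F' \<noteq> G'" "closed_segment X Y = F' \<inter> G'"
    "outward_unit_normal T F' n" "outward_unit_normal T G' m" "cos \<theta> = - lorentz n m"
    using dih unfolding has_dihedral_angle_def by blast
  have XY: "X \<in> F' \<inter> G'" "Y \<in> F' \<inter> G'" using FG(4)[symmetric] by auto
  have "H = F \<or> H = G" if "H facet_of T" "X \<in> H" "Y \<in> H" for H
  proof -
    have "H \<in> {F. F facet_of T}" using that by simp
    then show ?thesis using A B that unfolding facets by auto
  qed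
  then have "F' = F \<and> G' = G \<or> F' = G \<and> G' = F" using FG(1-3) XY by blast
  then show thesis using that[of n m] that[of m n] FG(5-7) by (auto simp: lorentz_commute)
qed

lemma dih_a:
  obtains n m where "outward_unit_normal T (A (i - 1)) n" "outward_unit_normal T (A i) m" "lorentz n m = 0"
proof -
  have "has_dihedral_angle T (closed_segment vp (P i)) (pi / 2)" using trap by (simp add: trapezohedron_def)
  then obtain n m where "outward_unit_normal T (A (i - 1)) n" "outward_unit_normal T (A i) m" "cos (pi / 2) = - lorentz n m"
    by (rule edge_normals[of vp "P i" _ "A (i - 1)" "A i"]) (auto simp: in_A in_B labels P_Q)
  then show thesis using that[of n m] by simp
qed

lemma dih_b:
  obtains n m where "outward_unit_normal T (B i) n" "outward_unit_normal T (B (i + 1)) m" "lorentz n m = 0"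
proof -
  have "has_dihedral_angle T (closed_segment vm (Q i)) (pi / 2)" using trap by (simp add: trapezohedron_def)
  then obtain n m where "outward_unit_normal T (B i) n" "outward_unit_normal T (B (i + 1)) m" "cos (pi / 2) = - lorentz n m"
    by (rule edge_normals[of vm "Q i" _ "B i" "B (i + 1)"]) (auto simp: in_A in_B labels P_Q)
  then show thesis using that[of n m] by simp
qed

lemma dih_ab_next:
  obtains n m where "outward_unit_normal T (A i) n" "outward_unit_normal T (B (i + 1)) m" "lorentz n m = 0"
proof -
  have "has_dihedral_angle T (closed_segment (Q i) (P (i + 1))) (pi / 2)" using trap by (simp add: trapezohedron_def)
  then obtain n m where "outward_unit_normal T (A i) n" "outward_unit_normal T (B (i + 1)) m" "cos (pi / 2) = - lorentz n m"
    by (rule edge_normals[of "Q i" "P (i + 1)" _ "A i" "B (i + 1)"]) (auto simp: in_A in_B labels P_Q)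
  then show thesis using that[of n m] by simp
qed

lemma dih_ab:
  assumes "\<alpha> $ i \<noteq> 0"
  obtains n m where "outward_unit_normal T (A i) n" "outward_unit_normal T (B i) m" "lorentz n m = - cos (\<alpha> $ i)"
proof -
  have "has_dihedral_angle T (closed_segment (P i) (Q i)) (\<alpha> $ i)" using trap assms by (simp add: trapezohedron_def)
  then obtain n m where "outward_unit_normal T (A i) n" "outward_unit_normal T (B i) m" "cos (\<alpha> $ i) = - lorentz n m"
    by (rule edge_normals[of "P i" "Q i" _ "A i" "B i"]) (use assms in \<open>auto simp: in_A in_B labels P_Q\<close>)
  then show thesis using that[of n m] by simp
qed

definition a :: "4 \<Rightarrow> (real^3) \<times> real" where "a i = (SOME n. outward_unit_normal T (A i) n)"
definition b :: "4 \<Rightarrow> (real^3) \<times> real" where "b i = (SOME n. outward_unit_normal T (B i) n)"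

lemma normal_a: "outward_unit_normal T (A i) (a i)" and normal_b: "outward_unit_normal T (B i) (b i)"
proof -
  obtain n where "outward_unit_normal T (A i) n" by (rule dih_a)
  then show "outward_unit_normal T (A i) (a i)" unfolding a_def by (rule someI)
  obtain n where "outward_unit_normal T (B i) n" by (rule dih_b)
  then show "outward_unit_normal T (B i) (b i)" unfolding b_def by (rule someI)
qed

lemma normal_a_unique: "outward_unit_normal T (A i) n \<Longrightarrow> n = a i"
  and normal_b_unique: "outward_unit_normal T (B i) n \<Longrightarrow> n = b i"
proof -
  have "A i facet_of T" "B i facet_of T" using facets by auto
  then show "outward_unit_normal T (A i) n \<Longrightarrow> n = a i" "outward_unit_normal T (B i) n \<Longrightarrow> n = b i"
    using outward_unit_normal_unique[OF T(4)] normal_a normal_b by blast+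
qed

lemma ab_unit: "lorentz (a i) (a i) = 1" "lorentz (b i) (b i) = 1"
  using normal_a[of i] normal_b[of i] by (auto simp: outward_unit_normal_def)

lemma a_next: "lorentz (a i) (a (i + 1)) = 0"
proof -
  obtain n m where nm: "outward_unit_normal T (A (i + 1 - 1)) n" "outward_unit_normal T (A (i + 1)) m" "lorentz n m = 0"
    by (rule dih_a)
  then have "n = a i" "m = a (i + 1)" using normal_a_unique by simp_all
  then show ?thesis using nm(3) by simp
qed

lemma b_next: "lorentz (b i) (b (i + 1)) = 0"
  using dih_b[of i] normal_b_unique by metis

lemma a_b_next: "lorentz (a i) (b (i + 1)) = 0"
  using dih_ab_next[of i] normal_a_unique normal_b_unique by metis

lemma A_zero: "X \<in> verts \<Longrightarrow> X \<in> A i \<Longrightarrow> lorentz (a i) (hom X) = 0"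
  and B_zero: "X \<in> verts \<Longrightarrow> X \<in> B i \<Longrightarrow> lorentz (b i) (hom X) = 0"
  and A_neg: "X \<in> verts \<Longrightarrow> X \<notin> A i \<Longrightarrow> lorentz (a i) (hom X) < 0"
  and B_neg: "X \<in> verts \<Longrightarrow> X \<notin> B i \<Longrightarrow> lorentz (b i) (hom X) < 0"
  using normal_a[of i] normal_b[of i] verts_T[of X]
  by (auto simp: outward_unit_normal_def lorentz_hom less_le)

text \<open>Modulo the null vector, \<open>n\<close> and \<open>l\<close> agree up to sign; the same sign would put \<open>X\<close> or \<open>Y\<close> outside
  one of the two half-spaces.\<close>

lemma opposite_normals:
  assumes Z: "Z \<in> verts" "norm Z = 1"
    and n: "lorentz n (hom Z) = 0" "lorentz m (hom Z) = 0" "lorentz l (hom Z) = 0"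
      "lorentz n n = 1" "lorentz m m = 1" "lorentz l l = 1" "lorentz n m = 0" "lorentz l m = 0"
    and X: "X \<in> verts" "lorentz n (hom X) = 0" "lorentz l (hom X) < 0"
    and Y: "Y \<in> verts" "lorentz l (hom Y) = 0" "lorentz n (hom Y) < 0"
  shows "\<exists>r. n + l = r *\<^sub>R hom Z"
proof (rule null_orthogonal_opposite[of Z n m l])
  fix r assume l: "l = n + r *\<^sub>R hom Z"
  have "X \<noteq> Z" "Y \<noteq> Z" using X Y n by auto
  then have neg: "lorentz (hom Z) (hom X) < 0" "lorentz (hom Z) (hom Y) < 0"
    using Z X Y verts_norm by (auto intro: lorentz_light_neg)
  have "0 < r" using X(2,3) neg(1) unfolding l by (simp add: mult_less_0_iff)
  moreover have "lorentz n (hom Y) = - r * lorentz (hom Z) (hom Y)" using Y(2) unfolding l by simp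
  then have "r < 0" using Y(3) neg(2) by (simp add: zero_less_mult_iff)
  ultimately show ?thesis by simp
next
  fix r assume "l = - n + r *\<^sub>R hom Z"
  then show ?thesis by auto
qed (use Z n in auto)

lemma a_zero: "lorentz (a i) (hom vp) = 0" "lorentz (a i) (hom (P i)) = 0" "lorentz (a i) (hom (Q i)) = 0"
  "lorentz (a i) (hom (P (i + 1))) = 0"
  and b_zero: "lorentz (b i) (hom vm) = 0" "lorentz (b i) (hom (P i)) = 0" "lorentz (b i) (hom (Q i)) = 0"
  "lorentz (b (i + 1)) (hom (Q i)) = 0"
  by (auto intro!: A_zero B_zero simp: in_A in_B)

lemma a_neg: "lorentz (a i) (hom vm) < 0" "lorentz (a (i + 2)) (hom (P i)) < 0" "lorentz (a i) (hom (P (i + 2))) < 0"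
  "lorentz (a (i + 1)) (hom (Q i)) < 0"
  and b_neg: "lorentz (b i) (hom vp) < 0" "lorentz (b (i + 2)) (hom (Q i)) < 0" "lorentz (b i) (hom (Q (i + 2))) < 0"
proof -
  have [simp]: "i + 2 + 1 \<noteq> i" "i \<noteq> i + 2 + 1" "i + 2 - 1 = i + 1" "i + 2 \<noteq> i - 1" by (simp_all add: algebra_simps)
  show "lorentz (a i) (hom vm) < 0" "lorentz (a (i + 2)) (hom (P i)) < 0" "lorentz (a i) (hom (P (i + 2))) < 0"
    "lorentz (a (i + 1)) (hom (Q i)) < 0"
    "lorentz (b i) (hom vp) < 0" "lorentz (b (i + 2)) (hom (Q i)) < 0" "lorentz (b i) (hom (Q (i + 2))) < 0"
    by (auto intro!: A_neg B_neg simp: in_A in_B labels P_Q)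
qed

lemma a_opp: "\<exists>r. a i + a (i + 2) = r *\<^sub>R hom vp"
  by (rule opposite_normals[of vp _ "a (i + 1)" _ "P i" "P (i + 2)"])
    (use a_next[of i] a_next[of "i + 1"] in \<open>simp_all add: norms a_zero a_neg ab_unit lorentz_commute[of "a (i + 2)" "a (i + 1)"] add.assoc\<close>)

lemma b_opp: "\<exists>r. b i + b (i + 2) = r *\<^sub>R hom vm"
  by (rule opposite_normals[of vm _ "b (i + 1)" _ "Q i" "Q (i + 2)"])
    (use b_next[of i] b_next[of "i + 1"] in \<open>simp_all add: norms b_zero b_neg ab_unit lorentz_commute[of "b (i + 2)" "b (i + 1)"] add.assoc\<close>)

text \<open>For angle 0 both planes pass through the ideal vertex \<open>P i\<close> and are
  orthogonal to \<open>a (i - 1)\<close>, so they are tangent there by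
  \<open>opposite_normals\<close>. Their product is -1, the value that \<open>- cos 0\<close>
  demands.\<close>

lemma a_b: "lorentz (a i) (b i) = - cos (\<alpha> $ i)"
proof (cases "\<alpha> $ i = 0")
  case False
  then show ?thesis using dih_ab[of i] normal_a_unique normal_b_unique by metis
next
  case True
  have "\<exists>r. a i + b i = r *\<^sub>R hom (P i)"
    by (rule opposite_normals[of "P i" _ "a (i - 1)" _ vp vm])
      (use True a_next[of "i - 1"] a_b_next[of "i - 1"] a_zero(4)[of "i - 1"]
        in \<open>simp_all add: norms a_zero b_zero a_neg b_neg ab_unit lorentz_commute[of "a i" "a (i - 1)"] lorentz_commute[of "b i" "a (i - 1)"]\<close>)
  then obtain r where "b i = r *\<^sub>R hom (P i) - a i" by (metis add_diff_cancel_left')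
  then have "lorentz (a i) (b i) = -1" using a_zero(2)[of i] ab_unit(1)[of i] by simp
  then show ?thesis using True by simp
qed

sublocale trapezohedral_normals a b vp vm "cos_vec \<alpha>"
proof
  have "-1 < cos (\<alpha> $ i)" for i
    using angles[of i] cos_monotone_0_pi[of "\<alpha> $ i" pi] by simp
  then show "cos_vec \<alpha> \<in> cos_box" by (simp add: cos_box_def cos_vec_def)
qed (use norms ab_unit a_next b_next a_b_next a_zero(1) b_zero(1) a_neg(1) b_neg(1) a_opp b_opp a_b
    in \<open>simp_all add: cos_vec_def\<close>)

end

subsection \<open>Existence\<close>

lemma lorentz_vector:
  "lorentz (vector [r, s, t], h) (vector [r', s', t'], h') = r * r' + s * s' + t * t' - h * h'"
  by (simp add: lorentz_def inner_vec_def sum_3)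

definition quarter_cos :: "4 \<Rightarrow> real" where "quarter_cos i = (if i = 0 then 1 else if i = 2 then -1 else 0)"
definition quarter_sin :: "4 \<Rightarrow> real" where "quarter_sin i = (if i = 1 then 1 else if i = 3 then -1 else 0)"

lemma quarter_next: "quarter_cos (i + 1) = - quarter_sin i" "quarter_sin (i + 1) = quarter_cos i"
  using exhaust_4[of i] by (auto simp: quarter_cos_def quarter_sin_def)

lemma quarter_opp: "quarter_cos (i + 2) = - quarter_cos i" "quarter_sin (i + 2) = - quarter_sin i"
  using exhaust_4[of i] by (auto simp: quarter_cos_def quarter_sin_def)

lemma quarter_sq: "quarter_cos i * quarter_cos i + quarter_sin i * quarter_sin i = 1"
  using exhaust_4[of i] by (auto simp: quarter_cos_def quarter_sin_def)

text \<open>In the upper half-space model with \<open>v\<close> at infinity and \<open>w\<close> at the origin, the faces at \<open>v\<close>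
  form a rectangle turned by the angle with cosine \<open>x\<close> against the axes carrying the centers of the
  hemispheres at \<open>w\<close>; here both ends are moved to the poles of the unit sphere.\<close>

lemma trapezohedral_polytope_exists:
  assumes c: "c \<in> cos_box" and x: "angle_root c x" and gap: "\<And>i. 0 < edge_gap c x i"
  obtains a b v w where "trapezohedral_polytope a b v w c"
proof -
  have cx: "0 < c $ i + x" for i using x by (rule angle_rootD)
  have "-1 < x" "x < 1" using angle_root_gt[OF c x] angle_rootD(2)[OF x] by auto
  then have x2: "x\<^sup>2 < 1" by (simp add: abs_square_less_1)
  define y where "y = sqrt (1 - x\<^sup>2)"
  have y: "0 < y" "y\<^sup>2 = 1 - x\<^sup>2" using x2 by (simp_all add: y_def)
  \<comment> \<open>Solution of the recursion \<open>nu (i + 1) * (c $ i + x) = nu i * y\<close>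
    started at 1. It closes up around the cycle precisely because \<open>x\<close> satisfies the
    root equation, which is used for \<open>i = 3\<close>.\<close>
  define nu where "nu i = (if i = 0 then 1 else if i = 1 then y / (c $ 0 + x)
    else if i = 2 then y\<^sup>2 / ((c $ 0 + x) * (c $ 1 + x))
    else y^3 / ((c $ 0 + x) * (c $ 1 + x) * (c $ 2 + x)))" for i :: 4
  have nu_pos: "0 < nu i" for i using y(1) cx by (simp add: nu_def)
  have nu_next: "nu (i + 1) * (c $ i + x) = nu i * y" for i
  proof -
    have "(c $ 0 + x) * (c $ 1 + x) * (c $ 2 + x) * (c $ 3 + x) = (1 - x\<^sup>2)\<^sup>2"
      using angle_rootD(3)[OF x] prod_4_shift[of "\<lambda>i. c $ i + x" 0] by simp
    also have "\<dots> = y^4" by (simp add: y(2)[symmetric])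
    finally have pr: "(c $ 0 + x) * (c $ 1 + x) * (c $ 2 + x) * (c $ 3 + x) = y^4" .
    have ne: "c $ 0 + x \<noteq> 0" "c $ 1 + x \<noteq> 0" "c $ 2 + x \<noteq> 0" using cx by (metis less_irrefl)+
    have "i = 0 \<or> i = 1 \<or> i = 2 \<or> i = 3" using exhaust_4[of i] four_eq_0 by metis
    then show ?thesis
    proof (elim disjE)
      assume "i = 3"
      then show ?thesis using ne pr by (simp add: nu_def divide_simps power4_eq_xxxx power3_eq_cube mult_ac)
    qed (use ne in \<open>simp_all add: nu_def divide_simps power2_eq_square power3_eq_cube\<close>)
  qed
  \<comment> \<open>The factor 2 is the value of \<open>k\<close> for antipodal poles of the unit
    sphere.\<close>
  define mu where "mu i = y / (2 * nu (i + 1))" for i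
  have mu_pos: "0 < mu i" for i using y nu_pos by (simp add: mu_def)
  have mu_nu: "2 * mu i * nu (i + 1) = y" "2 * mu i * nu i = c $ i + x" for i
  proof -
    have "nu (i + 1) \<noteq> 0" using nu_pos[of "i + 1"] by simp
    then show "2 * mu i * nu (i + 1) = y" "2 * mu i * nu i = c $ i + x"
      using nu_next[of i] by (simp_all add: mu_def field_simps)
  qed
  define a where "a i = (vector [x * quarter_cos i - y * quarter_sin i, x * quarter_sin i + y * quarter_cos i, mu i]
    :: real^3, mu i)" for i
  define b where "b i = (vector [quarter_cos i, quarter_sin i, - nu i] :: real^3, nu i)" for i
  define v w :: "real^3" where "v = vector [0, 0, 1]" and "w = vector [0, 0, -1]"
  have ring: "(x * C - y * S) * (x * C - y * S) + (x * S + y * C) * (x * S + y * C) = (x\<^sup>2 + y\<^sup>2) * (C * C + S * S)"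
    "(x * C - y * S) * (x * - S - y * C) + (x * S + y * C) * (x * C + y * - S) = 0"
    "(x * C - y * S) * C + (x * S + y * C) * S = x * (C * C + S * S)"
    "(x * C - y * S) * - S + (x * S + y * C) * C = y * (C * C + S * S)" for C S
    by (simp_all add: algebra_simps power2_eq_square)
  have normals: "trapezohedral_normals a b v w c"
  proof
    fix i
    show "lorentz (a i) (a i) = 1" by (simp add: a_def lorentz_vector ring quarter_sq y)
    show "lorentz (a i) (a (i + 1)) = 0" by (simp only: a_def lorentz_vector quarter_next ring)
    show "lorentz (b i) (b i) = 1" by (simp add: b_def lorentz_vector quarter_sq)
    show "lorentz (b i) (b (i + 1)) = 0" by (simp add: b_def lorentz_vector quarter_next)
    have "lorentz (a i) (b i) = x - 2 * mu i * nu i"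
      by (simp only: a_def b_def lorentz_vector ring quarter_sq)
    then show "lorentz (a i) (b i) = - c $ i" by (simp add: mu_nu)
    have "lorentz (a i) (b (i + 1)) = y - 2 * mu i * nu (i + 1)"
      by (simp only: a_def b_def lorentz_vector quarter_next ring quarter_sq)
    then show "lorentz (a i) (b (i + 1)) = 0" by (simp add: mu_nu)
    show "lorentz (a i) (hom v) = 0" "lorentz (b i) (hom w) = 0"
      "lorentz (a i) (hom w) < 0" "lorentz (b i) (hom v) < 0"
      using mu_pos[of i] nu_pos[of i] by (simp_all add: a_def b_def v_def w_def hom_def lorentz_vector)
    show "\<exists>r. a i + a (i + 2) = r *\<^sub>R hom v"
      by (rule exI[of _ "mu i + mu (i + 2)"])
        (simp add: a_def v_def hom_def vec_eq_iff forall_3 quarter_opp)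
    show "\<exists>r. b i + b (i + 2) = r *\<^sub>R hom w"
      by (rule exI[of _ "nu i + nu (i + 2)"])
        (simp add: b_def w_def hom_def vec_eq_iff forall_3 quarter_opp)
  qed (use c in \<open>simp_all add: v_def w_def norm_eq_1 inner_vec_def sum_3\<close>)
  interpret N: trapezohedral_normals a b v w c by (rule normals)
  have "N.x = x" by (rule angle_root_unique[OF c N.angle_root_x x])
  then have "trapezohedral_polytope a b v w c"
    by unfold_locales (simp add: gap)
  then show thesis by (rule that)
qed

lemma trapezohedron_exists:
  assumes c: "c \<in> cos_box" and x: "angle_root c x" and gap: "\<And>i. 0 < edge_gap c x i"
  shows "c \<in> \<A>'"
proof -
  obtain a b v w where poly: "trapezohedral_polytope a b v w c"
    using trapezohedral_polytope_exists[OF assms] .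
  interpret trapezohedral_polytope a b v w c by (rule poly)
  define \<alpha> :: "real^4" where "\<alpha> = (\<chi> i. arccos (c $ i))"
  have \<alpha>: "0 \<le> \<alpha> $ i \<and> \<alpha> $ i < pi" for i
  proof -
    have "arccos (c $ i) < arccos (-1)" using cos_boxD[OF c, of i] by (intro arccos_less_arccos) auto
    then show ?thesis using arccos_lbound[of "c $ i"] cos_boxD[OF c, of i] by (simp add: \<alpha>_def)
  qed
  have cos: "cos_vec \<alpha> = c"
    using cos_boxD[OF c] by (simp add: cos_vec_def \<alpha>_def vec_eq_iff less_imp_le)
  have "hyp_volume (body \<inter> hyp_space) < \<infinity>"
    unfolding body_eq_hull using vertices_ball by (intro hyp_volume_hull_finite finite_vertices) auto
  then have "trapezohedron (body \<inter> hyp_space) v w P Q \<alpha>" by (rule trapezohedron_body[OF \<alpha> cos])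
  then have "\<alpha> \<in> \<A>" using \<alpha> unfolding angle_set_def by blast
  then show ?thesis using cos by (auto simp: cos_angle_set_def)
qed

section \<open>Necessity of positive gaps, edge length, and the description of the cosine
  set\<close>

context realization begin

lemma Q_multiple:
  obtains r where "0 < r" "hom (Q i) = r *\<^sub>R q i"
proof -
  define r where "r = lorentz (hom (Q i)) (hom vm) / lorentz (q i) (hom vm)"
  have eq: "hom (Q i) = r *\<^sub>R q i"
    unfolding r_def by (rule q_unique) (simp_all add: lorentz_commute[of "hom _"] a_zero b_zero)
  have "lorentz (hom (Q i)) (hom vm) < 0"
    using norms by (intro lorentz_light_neg verts_norm) (simp_all add: labels)
  moreover have "lorentz (q i) (hom vm) < 0" using k_pos mu_pos[of i] by (simp add: q_w)
  ultimately have "0 < r" by (simp add: r_def divide_neg_neg)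
  then show thesis using that eq by blast
qed

lemma P_multiple:
  obtains r where "0 < r" "hom (P i) = r *\<^sub>R p i"
proof -
  define r where "r = lorentz (hom (P i)) (hom vp) / lorentz (p (i - 1 + 1)) (hom vp)"
  have eq: "hom (P i) = r *\<^sub>R p (i - 1 + 1)"
    unfolding r_def using a_zero(4)[of "i - 1"]
    by (intro p_unique) (simp_all add: lorentz_commute[of "hom _"] a_zero b_zero)
  have "lorentz (hom (P i)) (hom vp) < 0"
    using norms by (intro lorentz_light_neg verts_norm) (simp_all add: labels)
  moreover have "lorentz (p i) (hom vp) < 0" using k_pos nu_pos[of i] by (simp add: p_v)
  ultimately have "0 < r" by (simp add: r_def divide_neg_neg)
  then show thesis using that eq by simp
qed

text \<open>\<open>Q i\<close> is not a vertex of the face \<open>A (i + 1)\<close>, hence lies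
  strictly inside its half-space; by \<open>q_a_next\<close> this is positivity of the gap.\<close>

lemma edge_gap_pos: "0 < edge_gap (cos_vec \<alpha>) x i"
proof -
  obtain r where r: "0 < r" "hom (Q i) = r *\<^sub>R q i" by (rule Q_multiple)
  have "r * lorentz (q i) (a (i + 1)) < 0"
    using a_neg(4)[of i] r(2) by (simp add: lorentz_commute[of "a _"])
  then have "lorentz (q i) (a (i + 1)) < 0" using r(1) by (simp add: mult_less_0_iff)
  then have "y * lorentz (q i) (a (i + 1)) < 0" using y_pos by (simp add: mult_pos_neg)
  then have "0 < k * mu i * edge_gap (cos_vec \<alpha>) x i" unfolding q_a_next by simp
  then show ?thesis using mult_pos_pos[OF k_pos mu_pos[of i]] by (simp add: zero_less_mult_iff)
qed

lemma lorentz_hom_self: "lorentz (hom X) (hom X) = (norm X)\<^sup>2 - 1"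
  by (simp add: lorentz_def hom_def power2_norm_eq_inner)

text \<open>The scale factors of both vertices cancel, and \<open>k * mu i * nu (i + 1)\<close>
  equals \<open>y\<close>. What remains depends on the cosines and the root only, so it is the same
  for every realization.\<close>

lemma hyp_dist_edge:
  defines "c \<equiv> cos_vec \<alpha>"
  assumes lt: "c $ i < 1" "c $ (i + 1) < 1"
  shows "Q i \<in> hyp_space" "P (i + 1) \<in> hyp_space"
    "hyp_dist (Q i) (P (i + 1)) = arcosh ((1 + c $ i * c $ (i + 1) + x * (c $ i + c $ (i + 1))) /
      (sqrt (1 - x\<^sup>2) * sqrt (1 - (c $ i)\<^sup>2) * sqrt (1 - (c $ (i + 1))\<^sup>2)))"
proof -
  define s s' where "s = 1 - (c $ i)\<^sup>2" and "s' = 1 - (c $ (i + 1))\<^sup>2"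
  have s: "0 < s" "0 < s'"
    using lt cos_boxD[OF c_box, of i] cos_boxD[OF c_box, of "i + 1"]
    by (simp_all add: s_def s'_def c_def abs_square_less_1 abs_less_iff)
  obtain r where r: "0 < r" "hom (Q i) = r *\<^sub>R q i" by (rule Q_multiple)
  obtain r' where r': "0 < r'" "hom (P (i + 1)) = r' *\<^sub>R p (i + 1)" by (rule P_multiple)
  have Q: "1 - (norm (Q i))\<^sup>2 = (r * k * mu i)\<^sup>2 * s"
    using lorentz_hom_self[of "Q i"] unfolding r(2) lorentz_bilinear q_q
    by (simp add: s_def c_def power2_eq_square algebra_simps)
  have P: "1 - (norm (P (i + 1)))\<^sup>2 = (r' * k * nu (i + 1))\<^sup>2 * s'"
    using lorentz_hom_self[of "P (i + 1)"] unfolding r'(2) lorentz_bilinear p_p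
    by (simp add: s'_def c_def power2_eq_square algebra_simps)
  have rk: "0 < r * k * mu i" "0 < r' * k * nu (i + 1)" using r(1) r'(1) k_pos mu_pos nu_pos by simp_all
  have "0 < 1 - (norm (Q i))\<^sup>2" "0 < 1 - (norm (P (i + 1)))\<^sup>2"
    unfolding Q P by (intro mult_pos_pos zero_less_power rk s)+
  then show "Q i \<in> hyp_space" "P (i + 1) \<in> hyp_space"
    by (simp_all add: hyp_space_def abs_square_less_1)
  have QP: "1 - Q i \<bullet> P (i + 1) = r * r' * k * (1 + c $ i * c $ (i + 1) + x * (c $ i + c $ (i + 1)))"
  proof -
    have "1 - Q i \<bullet> P (i + 1) = - lorentz (hom (Q i)) (hom (P (i + 1)))" by (simp add: lorentz_def hom_def)
    then show ?thesis unfolding r(2) r'(2) lorentz_bilinear q_p by (simp add: c_def)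
  qed
  have y_eq: "sqrt (1 - x\<^sup>2) = y" using xy y_pos by (metis add_diff_cancel_left' less_imp_le real_sqrt_unique)
  have den: "sqrt (1 - (norm (Q i))\<^sup>2) * sqrt (1 - (norm (P (i + 1)))\<^sup>2)
      = r * r' * k * (sqrt (1 - x\<^sup>2) * sqrt s * sqrt s')"
  proof -
    have "sqrt (1 - (norm (Q i))\<^sup>2) * sqrt (1 - (norm (P (i + 1)))\<^sup>2)
       = (r * k * mu i) * sqrt s * ((r' * k * nu (i + 1)) * sqrt s')"
      unfolding Q P using rk by (simp add: real_sqrt_mult)
    also have "\<dots> = r * r' * k * ((k * mu i * nu (i + 1)) * sqrt s * sqrt s')" by (simp add: mult_ac)
    finally show ?thesis unfolding k_mu_nu y_eq .
  qed
  have "r * r' * k \<noteq> 0" using r(1) r'(1) k_pos by simp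
  show "hyp_dist (Q i) (P (i + 1)) = arcosh ((1 + c $ i * c $ (i + 1) + x * (c $ i + c $ (i + 1))) /
      (sqrt (1 - x\<^sup>2) * sqrt (1 - (c $ i)\<^sup>2) * sqrt (1 - (c $ (i + 1))\<^sup>2)))"
    unfolding hyp_dist_def QP den s_def[symmetric] s'_def[symmetric]
      mult_divide_mult_cancel_left[OF \<open>r * r' * k \<noteq> 0\<close>] ..
qed

end

lemma cos_angle_set_gap:
  assumes "c \<in> \<A>'"
  obtains x where "c \<in> cos_box" "angle_root c x" "\<And>i. 0 < edge_gap c x i"
proof -
  obtain \<alpha> K vp vm P Q where tr: "trapezohedron K vp vm P Q \<alpha>" and c: "c = cos_vec \<alpha>"
    using assms by (auto simp: cos_angle_set_def angle_set_def)
  interpret realization K vp vm P Q \<alpha> by unfold_locales (rule tr)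
  show thesis using that[of x] c_box angle_root_x edge_gap_pos unfolding c by blast
qed

lemma cos_angle_set_iff:
  assumes "c \<in> cos_box" "angle_root c x"
  shows "c \<in> \<A>' \<longleftrightarrow> (\<forall>i. 0 < edge_gap c x i)"
  using cos_angle_set_gap[of c] trapezohedron_exists[OF assms] angle_root_unique[OF assms] by metis

lemma cos_angle_set_eq: "\<A>' = {c \<in> cos_box. \<forall>i. Phi i c < 0 \<or> c $ i + c $ (i + 1) > 0}"
proof -
  have "c \<in> \<A>' \<longleftrightarrow> (\<forall>i. Phi i c < 0 \<or> c $ i + c $ (i + 1) > 0)" if c: "c \<in> cos_box" for c
  proof -
    obtain x where x: "angle_root c x" using angle_root_exists[OF c] .
    show ?thesis unfolding cos_angle_set_iff[OF c x] edge_gap_pos_iff[OF c x] ..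
  qed
  then show ?thesis using cos_angle_set_gap by blast
qed

subsection \<open>Frontier and degeneration\<close>

lemma one_plus_root_mult_pos:
  assumes "c \<in> cos_box" "angle_root c x"
  shows "0 < 1 + x * c $ i"
  using one_plus_mult_pos[of x "c $ i"] angle_root_gt[OF assms] angle_rootD(2)[OF assms(2)] cos_boxD[OF assms(1)]
  by simp

text \<open>The last factors are positive for a root, so comparing neighbouring gaps amounts to
  comparing opposite cosines.\<close>

lemma edge_gap_diff:
  "edge_gap c x (i + 1) - edge_gap c x i = (c $ (i + 2) - c $ i) * (1 + x * c $ (i + 1))"
  "edge_gap c x (i - 1) - edge_gap c x i = (c $ (i + 3) - c $ (i + 1)) * (1 + x * c $ i)"
proof -
  have "i - 1 = i + 3" "i + 3 + 1 = i" by (simp_all add: algebra_simps)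
  then show "edge_gap c x (i - 1) - edge_gap c x i = (c $ (i + 3) - c $ (i + 1)) * (1 + x * c $ i)"
    unfolding edge_gap_def by (simp only:) (simp add: algebra_simps)
qed (simp add: edge_gap_def algebra_simps)

lemma boundary_piece_iff:
  assumes c: "c \<in> cos_box" and x: "angle_root c x"
  shows "c \<in> boundary_piece i \<longleftrightarrow>
    edge_gap c x i = 0 \<and> c $ i \<le> c $ (i + 2) \<and> c $ (i + 1) \<le> c $ (i + 3)"
proof -
  have "Phi i c = 0 \<and> c $ i + c $ (i + 1) \<le> 0 \<longleftrightarrow> edge_gap c x i = 0"
    using edge_gap_iff_Phi(2)[OF c x, of i] edge_gap_pos_of_sum_pos[OF c x, of i] by (metis less_irrefl not_less)
  then show ?thesis using c by (auto simp: boundary_piece_def)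
qed

text \<open>The vanishing gap is \<open>(a + x) + b * (1 + x * a)\<close> with positive first
  summand and positive factor of \<open>b\<close>, so \<open>b\<close> is negative; the roles of the
  two cosines can be exchanged.\<close>

lemma boundary_piece_neg:
  assumes c: "c \<in> cos_box" and x: "angle_root c x" and gap: "edge_gap c x i = 0"
  shows "c $ i < 0" "c $ (i + 1) < 0"
proof -
  have *: "b < 0" if "0 < a + x" "0 < 1 + x * a" "a + b + x * (1 + a * b) = 0" for a b :: real
  proof (rule ccontr)
    assume "\<not> b < 0"
    then have "0 \<le> b * (1 + x * a)" using that(2) by simp
    moreover have "(a + x) + b * (1 + x * a) = 0" using that(3) by (simp add: algebra_simps)
    ultimately show False using that(1) by linarith
  qed
  note facts = angle_rootD(1)[OF x] one_plus_root_mult_pos[OF c x]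
  show "c $ (i + 1) < 0" using *[of "c $ i" "c $ (i + 1)"] facts gap by (simp add: edge_gap_def)
  show "c $ i < 0" using *[of "c $ (i + 1)" "c $ i"] facts gap by (simp add: edge_gap_def add.commute mult.commute)
qed

lemma cos_angle_set_open:
  obtains U where "open U" "\<A>' = cos_box \<inter> U"
proof
  have open1: "open {c :: real^4. Phi i c < 0}" "open {c :: real^4. 0 < c $ i + c $ (i + 1)}" for i
    unfolding Phi_def by (intro open_Collect_less continuous_intros)+
  show "open (\<Inter>i. {c. Phi i c < 0} \<union> {c. 0 < c $ i + c $ (i + 1)})"
    using open1 by (intro open_INT open_Un) auto
  show "\<A>' = cos_box \<inter> (\<Inter>i. {c. Phi i c < 0} \<union> {c. 0 < c $ i + c $ (i + 1)})"
    by (auto simp: cos_angle_set_eq)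
qed

lemma frontier_cos_angle_set: "(top_of_set cos_box) frontier_of \<A>' = cos_box \<inter> closure \<A>' - \<A>'"
proof -
  obtain U where U: "open U" "\<A>' = cos_box \<inter> U" using cos_angle_set_open .
  then have "openin (top_of_set cos_box) \<A>'" by (auto simp: openin_open)
  then have "(top_of_set cos_box) interior_of \<A>' = \<A>'" by (simp add: interior_of_openin)
  moreover have "cos_box \<inter> \<A>' = \<A>'" using U by auto
  ultimately show ?thesis by (simp add: frontier_of_def closure_of_subtopology)
qed

lemma closure_gap_nonneg:
  assumes "c \<in> closure \<A>'" and c: "c \<in> cos_box" and x: "angle_root c x"
  shows "0 \<le> edge_gap c x i"
proof -
  have "closed ({c :: real^4. Phi i c \<le> 0} \<union> {c. 0 \<le> c $ i + c $ (i + 1)})"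
    unfolding Phi_def by (intro closed_Un closed_Collect_le continuous_intros)
  moreover have "\<A>' \<subseteq> {c. Phi i c \<le> 0} \<union> {c. 0 \<le> c $ i + c $ (i + 1)}"
    unfolding cos_angle_set_eq by (auto intro: less_imp_le)
  ultimately have "c \<in> {c. Phi i c \<le> 0} \<union> {c. 0 \<le> c $ i + c $ (i + 1)}"
    using assms(1) closure_minimal by blast
  then consider "0 < c $ i + c $ (i + 1)" | "c $ i + c $ (i + 1) \<le> 0" "Phi i c \<le> 0" | "c $ (i + 1) = - c $ i"
    by fastforce
  then show ?thesis
  proof cases
    case 1 then show ?thesis using edge_gap_pos_of_sum_pos[OF c x] by (simp add: less_imp_le)
  next
    case 2 then show ?thesis using edge_gap_iff_Phi[OF c x] by (metis less_eq_real_def)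
  next
    \<comment> \<open>On the wall between the two alternatives, \<open>c $ i + x\<close> and
      \<open>- c $ i + x\<close> are both positive. Hence \<open>x\<close> is positive, and so is
      the gap.\<close>
    case 3
    have "0 < x" using angle_rootD(1)[OF x, of i] angle_rootD(1)[OF x, of "i + 1"] 3 by linarith
    moreover have "0 < 1 + c $ i * c $ (i + 1)" using cos_boxD[OF c] by (intro one_plus_mult_pos) auto
    ultimately show ?thesis using 3 by (simp add: edge_gap_def)
  qed
qed

text \<open>With both opposite pairs equal the root equation is a square, and together with the
  vanishing gap it forces \<open>c $ i * c $ (i + 1) = 1\<close>, impossible for two numbers
  strictly between -1 and 0. Thus at least one of the two inequalities of a boundary piece is
  strict.\<close>

lemma boundary_piece_not_square:
  assumes c: "c \<in> cos_box" and x: "angle_root c x" and gap: "edge_gap c x i = 0"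
  shows "c $ (i + 2) \<noteq> c $ i \<or> c $ (i + 3) \<noteq> c $ (i + 1)"
proof (rule ccontr)
  assume "\<not> ?thesis"
  then have eq: "c $ (i + 2) = c $ i" "c $ (i + 3) = c $ (i + 1)" by auto
  have x2: "x\<^sup>2 < 1" using angle_root_gt[OF c x] angle_rootD(2)[OF x] by (simp add: abs_square_less_1)
  define r where "r = (c $ i + x) * (c $ (i + 1) + x)"
  have "0 < r" using angle_rootD(1)[OF x] by (simp add: r_def)
  moreover have "r\<^sup>2 = (1 - x\<^sup>2)\<^sup>2"
    using angle_rootD(3)[OF x] unfolding prod_4_shift[of _ i] eq by (simp add: r_def power2_eq_square mult_ac)
  ultimately have r: "r = 1 - x\<^sup>2" using x2 by (simp add: power2_eq_iff_nonneg)
  have "(c $ i * c $ (i + 1) - 1) * (1 - x\<^sup>2) = r - (1 - x\<^sup>2) - x * edge_gap c x i"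
    by (simp add: r_def edge_gap_def algebra_simps power2_eq_square)
  also have "\<dots> = 0" using r gap by simp
  finally have "c $ i * c $ (i + 1) = 1" using x2 by simp
  moreover have "- c $ i * - c $ (i + 1) < 1 * 1"
    using boundary_piece_neg[OF c x gap] cos_boxD(1)[OF c, of i] cos_boxD(1)[OF c, of "i + 1"]
    by (intro mult_strict_mono) auto
  ultimately show False by simp
qed

text \<open>Under this ordering gap \<open>i\<close> is the smallest of the four: it bounds its two
  neighbours from below, and gap \<open>i + 2\<close> is reached through gap
  \<open>i + 1\<close>.\<close>

lemma gap_pos_of_Phi_neg:
  assumes c: "c \<in> cos_box" and le: "c $ i \<le> c $ (i + 2)" "c $ (i + 1) \<le> c $ (i + 3)" and Phi: "Phi i c < 0"
  shows "c \<in> \<A>'"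
proof -
  obtain x where x: "angle_root c x" using angle_root_exists[OF c] .
  note pos = one_plus_root_mult_pos[OF c x]
  have i: "0 < edge_gap c x i" using Phi edge_gap_pos_iff[OF c x] by blast
  have i1: "0 < edge_gap c x (i + 1)"
  proof -
    have "0 \<le> edge_gap c x (i + 1) - edge_gap c x i"
      unfolding edge_gap_diff using le pos[of "i + 1"] by simp
    then show ?thesis using i by simp
  qed
  have i2: "0 < edge_gap c x (i + 2)"
  proof -
    have "0 \<le> edge_gap c x (i + 1 + 1) - edge_gap c x (i + 1)"
      unfolding edge_gap_diff using le pos[of "i + 2"] by (simp add: add.assoc)
    then show ?thesis using i1 by (simp add: add.assoc)
  qed
  have i3: "0 < edge_gap c x (i - 1)"
  proof -
    have "0 \<le> edge_gap c x (i - 1) - edge_gap c x i"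
      unfolding edge_gap_diff using le pos[of i] by simp
    then show ?thesis using i by simp
  qed
  have "0 < edge_gap c x j" for j
    by (cases rule: index_cases[of j i]) (use i i1 i2 i3 in simp_all)
  then show ?thesis using cos_angle_set_iff[OF c x] by blast
qed

text \<open>Lower \<open>c $ (i + 2)\<close> or \<open>c $ (i + 3)\<close>, whichever exceeds its
  opposite cosine. \<open>Phi i\<close> is affine in it with positive slope, so it becomes negative.
  Stopping at the opposite cosine keeps the ordering, and \<open>gap_pos_of_Phi_neg\<close>
  applies.\<close>

lemma boundary_piece_closure:
  assumes "c \<in> boundary_piece i"
  shows "c \<in> closure \<A>'"
proof -
  have c: "c \<in> cos_box" using assms by (simp add: boundary_piece_def)
  obtain x where x: "angle_root c x" using angle_root_exists[OF c] .
  have gap: "edge_gap c x i = 0" and le: "c $ i \<le> c $ (i + 2)" "c $ (i + 1) \<le> c $ (i + 3)"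
    using assms boundary_piece_iff[OF c x] by auto
  have Phi0: "Phi i c = 0" using assms by (simp add: boundary_piece_def)
  define a b d e where "a = c $ i" and "b = c $ (i + 1)" and "d = c $ (i + 2)" and "e = c $ (i + 3)"
  have neg: "a < 0" "b < 0" using boundary_piece_neg[OF c x gap] by (simp_all add: a_def b_def)
  have p: "0 < a * b" using neg by (rule mult_neg_neg)
  have sum: "- (a + b) = x * (1 + a * b)" using gap by (simp add: edge_gap_def a_def b_def)
  have pos: "0 < d + x" "0 < e + x" using angle_rootD(1)[OF x] by (simp_all add: d_def e_def)
  \<comment> \<open>The left side with \<open>t = e\<close> is the slope of \<open>Phi i\<close> in
    \<open>d\<close>, and with \<open>t = d\<close> the slope in \<open>e\<close>; the vanishing gap
    factors it.\<close>
  have slope: "a * b * (a * b + 1) * t - a * b * (a + b) = a * b * (1 + a * b) * (t + x)" for t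
  proof -
    have "a * b * (a * b + 1) * t - a * b * (a + b) = a * b * ((1 + a * b) * t + - (a + b))"
      by (simp add: algebra_simps)
    then show ?thesis unfolding sum by (simp add: algebra_simps)
  qed
  define lower where "lower j t = c - t *\<^sub>R axis j 1" for j :: 4 and t :: real
  have lower: "lower j t $ j' = (if j' = j then c $ j - t else c $ j')" for j j' t
    by (simp add: lower_def axis_def)
  obtain j where j: "0 < c $ j - c $ (j - 2)" and mem: "\<And>t. 0 < t \<Longrightarrow> t \<le> c $ j - c $ (j - 2) \<Longrightarrow> lower j t \<in> \<A>'"
  proof (cases "a < d")
    case True
    show thesis
    proof (rule that[of "i + 2"])
      show "0 < c $ (i + 2) - c $ (i + 2 - 2)" using True by (simp add: a_def d_def)
      fix t assume t: "0 < t" "t \<le> c $ (i + 2) - c $ (i + 2 - 2)"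
      have "i + 3 \<noteq> i + 2" by simp
      then have vals: "lower (i + 2) t $ i = a" "lower (i + 2) t $ (i + 1) = b"
        "lower (i + 2) t $ (i + 2) = d - t" "lower (i + 2) t $ (i + 3) = e"
        by (simp_all add: lower a_def b_def d_def e_def)
      have "Phi i (lower (i + 2) t) = Phi i c - t * (a * b * (a * b + 1) * e - a * b * (a + b))"
        unfolding Phi_def vals a_def[symmetric] b_def[symmetric] d_def[symmetric] e_def[symmetric]
        by (simp add: algebra_simps)
      also have "\<dots> < 0" unfolding Phi0 slope using t p pos by simp
      finally have "Phi i (lower (i + 2) t) < 0" .
      moreover have "lower (i + 2) t \<in> cos_box"
        using cos_boxD[OF c] t by (auto simp: cos_box_def lower) (smt (verit) add_diff_cancel_right')+
      ultimately show "lower (i + 2) t \<in> \<A>'"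
        by (intro gap_pos_of_Phi_neg) (use t le in \<open>simp_all add: vals a_def b_def d_def e_def\<close>)
    qed
  next
    case False
    then have "b < e" using boundary_piece_not_square[OF c x gap] le by (auto simp: a_def b_def d_def e_def)
    show thesis
    proof (rule that[of "i + 3"])
      have [simp]: "i + 3 - 2 = i + 1" by simp
      show "0 < c $ (i + 3) - c $ (i + 3 - 2)" using \<open>b < e\<close> by (simp add: b_def e_def)
      fix t assume t: "0 < t" "t \<le> c $ (i + 3) - c $ (i + 3 - 2)"
      have "i \<noteq> i + 3" "i + 1 \<noteq> i + 3" "i + 2 \<noteq> i + 3" by simp_all
      then have vals: "lower (i + 3) t $ i = a" "lower (i + 3) t $ (i + 1) = b"
        "lower (i + 3) t $ (i + 2) = d" "lower (i + 3) t $ (i + 3) = e - t"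
        by (simp_all add: lower a_def b_def d_def e_def)
      have "Phi i (lower (i + 3) t) = Phi i c - t * (a * b * (a * b + 1) * d - a * b * (a + b))"
        unfolding Phi_def vals a_def[symmetric] b_def[symmetric] d_def[symmetric] e_def[symmetric]
        by (simp add: algebra_simps)
      also have "\<dots> < 0" unfolding Phi0 slope using t p pos by simp
      finally have "Phi i (lower (i + 3) t) < 0" .
      moreover have "lower (i + 3) t \<in> cos_box"
        using cos_boxD[OF c] t by (auto simp: cos_box_def lower) (smt (verit) add_diff_cancel_right')+
      ultimately show "lower (i + 3) t \<in> \<A>'"
        by (intro gap_pos_of_Phi_neg) (use t le in \<open>simp_all add: vals a_def b_def d_def e_def\<close>)
    qed
  qed
  show ?thesis unfolding closure_approachable
  proof (intro allI impI)
    fix \<epsilon> :: real assume "0 < \<epsilon>"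
    define t where "t = min (\<epsilon> / 2) (c $ j - c $ (j - 2))"
    have "0 < t" "t \<le> c $ j - c $ (j - 2)" "t < \<epsilon>" using j \<open>0 < \<epsilon>\<close> by (auto simp: t_def)
    then have "lower j t \<in> \<A>'" "dist (lower j t) c < \<epsilon>" using mem by (simp_all add: lower_def dist_norm norm_axis_1)
    then show "\<exists>y\<in>\<A>'. dist y c < \<epsilon>" by blast
  qed
qed

text \<open>At a limit point outside the set all gaps are nonnegative and some gap \<open>i\<close>
  is zero. Nonnegativity of its two neighbours, read through \<open>edge_gap_diff\<close>, gives the
  inequalities of the boundary piece.\<close>

lemma frontier_eq: "(top_of_set cos_box) frontier_of \<A>' = (\<Union>i. boundary_piece i)"
proof -
  have "c \<in> (\<Union>i. boundary_piece i)" if cl: "c \<in> closure \<A>'" and c: "c \<in> cos_box" and notin: "c \<notin> \<A>'" for c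
  proof -
    obtain x where x: "angle_root c x" using angle_root_exists[OF c] .
    note nonneg = closure_gap_nonneg[OF cl c x]
    obtain i where "\<not> 0 < edge_gap c x i" using notin cos_angle_set_iff[OF c x] by blast
    then have i: "edge_gap c x i = 0" using nonneg[of i] by linarith
    have "0 \<le> (c $ (i + 2) - c $ i) * (1 + x * c $ (i + 1))" "0 \<le> (c $ (i + 3) - c $ (i + 1)) * (1 + x * c $ i)"
      using nonneg[of "i + 1"] nonneg[of "i - 1"] i by (simp_all flip: edge_gap_diff)
    then have "c $ i \<le> c $ (i + 2)" "c $ (i + 1) \<le> c $ (i + 3)"
      using one_plus_root_mult_pos[OF c x] by (auto simp: zero_le_mult_iff not_le[symmetric] dest: less_imp_le)
    then show ?thesis using i boundary_piece_iff[OF c x] by blast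
  qed
  moreover have "c \<in> cos_box" "c \<in> closure \<A>'" "c \<notin> \<A>'" if "c \<in> boundary_piece i" for c i
  proof -
    show "c \<in> cos_box" "c \<in> closure \<A>'" using that boundary_piece_closure by (auto simp: boundary_piece_def)
    show "c \<notin> \<A>'" using that unfolding cos_angle_set_eq boundary_piece_def by (auto intro!: exI[of _ i])
  qed
  ultimately show ?thesis unfolding frontier_cos_angle_set by blast
qed

lemma cos_angle_set_neq_box: "\<A>' \<noteq> cos_box"
proof -
  \<comment> \<open>Two neighbouring angles close to \<open>pi\<close> and the other two equal to 0:
    \<open>Phi 0\<close> is positive although the sum of the first two cosines is negative.\<close>
  define c :: "real^4" where "c = (\<chi> j. if j = 0 \<or> j = 1 then - 9 / 10 else 1)"
  have vals: "c $ 0 = - 9 / 10" "c $ 1 = - 9 / 10" "c $ 2 = 1" "c $ 3 = 1" by (simp_all add: c_def)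
  have "c \<in> cos_box" by (simp add: cos_box_def c_def)
  moreover have "\<not> (Phi 0 c < 0 \<or> 0 < c $ 0 + c $ (0 + 1))" by (simp add: Phi_def vals power2_eq_square)
  then have "c \<notin> \<A>'" unfolding cos_angle_set_eq by blast
  ultimately show ?thesis by blast
qed

text \<open>At a fixed \<open>t\<close> beside the root at \<open>c0\<close>, the strict comparison
  of the two sides of the root equation persists for nearby \<open>c\<close>;
  \<open>angle_root_less\<close> turns it back into a bound on the root there.\<close>

lemma angle_root_tendsto:
  assumes c0: "c0 \<in> cos_box" and x0: "angle_root c0 x0" and \<rho>: "\<And>c. c \<in> cos_box \<Longrightarrow> angle_root c (\<rho> c)"
  shows "(\<rho> \<longlongrightarrow> x0) (at c0 within cos_box)"
proof -
  have prod: "((\<lambda>c. \<Prod>j\<in>UNIV. c $ j + t) \<longlongrightarrow> (\<Prod>j\<in>UNIV. c0 $ j + t)) (at c0 within cos_box)" for t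
    by (intro tendsto_intros)
  have coord: "\<forall>\<^sub>F c in at c0 within cos_box. \<forall>j. 0 < c $ j + t" if "\<And>j. 0 < c0 $ j + t" for t
  proof -
    have "((\<lambda>c. c $ j + t) \<longlongrightarrow> c0 $ j + t) (at c0 within cos_box)" for j by (intro tendsto_intros)
    then have "\<forall>\<^sub>F c in at c0 within cos_box. 0 < c $ j + t" for j using that[of j] by (rule order_tendstoD)
    then show ?thesis by (simp add: eventually_all_finite)
  qed
  have box: "\<forall>\<^sub>F c in at c0 within cos_box. c \<in> cos_box" by (simp add: eventually_at_filter)
  show ?thesis
  proof (rule order_tendstoI)
    fix l assume l: "l < x0"
    define \<delta> where "\<delta> = Min (range (\<lambda>j. c0 $ j + x0))"
    have "0 < \<delta>" using angle_rootD(1)[OF x0] by (simp add: \<delta>_def)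
    have \<delta>_le: "\<delta> \<le> c0 $ j + x0" for j by (simp add: \<delta>_def)
    \<comment> \<open>Staying within \<open>\<delta> / 2\<close> of the root keeps every
      \<open>c0 $ j + t\<close> positive, as \<open>angle_root_less\<close> requires.\<close>
    define t where "t = max l (x0 - \<delta> / 2)"
    have t: "t < x0" "l \<le> t" "t < 1" using l \<open>0 < \<delta>\<close> angle_rootD(2)[OF x0] by (auto simp: t_def)
    have pos: "0 < c0 $ j + t" for j using \<delta>_le[of j] \<open>0 < \<delta>\<close> by (auto simp: t_def)
    have "(\<Prod>j\<in>UNIV. c0 $ j + t) < (1 - t\<^sup>2)\<^sup>2" using angle_root_less(1)[OF c0 x0 pos t(3)] t(1) by simp
    with prod have "\<forall>\<^sub>F c in at c0 within cos_box. (\<Prod>j\<in>UNIV. c $ j + t) < (1 - t\<^sup>2)\<^sup>2" by (rule order_tendstoD)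
    with coord[OF pos] box show "\<forall>\<^sub>F c in at c0 within cos_box. l < \<rho> c"
    proof eventually_elim
      case (elim c)
      then have "t < \<rho> c" using angle_root_less(1)[OF elim(2) \<rho>[OF elim(2)], of t] t(3) by simp
      then show ?case using t by simp
    qed
  next
    fix t assume t: "x0 < t"
    show "\<forall>\<^sub>F c in at c0 within cos_box. \<rho> c < t"
    proof (cases "t < 1")
      case False
      from box show ?thesis
      proof eventually_elim
        case (elim c)
        then show ?case using angle_rootD(2)[OF \<rho>[OF elim]] False by simp
      qed
    next
      case True
      have pos: "0 < c0 $ j + t" for j using angle_rootD(1)[OF x0, of j] t by simp
      have "(1 - t\<^sup>2)\<^sup>2 < (\<Prod>j\<in>UNIV. c0 $ j + t)"
        using angle_root_less[OF c0 x0 pos True] t by auto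
      with prod have "\<forall>\<^sub>F c in at c0 within cos_box. (1 - t\<^sup>2)\<^sup>2 < (\<Prod>j\<in>UNIV. c $ j + t)" by (rule order_tendstoD)
      with coord[OF pos] box show ?thesis
      proof eventually_elim
        case (elim c)
        then show ?case using angle_root_less[OF elim(2) \<rho>[OF elim(2)], of t] True by auto
      qed
    qed
  qed
qed

text \<open>The hyperbolic cosine of the edge length is \<open>N c / D c\<close>, and the square of
  \<open>N c\<close> is the square of the gap plus the square of \<open>D c\<close>. Where the gap
  vanishes the quotient is 1, and by continuity of the root the length tends to 0.\<close>

lemma edge_degenerates:
  assumes "c0 \<in> boundary_piece i"
  shows "edge_degenerates_at i c0"
proof -
  define \<rho> where "\<rho> c = (SOME x. angle_root c x)" for c
  have \<rho>: "angle_root c (\<rho> c)" if c: "c \<in> cos_box" for c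
  proof -
    obtain x where "angle_root c x" using angle_root_exists[OF c] .
    then show ?thesis unfolding \<rho>_def by (rule someI)
  qed
  have c0: "c0 \<in> cos_box" using assms by (simp add: boundary_piece_def)
  define N where "N c = 1 + c $ i * c $ (i + 1) + \<rho> c * (c $ i + c $ (i + 1))" for c :: "real^4"
  define D where "D c = sqrt (1 - (\<rho> c)\<^sup>2) * sqrt (1 - (c $ i)\<^sup>2) * sqrt (1 - (c $ (i + 1))\<^sup>2)" for c :: "real^4"
  have ND: "(N c)\<^sup>2 = (edge_gap c (\<rho> c) i)\<^sup>2 + (D c)\<^sup>2" "0 < D c"
    if c: "c \<in> cos_box" and lt: "c $ i < 1" "c $ (i + 1) < 1" for c
  proof -
    have "(\<rho> c)\<^sup>2 < 1" using angle_root_gt[OF c \<rho>[OF c]] angle_rootD(2)[OF \<rho>[OF c]] by (simp add: abs_square_less_1)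
    moreover have "(c $ i)\<^sup>2 < 1" "(c $ (i + 1))\<^sup>2 < 1"
      using cos_boxD(1)[OF c, of i] cos_boxD(1)[OF c, of "i + 1"] lt by (simp_all add: abs_square_less_1)
    ultimately show "0 < D c" "(N c)\<^sup>2 = (edge_gap c (\<rho> c) i)\<^sup>2 + (D c)\<^sup>2"
      by (simp_all add: D_def N_def edge_gap_def power_mult_distrib) (simp add: algebra_simps power2_eq_square)
  qed
  have gap0: "edge_gap c0 (\<rho> c0) i = 0" using boundary_piece_iff[OF c0 \<rho>[OF c0]] assms by blast
  have neg: "c0 $ i < 0" "c0 $ (i + 1) < 0" using boundary_piece_neg[OF c0 \<rho>[OF c0] gap0] by auto
  \<comment> \<open>The squares only give \<open>N c0\<close> up to sign; the vanishing gap
    identifies it with a product of positive factors.\<close>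
  have N0: "0 < N c0"
  proof -
    have "(\<rho> c0)\<^sup>2 < 1"
      using angle_root_gt[OF c0 \<rho>[OF c0]] angle_rootD(2)[OF \<rho>[OF c0]] by (simp add: abs_square_less_1)
    moreover have "0 < c0 $ i * c0 $ (i + 1)" using neg by (rule mult_neg_neg)
    ultimately have "0 < (1 + c0 $ i * c0 $ (i + 1)) * (1 - (\<rho> c0)\<^sup>2)" by simp
    also have "\<dots> = N c0 - \<rho> c0 * edge_gap c0 (\<rho> c0) i"
      by (simp add: N_def edge_gap_def algebra_simps power2_eq_square)
    finally show ?thesis by (simp add: gap0)
  qed
  have D0: "0 < D c0" "(N c0)\<^sup>2 = (D c0)\<^sup>2" using ND[OF c0] neg by (simp_all add: gap0)
  then have ND0: "N c0 / D c0 = 1" using N0 by (simp add: power2_eq_iff_nonneg)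
  have \<rho>_lim: "(\<rho> \<longlongrightarrow> \<rho> c0) (at c0 within cos_box)" by (rule angle_root_tendsto[OF c0 \<rho>[OF c0] \<rho>])
  have N_lim: "(N \<longlongrightarrow> N c0) (at c0 within cos_box)"
    unfolding N_def by (intro tendsto_intros \<rho>_lim)
  have D_lim: "(D \<longlongrightarrow> D c0) (at c0 within cos_box)"
    unfolding D_def by (intro tendsto_intros \<rho>_lim)
  have coord: "((\<lambda>c. c $ j) \<longlongrightarrow> c0 $ j) (at c0 within cos_box)" for j by (intro tendsto_intros)
  have lt: "\<forall>\<^sub>F c in at c0 within cos_box. c $ i < 1" "\<forall>\<^sub>F c in at c0 within cos_box. c $ (i + 1) < 1"
    using order_tendstoD(2)[OF coord, of _ 1] neg by simp_all
  have box: "\<forall>\<^sub>F c in at c0 within cos_box. c \<in> cos_box" by (simp add: eventually_at_filter)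
  have "((\<lambda>c. N c / D c) \<longlongrightarrow> 1) (at c0 within cos_box)"
    using tendsto_divide[OF N_lim D_lim] D0 ND0 by simp
  \<comment> \<open>The limit value 1 is the left end of the domain of \<open>arcosh\<close>, so
    continuity there needs the quotient to stay at or above 1.\<close>
  moreover have "\<forall>\<^sub>F c in at c0 within cos_box. 1 \<le> N c / D c"
    using order_tendstoD(1)[OF N_lim N0] box lt
  proof eventually_elim
    case (elim c)
    note nd = ND[OF elim(2-4)]
    have "(D c)\<^sup>2 \<le> (N c)\<^sup>2" unfolding nd(1) by simp
    then have "D c \<le> N c" by (rule power2_le_imp_le) (use elim(1) in simp)
    then show ?case using nd(2) by simp
  qed
  ultimately have lim: "((\<lambda>c. arcosh (N c / D c)) \<longlongrightarrow> 0) (at c0 within cos_box)"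
    using tendsto_arcosh_strong[of "\<lambda>c. N c / D c" 1] by simp
  have "\<forall>\<^sub>F c in at c0 within \<A>'. \<forall>\<alpha> K vp vm P Q. trapezohedron K vp vm P Q \<alpha> \<and> cos_vec \<alpha> = c \<longrightarrow>
      Q i \<in> hyp_space \<and> P (i + 1) \<in> hyp_space \<and> hyp_dist (Q i) (P (i + 1)) < \<epsilon>" if "0 < \<epsilon>" for \<epsilon>
  proof (rule filter_leD)
    have "\<A>' \<subseteq> cos_box" by (auto simp: cos_angle_set_eq)
    then show "at c0 within \<A>' \<le> at c0 within cos_box" by (rule at_le)
    show "\<forall>\<^sub>F c in at c0 within cos_box. \<forall>\<alpha> K vp vm P Q. trapezohedron K vp vm P Q \<alpha> \<and> cos_vec \<alpha> = c \<longrightarrow>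
      Q i \<in> hyp_space \<and> P (i + 1) \<in> hyp_space \<and> hyp_dist (Q i) (P (i + 1)) < \<epsilon>"
      using order_tendstoD(2)[OF lim that] lt box
    proof eventually_elim
      case (elim c)
      show ?case
      proof (intro allI impI, elim conjE)
        fix \<alpha> K vp vm P Q assume tr: "trapezohedron K vp vm P Q \<alpha>" and c: "cos_vec \<alpha> = c"
        interpret realization K vp vm P Q \<alpha> by unfold_locales (rule tr)
        have x: "x = \<rho> c" using angle_root_unique[OF elim(4) _ \<rho>[OF elim(4)]] angle_root_x c by blast
        show "Q i \<in> hyp_space \<and> P (i + 1) \<in> hyp_space \<and> hyp_dist (Q i) (P (i + 1)) < \<epsilon>"
          using hyp_dist_edge[of i] elim by (simp add: c x N_def D_def)
      qed
    qed
  qed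
  then show ?thesis by (simp add: edge_degenerates_at_def)
qed

theorem theorem3p2:
  shows "\<A>' = {c \<in> cos_box. \<forall>i. Phi i c < 0 \<or> c $ i + c $ (i + 1) > 0}
    \<and> (top_of_set cos_box) frontier_of \<A>' = (\<Union>i. boundary_piece i)
    \<and> (\<forall>i. \<forall>c0 \<in> boundary_piece i. edge_degenerates_at i c0)
    \<and> \<A>' \<noteq> cos_box"
  using cos_angle_set_eq frontier_eq edge_degenerates cos_angle_set_neq_box by blast

end
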